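(* Let $\mathbb{K}$ be the cubian ring and $K=\mathbb{Q}(\sqrt2)$. The possible indices of similarity submodules (SSMs) of $\mathbb{K}$ are precisely the squares of nonzero rational integers that can be represented by the quadratic form $x^2-2y^2$ with $x,y\in\mathbb{Z}$. The number of SSMs of $\mathbb{K}$ of given index is a multiplicative arithmetic function of the index, and its Dirichlet series generating function $F_{\mathbb{K}}(s)=\sum_{m\ge1}|\{M : M\text{ is an SSM of }\mathbb{K},\ [\mathbb{K}:M]=m\}|\;m^{-s}$ is $$F_{\mathbb{K}}(s)=\frac{(\zeta_{\mathbb{K}}(s))^2}{\zeta_{K}(4s)}=\frac{(\zeta_{K}(2s)\,\zeta_{K}(2s-1))^2}{\zeta_{K}(4s)}$$ $$=1+\frac{6}{4^s}+\frac{22}{16^s}+\frac{32}{49^s}+\frac{66}{64^s}+\frac{20}{81^s}+\frac{192}{196^s}+\frac{178}{256^s}+\frac{72}{289^s}+\frac{120}{324^s}+\frac{96}{529^s}+\frac{52}{625^s}+\cdots$$ (the displayed terms being all nonzero terms with denominators up to $625^s$).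
   Context: $\mathbb{R}^4$ is identified with the real quaternions $\mathbb{H}(\mathbb{R})$ via the standard basis $1,i,j,k$ ($i^2=j^2=k^2=ijk=-1$). The cubian ring $\mathbb{K}$ is the $\mathbb{Z}[\sqrt2]$-span of $\{1,\ (1+i)/\sqrt2,\ (1+j)/\sqrt2,\ (1+i+j+k)/2\}$; it is a maximal order in the quaternion algebra $\mathbb{H}(\mathbb{Q}(\sqrt2))$. Similarity submodule: for a $\mathbb{Z}$-module $L\subset\mathbb{R}^4$ that spans $\mathbb{R}^4$, a subset $M\subset L$ is a similarity submodule (SSM) of $L$ if there are $\alpha\in\mathbb{R}\setminus\{0\}$ and $R\in\mathrm{O}(4)$ with $M=\alpha R(L)\subset L$. Its index is the group index $[L:M]$. SSMs are counted as subsets. $\zeta_K$ is the Dedekind zeta function of $K$. $\zeta_{\mathbb{K}}(s)=\sum_{\mathfrak{a}}[\mathbb{K}:\mathfrak{a}]^{-s}$, where $\mathfrak{a}$ runs over the non-zero left ideals of $\mathbb{K}$. A function $f$ on positive integers is multiplicative if $f(1)=1$ and $f(mn)=f(m)f(n)$ for coprime $m,n$. *)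

theory Defs
  imports "HOL-Analysis.Analysis" "HOL-Algebra.Ideal" "HOL-Computational_Algebra.Polynomial"
begin

text \<open>The multiplication \<^term>\<open>(*)\<close> on \<^typ>\<open>real^4\<close> is componentwise, so the
  Hamilton product needs a constant of its own.  The coordinates 1, 2, 3, 4 belong to the
  standard basis $1, i, j, k$.\<close>

definition qmult :: "real^4 \<Rightarrow> real^4 \<Rightarrow> real^4" where
  "qmult p q = vector
    [p$1 * q$1 - p$2 * q$2 - p$3 * q$3 - p$4 * q$4,
     p$1 * q$2 + p$2 * q$1 + p$3 * q$4 - p$4 * q$3,
     p$1 * q$3 - p$2 * q$4 + p$3 * q$1 + p$4 * q$2,
     p$1 * q$4 + p$2 * q$3 - p$3 * q$2 + p$4 * q$1]"

definition q_1 :: "real^4" where "q_1 = axis 1 1"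
definition q_i :: "real^4" where "q_i = axis 2 1"
definition q_j :: "real^4" where "q_j = axis 3 1"
definition q_k :: "real^4" where "q_k = axis 4 1"

lemma vector_4:
  "vector [a,b,c,d] $ (1::4) = a" "vector [a,b,c,d] $ (2::4) = b"
  "vector [a,b,c,d] $ (3::4) = c" "vector [a,b,c,d] $ (4::4) = d"
  unfolding vector_def by simp_all

lemma qmult_nth:
  "qmult p q $ 1 = p$1 * q$1 - p$2 * q$2 - p$3 * q$3 - p$4 * q$4"
  "qmult p q $ 2 = p$1 * q$2 + p$2 * q$1 + p$3 * q$4 - p$4 * q$3"
  "qmult p q $ 3 = p$1 * q$3 - p$2 * q$4 + p$3 * q$1 + p$4 * q$2"
  "qmult p q $ 4 = p$1 * q$4 + p$2 * q$3 - p$3 * q$2 + p$4 * q$1"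
  by (simp_all only: qmult_def vector_4)

lemma quaternion_relations:
  "qmult q_1 x = x" "qmult x q_1 = x"
  "qmult q_i q_i = - q_1" "qmult q_j q_j = - q_1" "qmult q_k q_k = - q_1"
  "qmult (qmult q_i q_j) q_k = - q_1"
  by (simp_all add: vec_eq_iff forall_4 qmult_nth q_1_def q_i_def q_j_def q_k_def axis_def)

text \<open>The group index $[L:M]$ of additive groups.  By the convention for \<^const>\<open>card\<close> it
  is 0 when there are infinitely many cosets.\<close>

definition add_index :: "'a::ab_group_add set \<Rightarrow> 'a set \<Rightarrow> nat" where
  "add_index L M = card (rcosets\<^bsub>\<lparr>carrier = L, monoid.mult = (+), one = 0\<rparr>\<^esub> M)"

definition left_ideal :: "'a set \<Rightarrow> ('a, 'b) ring_scheme \<Rightarrow> bool" where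
  "left_ideal I R \<longleftrightarrow> additive_subgroup I R \<and>
     (\<forall>r\<in>carrier R. \<forall>x\<in>I. r \<otimes>\<^bsub>R\<^esub> x \<in> I)"

definition Z_sqrt2 :: "real set" where
  "Z_sqrt2 = {of_int a + of_int b * sqrt 2 | a b. True}"

definition cubian :: "(real^4) set" where
  "cubian = {a *\<^sub>R q_1 + b *\<^sub>R ((q_1 + q_i) /\<^sub>R sqrt 2) + c *\<^sub>R ((q_1 + q_j) /\<^sub>R sqrt 2)
              + d *\<^sub>R ((q_1 + q_i + q_j + q_k) /\<^sub>R 2)
            | a b c d. a \<in> Z_sqrt2 \<and> b \<in> Z_sqrt2 \<and> c \<in> Z_sqrt2 \<and> d \<in> Z_sqrt2}"

definition cubian_ring :: "(real^4) ring" where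
  "cubian_ring = \<lparr>carrier = cubian, monoid.mult = qmult, one = q_1, zero = 0, add = (+)\<rparr>"

definition cubian_left_ideals :: "(real^4) set set" where
  "cubian_left_ideals = {I. left_ideal I cubian_ring \<and> I \<noteq> {0}}"

definition cubian_zeta :: "complex \<Rightarrow> complex" where
  "cubian_zeta s = (\<Sum>\<^sub>\<infinity>I\<in>cubian_left_ideals. of_nat (add_index cubian I) powr (- s))"

definition Q_sqrt2 :: "real set" where
  "Q_sqrt2 = {a + b * sqrt 2 | a b. a \<in> \<rat> \<and> b \<in> \<rat>}"

text \<open>Below, \<open>F\<close> is meant to be (the carrier of) a number field, embedded in a field of
  characteristic 0.  The series is the zeta function in the half-plane \<open>Re s > 1\<close> only.\<close>

definition ring_of_integers :: "'a::field_char_0 set \<Rightarrow> 'a ring" where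
  "ring_of_integers F =
     \<lparr>carrier = {x\<in>F. algebraic_int x}, monoid.mult = (*), one = 1, zero = 0, add = (+)\<rparr>"

definition nonzero_ideals :: "'a::field_char_0 set \<Rightarrow> 'a set set" where
  "nonzero_ideals F = {I. ideal I (ring_of_integers F) \<and> I \<noteq> {0}}"

definition ideal_norm :: "'a::field_char_0 set \<Rightarrow> 'a set \<Rightarrow> nat" where
  "ideal_norm F I = add_index (carrier (ring_of_integers F)) I"

definition dedekind_zeta :: "'a::field_char_0 set \<Rightarrow> complex \<Rightarrow> complex" where
  "dedekind_zeta F s = (\<Sum>\<^sub>\<infinity>I\<in>nonzero_ideals F. of_nat (ideal_norm F I) powr (- s))"

definition is_SSM :: "(real^4) set \<Rightarrow> (real^4) set \<Rightarrow> bool" where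
  "is_SSM L M \<longleftrightarrow> M \<subseteq> L \<and>
     (\<exists>\<alpha> R. \<alpha> \<noteq> 0 \<and> orthogonal_transformation R \<and> M = (\<lambda>x. \<alpha> *\<^sub>R R x) ` L)"

definition SSM_count :: "(real^4) set \<Rightarrow> nat \<Rightarrow> nat" where
  "SSM_count L m = card {M. is_SSM L M \<and> add_index L M = m}"

definition SSM_series :: "(real^4) set \<Rightarrow> complex \<Rightarrow> complex" where
  "SSM_series L s = (\<Sum>\<^sub>\<infinity>m\<in>{1..}. of_nat (SSM_count L m) * of_nat m powr (- s))"

definition multiplicative :: "(nat \<Rightarrow> 'a::comm_semiring_1) \<Rightarrow> bool" where
  "multiplicative f \<longleftrightarrow> f 1 = 1 \<and>
     (\<forall>m n. m > 0 \<longrightarrow> n > 0 \<longrightarrow> coprime m n \<longrightarrow> f (m * n) = f m * f n)"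

end

theory Submission
  imports Defs "HOL-Computational_Algebra.Nth_Powers"
begin

text \<open>Scaling and the theorem of Skolem and Noether, made explicit through the images of
  \<open>1, i, j, k\<close>, show that every similarity submodule of the cubian ring \<open>K\<close> has the form \<open>P K Q\<close>
  with \<open>P, Q\<close> in \<open>K\<close>.  Moving the content of \<open>P\<close> to \<open>Q\<close> makes \<open>P\<close> primitive, and then \<open>P K\<close> and
  \<open>K Q\<close> are determined by \<open>P K Q\<close>.  Since every one-sided ideal is principal, pairs of left ideals
  correspond to pairs of an ideal of \<open>Z[sqrt 2]\<close> and a similarity submodule; this is the identity
  \<open>F(s) * zeta(4 s) = (zeta of K)(s)^2\<close>.

  The quaternion algebra is unramified at all finite places.  Here this enters through the
  unimodularity of the trace form, which makes \<open>K / p K\<close> simple, and through an isotropic vector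
  modulo \<open>p\<close>; together they give \<open>N p + 1\<close> left ideals of reduced norm \<open>p\<close>.  Double counting of
  the pairs \<open>I <= J\<close> with quotient of norm \<open>p\<close> gives a Hecke recursion, which the sum of the norms of
  the divisors of \<open>n\<close> also satisfies.  Hence that sum counts the left ideals of reduced norm \<open>n\<close>.\<close>

section \<open>The ring of integers of the quadratic field\<close>

text \<open>All indices that occur are squares: \<open>K x\<close> has index
  \<open>N(nr x)^2\<close>. So everything is counted by the root of the index, and the series are
  evaluated at \<open>2 s\<close>; the shifted factor \<open>zeta(2 s - 1)\<close> is what asks for
  \<open>Re s > 1\<close>. Besides units, central scalars are the only ambiguity in
  \<open>P K Q\<close>. A scalar \<open>c\<close> can sit in either factor; a pair of left ideals
  records which, a similarity submodule does not. Since \<open>K c\<close> has index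
  \<open>N(c)^4\<close>, forgetting it costs exactly the factor \<open>zeta(4 s)\<close>. No
  isomorphism of \<open>K / p K\<close> with a matrix ring is constructed. An element outside
  \<open>p K\<close> whose reduced norm is divisible by \<open>p\<close> plays the part of a matrix
  of rank one, and the left ideals of norm \<open>p\<close> behave like the points of a projective
  line over the residue field. Nor is there a local factorisation of left ideals: a recursion at one
  prime at a time, applied by induction on the norm, determines the count for every
  \<open>n\<close>.\<close>

text \<open>\<open>ZS a b\<close> stands for \<open>a + b * sqrt 2\<close>.\<close>
datatype zs = ZS (rat_part: int) (irr_part: int)

lemma zs_eq_iff: "x = y \<longleftrightarrow> rat_part x = rat_part y \<and> irr_part x = irr_part y"
  by (cases x; cases y) simp

instantiation zs :: comm_ring_1
begin

definition "0 = ZS 0 0"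
definition "1 = ZS 1 0"
definition "x + y = ZS (rat_part x + rat_part y) (irr_part x + irr_part y)"
definition "x - y = ZS (rat_part x - rat_part y) (irr_part x - irr_part y)"
definition "- x = ZS (- rat_part x) (- irr_part x)"
definition "x * y = ZS (rat_part x * rat_part y + 2 * irr_part x * irr_part y)
  (rat_part x * irr_part y + irr_part x * rat_part y)"

instance
  by standard (auto simp: zs_eq_iff zero_zs_def one_zs_def plus_zs_def minus_zs_def uminus_zs_def
      times_zs_def algebra_simps)

end

lemma zs_simps [simp]:
  "rat_part 0 = 0" "irr_part 0 = 0" "rat_part 1 = 1" "irr_part 1 = 0"
  "rat_part (x + y) = rat_part x + rat_part y" "irr_part (x + y) = irr_part x + irr_part y"
  "rat_part (x - y) = rat_part x - rat_part y" "irr_part (x - y) = irr_part x - irr_part y"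
  "rat_part (- x) = - rat_part x" "irr_part (- x) = - irr_part x"
  "rat_part (x * y) = rat_part x * rat_part y + 2 * irr_part x * irr_part y"
  "irr_part (x * y) = rat_part x * irr_part y + irr_part x * rat_part y"
  by (simp_all add: zero_zs_def one_zs_def plus_zs_def minus_zs_def uminus_zs_def times_zs_def)

lemma zs_of_nat [simp]: "rat_part (of_nat n) = int n" "irr_part (of_nat n) = 0"
  by (induction n) auto

lemma zs_of_int [simp]: "rat_part (of_int n) = n" "irr_part (of_int n) = 0"
  by (cases n; simp)+

lemma zs_numeral [simp]: "rat_part (numeral n) = numeral n" "irr_part (numeral n) = 0"
  using zs_of_nat[of "numeral n"] by simp_all

definition gconj :: "zs \<Rightarrow> zs" where "gconj x = ZS (rat_part x) (- irr_part x)"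

definition Nm :: "zs \<Rightarrow> int" where "Nm x = (rat_part x)\<^sup>2 - 2 * (irr_part x)\<^sup>2"

lemma gconj_simps [simp]: "rat_part (gconj x) = rat_part x" "irr_part (gconj x) = - irr_part x"
  by (simp_all add: gconj_def)

lemma gconj_mult: "gconj (x * y) = gconj x * gconj y"
  by (simp add: zs_eq_iff)

lemma mult_gconj: "x * gconj x = of_int (Nm x)"
  by (simp add: zs_eq_iff Nm_def power2_eq_square)

lemma Nm_mult: "Nm (x * y) = Nm x * Nm y"
  by (simp add: Nm_def power2_eq_square algebra_simps)

lemma Nm_gconj [simp]: "Nm (gconj x) = Nm x"
  by (simp add: Nm_def)

lemma Nm_of_int [simp]: "Nm (of_int n) = n\<^sup>2"
  by (simp add: Nm_def)

lemma Nm_0 [simp]: "Nm 0 = 0" and Nm_1 [simp]: "Nm 1 = 1"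
  by (simp_all add: Nm_def)

text \<open>For non-zero \<open>b\<close> the exponent of 2 would be even on one side of the
  assumption and odd on the other.\<close>

lemma sqrt2_irrat_int:
  fixes a b :: int assumes "a\<^sup>2 = 2 * b\<^sup>2" shows "b = 0"
proof (rule ccontr)
  assume b: "b \<noteq> 0"
  with assms have a: "a \<noteq> 0" by auto
  have "multiplicity 2 (a\<^sup>2) = 2 * multiplicity 2 a"
    using a by (simp add: prime_elem_multiplicity_power_distrib)
  moreover have "multiplicity 2 (2 * b\<^sup>2) = Suc (2 * multiplicity 2 b)"
    using b by (simp add: prime_elem_multiplicity_power_distrib multiplicity_times_same)
  ultimately have "2 * multiplicity 2 a = Suc (2 * multiplicity 2 b)" using assms by simp
  then show False by presburger
qed

lemma Nm_eq_0 [simp]: "Nm x = 0 \<longleftrightarrow> x = 0"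
proof
  assume "Nm x = 0"
  then have eq: "(rat_part x)\<^sup>2 = 2 * (irr_part x)\<^sup>2" by (simp add: Nm_def)
  from sqrt2_irrat_int[OF eq] have "irr_part x = 0" .
  with eq show "x = 0" by (simp add: zs_eq_iff)
qed simp

instance zs :: idom
proof
  fix a b :: zs
  assume "a \<noteq> 0" "b \<noteq> 0"
  then show "a * b \<noteq> 0" by (metis Nm_eq_0 Nm_mult mult_eq_0_iff)
qed

section \<open>Euclidean division in Z[sqrt 2]\<close>

definition rdiv :: "int \<Rightarrow> int \<Rightarrow> int" where "rdiv a n = round (real_of_int a / real_of_int n)"

lemma rdiv_exact [simp]: "n \<noteq> 0 \<Longrightarrow> rdiv (k * n) n = k"
  by (simp add: rdiv_def)

lemma rdiv_bound: assumes "n \<noteq> 0" shows "4 * (a - rdiv a n * n)\<^sup>2 \<le> n\<^sup>2"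
proof -
  have "\<bar>real_of_int a / real_of_int n - of_int (rdiv a n)\<bar> \<le> 1/2"
    unfolding rdiv_def using of_int_round_abs_le[of "real_of_int a / real_of_int n"]
    by (simp add: abs_minus_commute)
  then have "\<bar>real_of_int a / real_of_int n - of_int (rdiv a n)\<bar> * \<bar>real_of_int n\<bar> \<le> 1/2 * \<bar>real_of_int n\<bar>"
    by (rule mult_right_mono) simp
  moreover have "\<bar>real_of_int a / real_of_int n - of_int (rdiv a n)\<bar> * \<bar>real_of_int n\<bar>
      = \<bar>real_of_int (a - rdiv a n * n)\<bar>"
    using assms by (simp add: abs_mult[symmetric] left_diff_distrib)
  ultimately have "real_of_int (2 * \<bar>a - rdiv a n * n\<bar>) \<le> real_of_int \<bar>n\<bar>" by simp
  then have "2 * \<bar>a - rdiv a n * n\<bar> \<le> \<bar>n\<bar>" by (simp only: of_int_le_iff)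
  then have "(2 * \<bar>a - rdiv a n * n\<bar>)\<^sup>2 \<le> \<bar>n\<bar>\<^sup>2" by (intro power_mono) auto
  then show ?thesis by (simp add: power_mult_distrib)
qed

instantiation zs :: euclidean_ring
begin

definition "x div y = (if y = 0 then 0 else
   ZS (rdiv (rat_part (x * gconj y)) (Nm y)) (rdiv (irr_part (x * gconj y)) (Nm y)))"
definition "x mod y = x - (x div y) * (y :: zs)"
definition "euclidean_size x = nat \<bar>Nm x\<bar>"

lemma zs_mult_div: "b \<noteq> 0 \<Longrightarrow> (a * b) div b = (a :: zs)"
proof -
  assume b: "b \<noteq> 0"
  have "a * b * gconj b = a * of_int (Nm b)" by (simp add: mult.assoc mult_gconj)
  then have "rat_part (a * b * gconj b) = rat_part a * Nm b"
    "irr_part (a * b * gconj b) = irr_part a * Nm b" by (simp_all only: zs_simps zs_of_int)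
  then show ?thesis using b unfolding divide_zs_def by (simp only: if_False rdiv_exact Nm_eq_0) (simp add: zs_eq_iff)
qed

text \<open>The quotient rounds both coordinates of \<open>a * gconj b / Nm b\<close> to a nearest
  integer. In \<open>u - 2 * v\<close> both squares are at most a quarter of the square of
  \<open>Nm b\<close> and enter with opposite signs, so the absolute value is at most half of
  it.\<close>

lemma Nm_mod_less: assumes "b \<noteq> 0" shows "\<bar>Nm (a mod b)\<bar> < \<bar>Nm b\<bar>"
proof -
  let ?n = "Nm b" and ?c = "a * gconj b"
  have n: "?n \<noteq> 0" using assms by simp
  have "(a mod b) * gconj b = ?c - (a div b) * of_int ?n"
    by (simp add: modulo_zs_def algebra_simps mult_gconj)
  then have e: "Nm (a mod b) * ?n = (rat_part ?c - rdiv (rat_part ?c) ?n * ?n)\<^sup>2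
      - 2 * (irr_part ?c - rdiv (irr_part ?c) ?n * ?n)\<^sup>2"
    using assms Nm_mult[of "a mod b" "gconj b"]
    by (simp add: Nm_def[of "_ - _"] divide_zs_def del: mult_gconj)
  let ?u = "(rat_part ?c - rdiv (rat_part ?c) ?n * ?n)\<^sup>2"
  let ?v = "(irr_part ?c - rdiv (irr_part ?c) ?n * ?n)\<^sup>2"
  have "4 * ?u \<le> ?n\<^sup>2" "4 * ?v \<le> ?n\<^sup>2" using rdiv_bound[OF n] by auto
  moreover have "?u \<ge> 0" "?v \<ge> 0" "?n\<^sup>2 > 0" using n by auto
  ultimately have "\<bar>?u - 2 * ?v\<bar> < ?n\<^sup>2" by linarith
  then have "\<bar>Nm (a mod b)\<bar> * \<bar>?n\<bar> < \<bar>?n\<bar> * \<bar>?n\<bar>"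
    using e by (simp add: abs_mult[symmetric] power2_eq_square)
  then have "\<bar>?n\<bar> * \<bar>Nm (a mod b)\<bar> < \<bar>?n\<bar> * \<bar>?n\<bar>" by (simp only: mult.commute)
  then show ?thesis by (rule mult_left_less_imp_less) simp
qed

instance
proof
  fix a b :: zs
  show "b \<noteq> 0 \<Longrightarrow> a * b div b = a" by (rule zs_mult_div)
  show "a div 0 = 0" by (simp add: divide_zs_def)
  show "a div b * b + a mod b = a" by (simp add: modulo_zs_def)
  show "euclidean_size (0::zs) = 0" by (simp add: euclidean_size_zs_def)
  show "b \<noteq> 0 \<Longrightarrow> euclidean_size (a mod b) < euclidean_size b"
    using Nm_mod_less[of b a] by (simp add: euclidean_size_zs_def)
  show "b \<noteq> 0 \<Longrightarrow> euclidean_size a \<le> euclidean_size (a * b)"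
  proof -
    assume "b \<noteq> 0"
    then have "\<bar>Nm b\<bar> \<ge> 1" using Nm_eq_0[of b] by linarith
    then have "\<bar>Nm a\<bar> * 1 \<le> \<bar>Nm a\<bar> * \<bar>Nm b\<bar>" by (intro mult_left_mono) auto
    then show ?thesis by (simp add: euclidean_size_zs_def Nm_mult abs_mult)
  qed
qed

end

lemma zs_is_unit_iff: "is_unit (x::zs) \<longleftrightarrow> \<bar>Nm x\<bar> = 1"
proof -
  have "is_unit x \<longleftrightarrow> euclidean_size x = euclidean_size (1::zs) \<and> x \<noteq> 0"
    by (rule unit_iff_euclidean_size)
  also have "\<dots> \<longleftrightarrow> \<bar>Nm x\<bar> = 1" by (auto simp: euclidean_size_zs_def)
  finally show ?thesis .
qed

text \<open>The predicate under \<open>SOME\<close> is the same for all associates of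
  \<open>x\<close>, so one choice is made per class. The class of the units is fixed to 1 because
  \<open>unit_factor\<close> has to be the identity on units.\<close>

definition assoc_rep :: "zs \<Rightarrow> zs" where
  "assoc_rep x = (if is_unit x then 1 else SOME y. x dvd y \<and> y dvd x)"

lemma assoc_rep_dvd: "x dvd assoc_rep x \<and> assoc_rep x dvd x"
proof (cases "is_unit x")
  case False
  have "\<exists>y. x dvd y \<and> y dvd x" by (rule exI[of _ x]) simp
  from someI_ex[OF this] show ?thesis using False by (simp add: assoc_rep_def)
qed (simp add: assoc_rep_def)

lemma assoc_rep_cong: assumes "x dvd y" "y dvd x" shows "assoc_rep x = assoc_rep y"
proof -
  have "(\<lambda>z. x dvd z \<and> z dvd x) = (\<lambda>z. y dvd z \<and> z dvd y)"
    using assms by (auto intro: dvd_trans)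
  moreover have "is_unit x \<longleftrightarrow> is_unit y" using assms by (auto intro: dvd_trans)
  ultimately show ?thesis by (simp add: assoc_rep_def)
qed

lemma assoc_rep_0 [simp]: "assoc_rep 0 = 0"
  using assoc_rep_dvd[of 0] by simp

instantiation zs :: normalization_euclidean_semiring
begin

definition "normalize x = assoc_rep x"
definition "unit_factor x = (if x = 0 then 0 else x div assoc_rep x)"

instance
proof
  fix a b :: zs
  show "unit_factor (0::zs) = 0" by (simp add: unit_factor_zs_def)
  show "is_unit a \<Longrightarrow> unit_factor a = a"
    by (auto simp: unit_factor_zs_def assoc_rep_def)
  show "a \<noteq> 0 \<Longrightarrow> is_unit (unit_factor a)"
    using assoc_rep_dvd[of a] unfolding unit_factor_zs_def
    by (simp add: dvd_div_mult2_eq) (metis assoc_rep_dvd div_self dvd_0_left_iff dvd_div_iff_mult mult_1 unit_div unit_imp_dvd dvdE mult.commute dvd_mult_cancel_left nonzero_mult_div_cancel_right)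
  show "is_unit a \<Longrightarrow> unit_factor (a * b) = a * unit_factor b"
  proof -
    assume a: "is_unit a"
    have "assoc_rep (a * b) = assoc_rep b"
      using a by (intro assoc_rep_cong) auto
    then show ?thesis using a assoc_rep_dvd[of b] by (auto simp: unit_factor_zs_def div_mult_swap)
  qed
  show "unit_factor a * normalize a = a"
    using assoc_rep_dvd[of a] by (auto simp: unit_factor_zs_def normalize_zs_def)
  show "normalize (0::zs) = 0" by (simp add: normalize_zs_def)
qed

end

instantiation zs :: euclidean_ring_gcd
begin

definition "gcd = (Euclidean_Algorithm.gcd :: zs \<Rightarrow> _)"
definition "lcm = (Euclidean_Algorithm.lcm :: zs \<Rightarrow> _)"
definition "Gcd = (Euclidean_Algorithm.Gcd :: zs set \<Rightarrow> _)"
definition "Lcm = (Euclidean_Algorithm.Lcm :: zs set \<Rightarrow> _)"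

instance
  by standard (simp_all add: gcd_zs_def lcm_zs_def Gcd_zs_def Lcm_zs_def)

end

lemma Nm_dvd: "a dvd b \<Longrightarrow> Nm a dvd Nm b"
  by (auto simp: Nm_mult elim!: dvdE)

lemma abs_Nm_normalize [simp]: "\<bar>Nm (normalize a)\<bar> = \<bar>Nm a\<bar>"
proof (rule zdvd_antisym_abs[THEN trans])
  show "Nm (normalize a) dvd Nm a" "Nm a dvd Nm (normalize a)" by (auto intro: Nm_dvd)
qed simp

lemma dvd_of_int_Nm: "a dvd of_int (Nm a)"
  by (metis dvd_triv_left mult_gconj)

definition r2 :: zs where "r2 = ZS 0 1"

lemma r2_simps [simp]: "rat_part r2 = 0" "irr_part r2 = 1" "Nm r2 = -2"
  by (simp_all add: r2_def Nm_def)

lemma r2_r2: "r2 * r2 = 2" "r2 * (r2 * x) = 2 * x"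
  by (simp_all add: zs_eq_iff)

section \<open>The cubian ring in coordinates\<close>

text \<open>Coordinates over \<open>Z[sqrt 2]\<close> in the basis \<open>1, u, v, w\<close> with \<open>u = (1 + i) / sqrt 2\<close>,
  \<open>v = (1 + j) / sqrt 2\<close> and \<open>w = u v = (1 + i + j + k) / 2\<close>.  The product is determined by
  \<open>u^2 = r u - 1\<close>, \<open>v^2 = r v - 1\<close> and \<open>v u = r u + r v - 1 - w\<close>, where \<open>r = sqrt 2\<close>.\<close>
datatype kq = KQ (c1: zs) (cu: zs) (cv: zs) (cw: zs)

lemma kq_eq_iff: "x = y \<longleftrightarrow> c1 x = c1 y \<and> cu x = cu y \<and> cv x = cv y \<and> cw x = cw y"
  by (cases x; cases y) simp

instantiation kq :: "{zero, one, plus, minus, uminus, times}"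
begin

definition "0 = KQ 0 0 0 0"
definition "1 = KQ 1 0 0 0"
definition "x + y = KQ (c1 x + c1 y) (cu x + cu y) (cv x + cv y) (cw x + cw y)"
definition "x - y = KQ (c1 x - c1 y) (cu x - cu y) (cv x - cv y) (cw x - cw y)"
definition "- x = KQ (- c1 x) (- cu x) (- cv x) (- cw x)"
definition "x * y = KQ
  (c1 x * c1 y - cu x * cu y - cv x * cu y - cv x * cv y - r2 * (cv x * cw y) - r2 * (cw x * cu y)
    - cw x * cw y)
  (c1 x * cu y + cu x * c1 y + r2 * (cu x * cu y) + r2 * (cv x * cu y) + cv x * cw y + cw x * cu y
    - cw x * cv y)
  (c1 x * cv y + cv x * c1 y - cu x * cw y + r2 * (cv x * cu y) + r2 * (cv x * cv y) + cv x * cw y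
    + cw x * cu y)
  (c1 x * cw y + cw x * c1 y + cu x * cv y + r2 * (cu x * cw y) - cv x * cu y + r2 * (cw x * cv y)
    + cw x * cw y)"

instance ..

end

lemma kq_simps [simp]:
  "c1 0 = 0" "cu 0 = 0" "cv 0 = 0" "cw 0 = 0"
  "c1 1 = 1" "cu 1 = 0" "cv 1 = 0" "cw 1 = 0"
  "c1 (x + y) = c1 x + c1 y" "cu (x + y) = cu x + cu y" "cv (x + y) = cv x + cv y" "cw (x + y) = cw x + cw y"
  "c1 (x - y) = c1 x - c1 y" "cu (x - y) = cu x - cu y" "cv (x - y) = cv x - cv y" "cw (x - y) = cw x - cw y"
  "c1 (- x) = - c1 x" "cu (- x) = - cu x" "cv (- x) = - cv x" "cw (- x) = - cw x"
  by (simp_all add: zero_kq_def one_kq_def plus_kq_def minus_kq_def uminus_kq_def)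

lemma kq_mult_simps:
  "c1 (x * y) = c1 x * c1 y - cu x * cu y - cv x * cu y - cv x * cv y - r2 * (cv x * cw y)
     - r2 * (cw x * cu y) - cw x * cw y"
  "cu (x * y) = c1 x * cu y + cu x * c1 y + r2 * (cu x * cu y) + r2 * (cv x * cu y) + cv x * cw y
     + cw x * cu y - cw x * cv y"
  "cv (x * y) = c1 x * cv y + cv x * c1 y - cu x * cw y + r2 * (cv x * cu y) + r2 * (cv x * cv y)
     + cv x * cw y + cw x * cu y"
  "cw (x * y) = c1 x * cw y + cw x * c1 y + cu x * cv y + r2 * (cu x * cw y) - cv x * cu y
     + r2 * (cw x * cv y) + cw x * cw y"
  by (simp_all add: times_kq_def)

instance kq :: ring_1
proof
  fix a b c :: kq
  show "a * b * c = a * (b * c)"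
    unfolding kq_eq_iff kq_mult_simps
    by (intro conjI; simp add: algebra_simps r2_r2)
  show "(a + b) * c = a * c + b * c" "a * (b + c) = a * b + a * c"
    by (simp_all add: kq_eq_iff kq_mult_simps algebra_simps)
  show "1 * a = a" "a * 1 = a" by (simp_all add: kq_eq_iff kq_mult_simps)
qed (auto simp: kq_eq_iff)

definition oK :: "zs \<Rightarrow> kq" where "oK a = KQ a 0 0 0"

lemma oK_sel [simp]: "c1 (oK a) = a" "cu (oK a) = 0" "cv (oK a) = 0" "cw (oK a) = 0"
  by (simp_all add: oK_def)

lemma oK_hom [simp]: "oK 0 = 0" "oK 1 = 1" "oK (a + b) = oK a + oK b" "oK (a - b) = oK a - oK b"
  "oK (- a) = - oK a"
  by (simp_all add: kq_eq_iff)

lemma oK_mult: "oK (a * b) = oK a * oK b"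
  by (simp add: kq_eq_iff kq_mult_simps)

lemma oK_inject [simp]: "oK a = oK b \<longleftrightarrow> a = b"
  by (simp add: oK_def)

lemma oK_eq_0 [simp]: "oK a = 0 \<longleftrightarrow> a = 0"
  by (simp add: kq_eq_iff)

lemma smul_sel [simp]: "c1 (oK a * x) = a * c1 x" "cu (oK a * x) = a * cu x"
  "cv (oK a * x) = a * cv x" "cw (oK a * x) = a * cw x"
  by (simp_all add: kq_mult_simps)

lemma oK_comm: "x * oK a = oK a * x" "x * (oK a * y) = oK a * (x * y)"
proof -
  show 1: "x * oK a = oK a * x" for x by (simp add: kq_eq_iff kq_mult_simps)
  show "x * (oK a * y) = oK a * (x * y)" by (metis 1 mult.assoc)
qed

text \<open>Quaternion conjugation: \<open>u\<close>, \<open>v\<close>, \<open>w\<close> have traces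
  \<open>sqrt 2\<close>, \<open>sqrt 2\<close> and 1, so they are sent to \<open>sqrt 2 - u\<close>,
  \<open>sqrt 2 - v\<close> and \<open>1 - w\<close>.\<close>

definition qbar :: "kq \<Rightarrow> kq" where
  "qbar x = KQ (c1 x + r2 * cu x + r2 * cv x + cw x) (- cu x) (- cv x) (- cw x)"

definition tr :: "kq \<Rightarrow> zs" where "tr x = 2 * c1 x + r2 * cu x + r2 * cv x + cw x"

definition nr :: "kq \<Rightarrow> zs" where
  "nr x = c1 x * c1 x + cu x * cu x + cv x * cv x + cw x * cw x
     + r2 * (c1 x * cu x + c1 x * cv x + cu x * cw x + cv x * cw x) + c1 x * cw x + cu x * cv x"

lemma qbar_sel [simp]: "c1 (qbar x) = c1 x + r2 * cu x + r2 * cv x + cw x"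
  "cu (qbar x) = - cu x" "cv (qbar x) = - cv x" "cw (qbar x) = - cw x"
  by (simp_all add: qbar_def)

lemma qbar_add [simp]: "qbar (x + y) = qbar x + qbar y" "qbar (x - y) = qbar x - qbar y"
  "qbar (- x) = - qbar x" "qbar (qbar x) = x" "qbar 0 = 0" "qbar 1 = 1" "qbar (oK a) = oK a"
  by (simp_all add: kq_eq_iff algebra_simps)

lemma qbar_eq_0 [simp]: "qbar x = 0 \<longleftrightarrow> x = 0"
  by (metis qbar_add(4,5))

lemma qbar_mult: "qbar (x * y) = qbar y * qbar x"
  by (simp add: kq_eq_iff kq_mult_simps algebra_simps r2_r2)

lemma plus_qbar: "x + qbar x = oK (tr x)"
  by (simp add: kq_eq_iff tr_def algebra_simps)

lemma qbar_eq: "qbar x = oK (tr x) - x"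
  by (simp add: plus_qbar[symmetric])

lemma mult_qbar: "x * qbar x = oK (nr x)"
  by (simp add: kq_eq_iff kq_mult_simps nr_def algebra_simps r2_r2)

lemma nr_qbar [simp]: "nr (qbar x) = nr x"
  by (simp add: nr_def algebra_simps r2_r2)

lemma qbar_mult_self: "qbar x * x = oK (nr x)"
  using mult_qbar[of "qbar x"] by simp

lemma tr_simps [simp]: "tr (x + y) = tr x + tr y" "tr (x - y) = tr x - tr y" "tr (- x) = - tr x"
  "tr (oK a * x) = a * tr x" "tr (qbar x) = tr x" "tr 0 = 0" "tr (oK a) = 2 * a"
  by (simp_all add: tr_def algebra_simps)

lemma tr_mult_commute: "tr (x * y) = tr (y * x)"
  by (simp add: tr_def kq_mult_simps algebra_simps r2_r2)

lemma nr_mult: "nr (x * y) = nr x * nr y"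
proof -
  have "oK (nr (x * y)) = x * (y * qbar y) * qbar x"
    by (simp add: mult_qbar[symmetric] qbar_mult mult.assoc)
  also have "\<dots> = oK (nr x * nr y)"
    by (simp only: mult_qbar mult.assoc oK_comm(2)[of x] oK_mult) (simp only: mult_qbar flip: mult.assoc oK_mult, simp add: mult.commute)
  finally show ?thesis by simp
qed

lemma nr_oK [simp]: "nr (oK a) = a * a" and nr_0 [simp]: "nr 0 = 0" and nr_1 [simp]: "nr 1 = 1"
  by (simp_all add: nr_def)

text \<open>The polarised norm form has determinant 1 in the basis, so that a vector is divisible by
  \<open>p\<close> as soon as all its trace products are.\<close>
lemma trace_form_unimodular:
  assumes "\<And>y. p dvd tr (x * y)"
  shows "\<exists>y. x = oK p * y"
proof -
  define t1 where "t1 = tr x"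
  define t2 where "t2 = tr (x * qbar (KQ 0 1 0 0))"
  define t3 where "t3 = tr (x * qbar (KQ 0 0 1 0))"
  define t4 where "t4 = tr (x * qbar (KQ 0 0 0 1))"
  have d: "p dvd t1" "p dvd t2" "p dvd t3" "p dvd t4"
    using assms[of 1] assms unfolding t1_def t2_def t3_def t4_def by auto
  note t = t1_def t2_def t3_def t4_def tr_def kq_mult_simps qbar_sel
  \<comment> \<open>The differences \<open>t1 - t4\<close> and \<open>t2 - t3\<close> equal
    \<open>c1 x - cw x\<close> and \<open>cu x - cv x\<close>. After elimination of
    \<open>c1 x\<close> and \<open>cv x\<close>, the pair \<open>cw x\<close>, \<open>cu x\<close>
    solves a linear system with rows \<open>3, 2 * r2\<close> and \<open>2 * r2, 3\<close>. Its
    determinant is 9 - 8 = 1, and the inverse matrix supplies the coefficients.\<close>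
  have w: "cw x = 3 * (t1 - 2 * (t1 - t4) + r2 * (t2 - t3)) - 2 * r2 * (t2 - r2 * (t1 - t4) + (t2 - t3))"
    by (simp add: t algebra_simps r2_r2)
  have u: "cu x = 3 * (t2 - r2 * (t1 - t4) + (t2 - t3)) - 2 * r2 * (t1 - 2 * (t1 - t4) + r2 * (t2 - t3))"
    by (simp add: t algebra_simps r2_r2)
  have v: "cv x = cu x - (t2 - t3)" by (simp add: t algebra_simps r2_r2)
  have a: "c1 x = cw x + (t1 - t4)" by (simp add: t algebra_simps r2_r2)
  have "p dvd cw x" unfolding w using d by (intro dvd_diff dvd_add dvd_mult)
  moreover have "p dvd cu x" unfolding u using d by (intro dvd_diff dvd_add dvd_mult)
  ultimately have "p dvd c1 x" "p dvd cu x" "p dvd cv x" "p dvd cw x"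
    unfolding a v using d by (auto intro!: dvd_diff dvd_add)
  then obtain a' b' c' d' where "c1 x = p * a'" "cu x = p * b'" "cv x = p * c'" "cw x = p * d'"
    unfolding dvd_def by blast
  then show ?thesis by (intro exI[of _ "KQ a' b' c' d'"]) (simp add: kq_eq_iff)
qed

subsection \<open>Embedding into Euclidean space\<close>

definition er :: "zs \<Rightarrow> real" where "er x = of_int (rat_part x) + of_int (irr_part x) * sqrt 2"

lemma er_simps [simp]: "er 0 = 0" "er 1 = 1" "er (x + y) = er x + er y" "er (x - y) = er x - er y"
  "er (- x) = - er x" "er (x * y) = er x * er y" "er r2 = sqrt 2" "er (of_int n) = of_int n"
  "er (numeral k) = numeral k"
  by (simp_all add: er_def algebra_simps)

lemma er_mult_er_gconj: "er x * er (gconj x) = of_int (Nm x)"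
  by (simp only: er_simps(6)[symmetric] mult_gconj er_simps(8))

lemma er_eq_0 [simp]: "er x = 0 \<longleftrightarrow> x = 0"
  using er_mult_er_gconj[of x] by auto

lemma er_inject [simp]: "er x = er y \<longleftrightarrow> x = y"
  using er_eq_0[of "x - y"] by (simp del: er_eq_0) 

lemma range_er: "range er = Z_sqrt2"
proof -
  have "of_int a + of_int b * sqrt 2 \<in> range er" for a b
    by (rule range_eqI[of _ _ "ZS a b"]) (simp add: er_def)
  then show ?thesis by (auto simp: Z_sqrt2_def er_def)
qed

text \<open>The number \<open>s\<close> stays a parameter so that the identity serves both real
  embeddings: \<open>sqrt 2\<close> for the norm form itself and \<open>- sqrt 2\<close> for its
  Galois conjugate. Reduced norms are therefore totally non-negative, which makes
  \<open>Nm (nr x)\<close> non-negative.\<close>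

lemma norm_form_sum_of_squares:
  fixes a b c d s :: real
  assumes "s * s = 2"
  shows "a * a + b * b + c * c + d * d + s * (a * b + a * c + b * d + c * d) + a * d + b * c
    = (a + (b + c) * s / 2 + d / 2)\<^sup>2 + (b * s / 2 + d / 2)\<^sup>2 + (c * s / 2 + d / 2)\<^sup>2 + (d / 2)\<^sup>2"
proof -
  have [simp]: "s * (s * x) = 2 * x" for x using assms by (simp add: mult.assoc[symmetric])
  show ?thesis by (simp add: power2_eq_square field_simps assms)
qed

lemma er_nr: "er (nr x) = (er (c1 x) + (er (cu x) + er (cv x)) * sqrt 2 / 2 + er (cw x) / 2)\<^sup>2
   + (er (cu x) * sqrt 2 / 2 + er (cw x) / 2)\<^sup>2 + (er (cv x) * sqrt 2 / 2 + er (cw x) / 2)\<^sup>2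
   + (er (cw x) / 2)\<^sup>2"
  by (subst norm_form_sum_of_squares[symmetric]) (simp_all add: nr_def)

lemma er_nr_nonneg: "er (nr x) \<ge> 0"
  by (simp add: er_nr)

lemma er_gconj_nr_nonneg: "er (gconj (nr x)) \<ge> 0"
proof -
  let ?e = "\<lambda>x. er (gconj x)"
  have [simp]: "?e (x + y) = ?e x + ?e y" "?e (x * y) = ?e x * ?e y" "?e r2 = - sqrt 2" for x y
    by (simp_all add: er_def algebra_simps)
  show ?thesis
    unfolding nr_def
    using norm_form_sum_of_squares[of "- sqrt 2" "?e (c1 x)" "?e (cu x)" "?e (cv x)" "?e (cw x)"]
    by simp
qed

lemma Nm_nr_nonneg: "Nm (nr x) \<ge> 0"
proof -
  have "real_of_int (Nm (nr x)) \<ge> 0"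
    unfolding er_mult_er_gconj[symmetric]
    by (intro mult_nonneg_nonneg er_nr_nonneg er_gconj_nr_nonneg)
  then show ?thesis by simp
qed

lemma nr_eq_0 [simp]: "nr x = 0 \<longleftrightarrow> x = 0"
proof
  assume "nr x = 0"
  then have "er (nr x) = 0" by simp
  then have "er (c1 x) + (er (cu x) + er (cv x)) * sqrt 2 / 2 + er (cw x) / 2 = 0 \<and>
    er (cu x) * sqrt 2 / 2 + er (cw x) / 2 = 0 \<and> er (cv x) * sqrt 2 / 2 + er (cw x) / 2 = 0 \<and>
    er (cw x) / 2 = 0"
    unfolding er_nr by (simp add: add_nonneg_eq_0_iff) (auto simp: add_nonneg_eq_0_iff)
  then have "er (cw x) = 0" "er (cu x) = 0" "er (cv x) = 0" "er (c1 x) = 0" by auto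
  then show "x = 0" by (simp add: kq_eq_iff)
qed simp

instance kq :: ring_1_no_zero_divisors
proof
  fix a b :: kq
  assume "a \<noteq> 0" "b \<noteq> 0"
  then show "a * b \<noteq> 0" by (metis mult_eq_0_iff nr_eq_0 nr_mult)
qed

definition emb :: "kq \<Rightarrow> real^4" where
  "emb x = vector [er (c1 x) + (er (cu x) + er (cv x)) * sqrt 2 / 2 + er (cw x) / 2,
    er (cu x) * sqrt 2 / 2 + er (cw x) / 2, er (cv x) * sqrt 2 / 2 + er (cw x) / 2, er (cw x) / 2]"

lemma emb_nth [simp]:
  "emb x $ 1 = er (c1 x) + (er (cu x) + er (cv x)) * sqrt 2 / 2 + er (cw x) / 2"
  "emb x $ 2 = er (cu x) * sqrt 2 / 2 + er (cw x) / 2"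
  "emb x $ 3 = er (cv x) * sqrt 2 / 2 + er (cw x) / 2"
  "emb x $ 4 = er (cw x) / 2"
  by (simp_all add: emb_def vector_4)

lemma emb_add [simp]: "emb (x + y) = emb x + emb y" "emb (x - y) = emb x - emb y"
  "emb (- x) = - emb x" "emb 0 = 0"
  by (simp_all add: vec_eq_iff forall_4 field_simps)

lemma emb_oK_mult [simp]: "emb (oK a * x) = er a *\<^sub>R emb x"
  by (simp add: vec_eq_iff forall_4 algebra_simps)

lemma emb_mult: "emb (x * y) = qmult (emb x) (emb y)"
proof -
  have [simp]: "sqrt 2 * (sqrt 2 * z) = 2 * z" for z by (simp add: mult.assoc[symmetric])
  show ?thesis
    by (simp add: vec_eq_iff forall_4 qmult_nth kq_mult_simps) (simp add: field_simps)
qed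

lemma inner_4: "x \<bullet> (y :: real^4) = x$1 * y$1 + x$2 * y$2 + x$3 * y$3 + x$4 * y$4"
  by (simp add: inner_vec_def sum_4)

lemma emb_inner_self: "emb x \<bullet> emb x = er (nr x)"
  by (simp add: er_nr inner_4 power2_eq_square)

lemma emb_eq_0 [simp]: "emb x = 0 \<longleftrightarrow> x = 0"
  using emb_inner_self[of x] by auto

lemma inj_emb: "inj emb"
proof (rule injI)
  fix x y assume "emb x = emb y"
  then have "emb (x - y) = 0" by simp
  then show "x = y" by (simp del: emb_add)
qed

lemma range_emb: "range emb = cubian"
proof -
  have e: "emb x = er (c1 x) *\<^sub>R q_1 + er (cu x) *\<^sub>R ((q_1 + q_i) /\<^sub>R sqrt 2)
      + er (cv x) *\<^sub>R ((q_1 + q_j) /\<^sub>R sqrt 2) + er (cw x) *\<^sub>R ((q_1 + q_i + q_j + q_k) /\<^sub>R 2)" for x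
  proof -
    have [simp]: "z / sqrt 2 = z * sqrt 2 / 2" for z :: real
      by (simp add: field_simps mult.assoc[symmetric] flip: real_sqrt_mult)
    show ?thesis
      by (simp add: vec_eq_iff forall_4 q_1_def q_i_def q_j_def q_k_def axis_def divide_inverse[symmetric])
         (simp add: field_simps)
  qed
  show ?thesis
  proof (intro equalityI subsetI)
    fix z assume "z \<in> range emb"
    then obtain x where "z = emb x" by blast
    then show "z \<in> cubian" unfolding cubian_def range_er[symmetric] e by blast
  next
    fix z assume "z \<in> cubian"
    then obtain a b c d where z: "z = er a *\<^sub>R q_1 + er b *\<^sub>R ((q_1 + q_i) /\<^sub>R sqrt 2)
      + er c *\<^sub>R ((q_1 + q_j) /\<^sub>R sqrt 2) + er d *\<^sub>R ((q_1 + q_i + q_j + q_k) /\<^sub>R 2)"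
      unfolding cubian_def range_er[symmetric] by blast
    have "z = emb (KQ a b c d)" by (simp add: z e)
    then show "z \<in> range emb" by blast
  qed
qed

section \<open>Group indices\<close>

definition add_closed :: "'a::ab_group_add set \<Rightarrow> bool" where
  "add_closed S \<longleftrightarrow> 0 \<in> S \<and> (\<forall>x\<in>S. \<forall>y\<in>S. x - y \<in> S)"

lemma add_closedD:
  assumes "add_closed S"
  shows "0 \<in> S" "x \<in> S \<Longrightarrow> y \<in> S \<Longrightarrow> x - y \<in> S" "x \<in> S \<Longrightarrow> - x \<in> S"
    "x \<in> S \<Longrightarrow> y \<in> S \<Longrightarrow> x + y \<in> S"
proof -
  show 0: "0 \<in> S" and d: "\<And>x y. x \<in> S \<Longrightarrow> y \<in> S \<Longrightarrow> x - y \<in> S"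
    using assms by (auto simp: add_closed_def)
  show m: "- x \<in> S" if "x \<in> S" for x using d[OF 0 that] by simp
  show "x + y \<in> S" if "x \<in> S" "y \<in> S" using d[OF that(1) m[OF that(2)]] by simp
qed

lemma add_closed_UNIV [simp]: "add_closed UNIV"
  by (simp add: add_closed_def)

definition coset :: "'a::ab_group_add set \<Rightarrow> 'a \<Rightarrow> 'a set" where
  "coset M a = (\<lambda>h. h + a) ` M"

lemma coset_eq_iff: assumes "add_closed M" shows "coset M a = coset M b \<longleftrightarrow> a - b \<in> M"
proof
  assume "coset M a = coset M b"
  moreover have "a \<in> coset M a" using add_closedD(1)[OF assms] by (force simp: coset_def)
  ultimately show "a - b \<in> M" by (auto simp: coset_def)
next
  have sub: "coset M a \<subseteq> coset M b" if "a - b \<in> M" for a b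
  proof
    fix z assume "z \<in> coset M a"
    then obtain h where h: "h \<in> M" "z = h + a" by (auto simp: coset_def)
    have "z = (h + (a - b)) + b" using h by simp
    moreover have "h + (a - b) \<in> M" using add_closedD(4)[OF assms] h that by blast
    ultimately show "z \<in> coset M b" unfolding coset_def by (rule image_eqI)
  qed
  assume "a - b \<in> M"
  moreover from this have "b - a \<in> M" using add_closedD(3)[OF assms] by fastforce
  ultimately show "coset M a = coset M b" using sub by blast
qed

lemma add_index_coset: "add_index L M = card (coset M ` L)"
proof -
  have "rcosets\<^bsub>\<lparr>carrier = L, monoid.mult = (+), one = 0\<rparr>\<^esub> M = coset M ` L"
    by (auto simp: RCOSETS_def r_coset_def coset_def)
  then show ?thesis by (simp add: add_index_def)
qed

text \<open>Sending \<open>f a\<close> to \<open>g a\<close> is well defined and injective because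
  the fibres agree. Infinite images are covered, in keeping with \<open>card\<close>.\<close>

lemma card_image_cong_kernel:
  assumes "\<And>a b. a \<in> L \<Longrightarrow> b \<in> L \<Longrightarrow> f a = f b \<longleftrightarrow> g a = g b"
  shows "card (f ` L) = card (g ` L)"
proof -
  let ?h = "\<lambda>y. g (SOME a. a \<in> L \<and> f a = y)"
  have h: "?h (f a) = g a" if "a \<in> L" for a
  proof -
    have "(SOME a'. a' \<in> L \<and> f a' = f a) \<in> L \<and> f (SOME a'. a' \<in> L \<and> f a' = f a) = f a"
      by (rule someI[of _ a]) (use that in auto)
    then show ?thesis using assms that by blast
  qed
  have "bij_betw ?h (f ` L) (g ` L)"
  proof (rule bij_betwI')
    fix y y' assume "y \<in> f ` L" "y' \<in> f ` L"
    then obtain a a' where "a \<in> L" "a' \<in> L" "y = f a" "y' = f a'" by blast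
    then show "?h y = ?h y' \<longleftrightarrow> y = y'" using h assms by simp
  next
    fix y assume "y \<in> f ` L"
    then show "?h y \<in> g ` L" using h by auto
  next
    fix z assume "z \<in> g ` L"
    then show "\<exists>y\<in>f ` L. z = ?h y" using h by auto
  qed
  then show ?thesis by (rule bij_betw_same_card)
qed

lemma add_index_fun:
  assumes "add_closed M" "\<And>a b. a \<in> L \<Longrightarrow> b \<in> L \<Longrightarrow> f a = f b \<longleftrightarrow> a - b \<in> M"
  shows "add_index L M = card (f ` L)"
  unfolding add_index_coset using assms by (intro card_image_cong_kernel) (simp add: coset_eq_iff)

text \<open>The class of \<open>a\<close> modulo \<open>N\<close> is recorded by its class modulo
  \<open>M\<close> together with the class modulo \<open>N\<close> of its difference from a chosen
  representative. As \<open>card\<close> of a product is always the product, infinite indices, which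
  count as 0, are covered too.\<close>

lemma add_index_tower:
  assumes "add_closed L" "add_closed M" "add_closed N" "N \<subseteq> M" "M \<subseteq> L"
  shows "add_index L N = add_index L M * add_index M N"
proof -
  define rep where "rep a = (SOME b. b \<in> L \<and> coset M b = coset M a)" for a
  have rep: "rep a \<in> L" "a - rep a \<in> M" if "a \<in> L" for a
  proof -
    have "rep a \<in> L \<and> coset M (rep a) = coset M a"
      unfolding rep_def by (rule someI[of _ a]) (use that in auto)
    then have "rep a \<in> L" "coset M a = coset M (rep a)" by auto
    then show "rep a \<in> L" "a - rep a \<in> M" using coset_eq_iff[OF assms(2)] by auto
  qed
  define f where "f a = (coset M a, coset N (a - rep a))" for a
  have "add_index L N = card (f ` L)"
  proof (rule add_index_fun[OF assms(3)])
    fix a b assume ab: "a \<in> L" "b \<in> L"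
    show "f a = f b \<longleftrightarrow> a - b \<in> N"
    proof
      assume "f a = f b"
      then have "coset M a = coset M b" "(a - rep a) - (b - rep b) \<in> N"
        by (auto simp: f_def coset_eq_iff[OF assms(3)])
      then show "a - b \<in> N" by (simp add: rep_def)
    next
      assume N: "a - b \<in> N"
      then have "coset M a = coset M b" using assms by (auto simp: coset_eq_iff)
      moreover from this have "rep a = rep b" by (simp add: rep_def)
      ultimately show "f a = f b" using N by (simp add: f_def coset_eq_iff[OF assms(3)])
    qed
  qed
  also have "f ` L = (coset M ` L) \<times> (coset N ` M)"
  proof (intro equalityI subsetI)
    fix z assume "z \<in> f ` L"
    then show "z \<in> (coset M ` L) \<times> (coset N ` M)" using rep by (auto simp: f_def)
  next
    fix z assume "z \<in> (coset M ` L) \<times> (coset N ` M)"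
    then obtain a m where z: "z = (coset M a, coset N m)" "a \<in> L" "m \<in> M" by auto
    define b where "b = rep a + m"
    have b: "b \<in> L" using add_closedD(4)[OF assms(1)] rep z assms(5) by (auto simp: b_def)
    have "b - a \<in> M" using add_closedD(2)[OF assms(2) z(3) rep(2)[OF z(2)]] by (simp add: b_def algebra_simps)
    then have c: "coset M b = coset M a" by (simp add: coset_eq_iff[OF assms(2)])
    then have "rep b = rep a" by (simp add: rep_def)
    then have "f b = z" using c z by (simp add: f_def b_def)
    then show "z \<in> f ` L" using b by auto
  qed
  finally show ?thesis by (simp add: card_cartesian_product add_index_coset)
qed

lemma add_index_image:
  assumes "inj g" "\<And>a b. g (a - b) = g a - g b" "add_closed M"
  shows "add_index (g ` L) (g ` M) = add_index L M"
proof -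
  have g0: "g 0 = 0" using assms(2)[of 0 0] by simp
  have M: "add_closed (g ` M)"
    unfolding add_closed_def
  proof (intro conjI ballI)
    show "0 \<in> g ` M" using g0 add_closedD(1)[OF assms(3)] by (metis imageI)
    fix x y assume "x \<in> g ` M" "y \<in> g ` M"
    then obtain a b where "a \<in> M" "b \<in> M" "x = g a" "y = g b" by blast
    then show "x - y \<in> g ` M" using add_closedD(2)[OF assms(3), of a b] assms(2)[of a b] by (metis imageI)
  qed
  have "add_index L M = card ((\<lambda>a. coset (g ` M) (g a)) ` L)"
    by (rule add_index_fun[OF assms(3)])
       (simp add: coset_eq_iff[OF M] assms(2)[symmetric] inj_image_mem_iff[OF assms(1)])
  then show ?thesis by (simp add: add_index_coset image_image)
qed

section \<open>Indices of principal ideals\<close>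

definition oid :: "zs \<Rightarrow> zs set" where "oid m = range ((*) m)"

definition lid :: "kq \<Rightarrow> kq set" where "lid x = range (\<lambda>k. k * x)"

definition rid :: "kq \<Rightarrow> kq set" where "rid x = range ((*) x)"

lemma add_closed_rangeI:
  fixes f :: "'a::ab_group_add \<Rightarrow> 'b::ab_group_add"
  assumes "\<And>a b. f (a - b) = f a - f b" shows "add_closed (range f)"
proof -
  have "f 0 = 0" using assms[of 0 0] by simp
  then show ?thesis unfolding add_closed_def using assms by (metis (no_types) rangeE rangeI)
qed

lemma add_closed_ids [simp]: "add_closed (oid m)" "add_closed (lid x)" "add_closed (rid x)"
  unfolding oid_def lid_def rid_def by (rule add_closed_rangeI; simp add: algebra_simps)+

lemma oid_mem: "x \<in> oid m \<longleftrightarrow> m dvd x"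
  by (auto simp: oid_def)

lemma lid_self [simp]: "x \<in> lid x" and rid_self [simp]: "x \<in> rid x"
  unfolding lid_def rid_def by (rule range_eqI[of _ _ 1], simp)+

lemma lid_mult: "y \<in> lid x \<Longrightarrow> k * y \<in> lid x"
  unfolding lid_def by (auto simp: mult.assoc[symmetric])

lemma rid_mult: "y \<in> rid x \<Longrightarrow> y * k \<in> rid x"
  unfolding rid_def by (auto simp: mult.assoc)

lemma lid_subset_iff: "lid x \<subseteq> lid y \<longleftrightarrow> x \<in> lid y"
proof
  show "x \<in> lid y" if "lid x \<subseteq> lid y" using that lid_self by blast
  show "lid x \<subseteq> lid y" if "x \<in> lid y" using lid_mult[OF that] by (auto simp: lid_def[of x])
qed

lemma rid_subset_iff: "rid x \<subseteq> rid y \<longleftrightarrow> x \<in> rid y"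
proof
  show "x \<in> rid y" if "rid x \<subseteq> rid y" using that rid_self by blast
  show "rid x \<subseteq> rid y" if "x \<in> rid y" using rid_mult[OF that] by (auto simp: rid_def[of x])
qed

text \<open>Multiplicativity and invariance under Galois conjugation give
  \<open>I m * I m = I (m * gconj m) = I (Nm m)\<close>, and for a rational integer the residues of
  the two coordinates can be counted directly.\<close>

lemma oid_index: assumes "m \<noteq> 0" shows "add_index UNIV (oid m) = nat \<bar>Nm m\<bar>"
proof -
  define I where "I m = add_index UNIV (oid m)" for m
  have mult: "I (m * n) = I m * I n" if "n \<noteq> 0" for m n
  proof -
    have "I (m * n) = I n * add_index (oid n) (oid (m * n))"
      unfolding I_def by (rule add_index_tower) (auto simp: oid_mem intro: dvd_mult_right)
    also have "oid n = (*) n ` UNIV" by (simp add: oid_def)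
    also have "oid (m * n) = (*) n ` oid m" by (auto simp: oid_def image_image mult_ac)
    also have "add_index ((*) n ` UNIV) ((*) n ` oid m) = I m"
      unfolding I_def using that by (intro add_index_image) (auto simp: inj_def algebra_simps)
    finally show ?thesis by simp
  qed
  have conj: "I (gconj m) = I m"
  proof -
    have "gconj ` UNIV = UNIV" by (rule surjI[of gconj gconj, unfolded surj_def[symmetric]]) (simp add: zs_eq_iff)
    moreover have "gconj ` oid m = oid (gconj m)"
    proof -
      have "gconj (m * x) = gconj m * gconj x" for x by (rule gconj_mult)
      then have "gconj ` oid m = (*) (gconj m) ` (gconj ` UNIV)" by (simp add: oid_def image_image)
      with \<open>gconj ` UNIV = UNIV\<close> show ?thesis by (simp add: oid_def)
    qed
    moreover have "add_index (gconj ` UNIV) (gconj ` oid m) = add_index UNIV (oid m)"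
      by (rule add_index_image) (auto simp: inj_def zs_eq_iff)
    ultimately show ?thesis by (simp add: I_def)
  qed
  have int: "I (of_int n) = nat (n\<^sup>2)" if "n \<noteq> 0" for n
  proof -
    let ?n = "\<bar>n\<bar>"
    let ?f = "\<lambda>x. (rat_part x mod ?n, irr_part x mod ?n)"
    have "I (of_int n) = card (range ?f)"
      unfolding I_def
    proof (rule add_index_fun)
      fix a b :: zs
      have "a - b \<in> oid (of_int n) \<longleftrightarrow> n dvd rat_part (a - b) \<and> n dvd irr_part (a - b)"
      proof
        assume "a - b \<in> oid (of_int n)"
        then obtain c where "a - b = of_int n * c" by (auto simp: oid_def)
        then show "n dvd rat_part (a - b) \<and> n dvd irr_part (a - b)" by simp
      next
        assume "n dvd rat_part (a - b) \<and> n dvd irr_part (a - b)"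
        then obtain c d where "rat_part (a - b) = n * c" "irr_part (a - b) = n * d" by (auto elim!: dvdE)
        then have "a - b = of_int n * ZS c d" by (simp add: zs_eq_iff)
        then show "a - b \<in> oid (of_int n)" by (auto simp: oid_def)
      qed
      then show "?f a = ?f b \<longleftrightarrow> a - b \<in> oid (of_int n)"
        by (simp add: mod_eq_dvd_iff)
    qed simp
    also have "range ?f = {0..<?n} \<times> {0..<?n}"
    proof (intro equalityI subsetI)
      fix z assume "z \<in> {0..<?n} \<times> {0..<?n}"
      then obtain a b where "z = (a, b)" "0 \<le> a" "a < ?n" "0 \<le> b" "b < ?n" by auto
      then have "z = ?f (ZS a b)" by simp
      then show "z \<in> range ?f" by blast
    qed (use that in auto)
    finally show ?thesis by (simp add: card_cartesian_product power2_eq_square nat_mult_distrib flip: abs_mult)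
        (metis abs_ge_zero abs_mult abs_mult_self_eq nat_mult_distrib)
  qed
  have "I m * I m = nat ((Nm m)\<^sup>2)"
    using mult[of "gconj m" m] assms conj int[of "Nm m"] by (simp add: zs_eq_iff mult_gconj)
  then have "int (I m) * int (I m) = \<bar>Nm m\<bar> * \<bar>Nm m\<bar>"
    by (metis abs_mult_self_eq int_nat_eq of_nat_mult power2_eq_square zero_le_power2)
  then have "int (I m) = \<bar>Nm m\<bar>" by (metis abs_ge_zero of_nat_0_le_iff power2_eq_iff_nonneg power2_eq_square)
  then show ?thesis by (simp add: I_def)
qed

lemma pK_mem: "x \<in> lid (oK p) \<longleftrightarrow> p dvd c1 x \<and> p dvd cu x \<and> p dvd cv x \<and> p dvd cw x"
proof
  assume "x \<in> lid (oK p)"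
  then obtain y where "x = oK p * y" by (auto simp: lid_def oK_comm)
  then show "p dvd c1 x \<and> p dvd cu x \<and> p dvd cv x \<and> p dvd cw x" by simp
next
  assume "p dvd c1 x \<and> p dvd cu x \<and> p dvd cv x \<and> p dvd cw x"
  then obtain a b c d where "c1 x = p * a" "cu x = p * b" "cv x = p * c" "cw x = p * d"
    by (auto elim!: dvdE)
  then have "x = oK p * KQ a b c d" by (simp add: kq_eq_iff)
  then show "x \<in> lid (oK p)" by (metis lid_def oK_comm(1) rangeI)
qed

lemma pK_index: assumes "m \<noteq> 0" shows "add_index UNIV (lid (oK m)) = nat \<bar>Nm m\<bar> ^ 4"
proof -
  let ?c = "coset (oid m)"
  let ?f = "\<lambda>x. (?c (c1 x), ?c (cu x), ?c (cv x), ?c (cw x))"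
  have "add_index UNIV (lid (oK m)) = card (range ?f)"
    by (rule add_index_fun) (auto simp: pK_mem coset_eq_iff oid_mem)
  also have "range ?f = range ?c \<times> range ?c \<times> range ?c \<times> range ?c"
  proof (intro equalityI subsetI)
    fix z assume "z \<in> range ?c \<times> range ?c \<times> range ?c \<times> range ?c"
    then obtain a b c d where "z = ?f (KQ a b c d)" by auto
    then show "z \<in> range ?f" by blast
  qed auto
  finally show ?thesis
    using oid_index[OF assms] by (simp add: card_cartesian_product add_index_coset power4_eq_xxxx)
qed

definition ind :: "kq \<Rightarrow> nat" where "ind r = add_index UNIV (lid r)"

lemma add_index_sandwich:
  assumes "b \<noteq> 0" "a \<noteq> 0"
  shows "add_index (range (\<lambda>k. a * k * b)) (range (\<lambda>k. a * (k * c) * b)) = ind c"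
proof -
  have "add_index ((\<lambda>k. a * k * b) ` UNIV) ((\<lambda>k. a * k * b) ` lid c) = add_index UNIV (lid c)"
    using assms by (intro add_index_image) (auto simp: inj_def algebra_simps)
  then show ?thesis by (simp add: ind_def lid_def image_image)
qed

lemma ind_mult: assumes "b \<noteq> 0" shows "ind (a * b) = ind a * ind b"
proof -
  have "ind (a * b) = ind b * add_index (lid b) (lid (a * b))"
    unfolding ind_def by (rule add_index_tower) (auto simp: lid_subset_iff lid_mult)
  also have "add_index (lid b) (lid (a * b)) = ind a"
    using add_index_sandwich[OF assms, of 1 a] by (simp add: lid_def mult.assoc)
  finally show ?thesis by simp
qed

lemma ind_oK: "m \<noteq> 0 \<Longrightarrow> ind (oK m) = nat \<bar>Nm m\<bar> ^ 4"
  using pK_index by (simp add: ind_def)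

lemma ind_pos: "r \<noteq> 0 \<Longrightarrow> ind r > 0"
  using ind_mult[of r "qbar r"] ind_oK[of "nr r"] by (cases "ind r = 0") (auto simp: mult_qbar qbar_mult_self)

text \<open>An element is conjugate to its quaternion conjugate, by any of its commutators.\<close>
lemma ind_qbar: "ind (qbar r) = ind r"
proof (cases "\<exists>x. x * r \<noteq> r * x")
  case True
  then obtain x where x: "x * r \<noteq> r * x" by blast
  define s where "s = x * r - r * x"
  have s: "s \<noteq> 0" using x by (simp add: s_def)
  have r: "r \<noteq> 0" using x by auto
  have rr: "r * r = oK (tr r) * r - oK (nr r)"
    using mult_qbar[of r] by (simp add: qbar_eq algebra_simps oK_comm(1))
  have "s * r = x * (r * r) - r * x * r" by (simp add: s_def algebra_simps)
  also have "\<dots> = oK (tr r) * (x * r) - oK (nr r) * x - r * x * r"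
    unfolding rr by (simp add: algebra_simps oK_comm)
  finally have 1: "s * r = oK (tr r) * (x * r) - oK (nr r) * x - r * x * r" .
  have "qbar r * s = oK (tr r) * (x * r) - oK (tr r) * (r * x) - r * x * r + (r * r) * x"
    by (simp add: s_def qbar_eq algebra_simps)
  also have "\<dots> = oK (tr r) * (x * r) - r * x * r - oK (nr r) * x"
    unfolding rr by (simp add: algebra_simps)
  finally have "s * r = qbar r * s" using 1 by simp
  then have "ind s * ind r = ind (qbar r) * ind s" using ind_mult s r by metis
  then show ?thesis using ind_pos[OF s] by simp
next
  case False
  \<comment> \<open>An element commuting with \<open>u\<close> and \<open>v\<close> is a scalar,
    which conjugation fixes.\<close>
  have u: "KQ 0 1 0 0 * r = r * KQ 0 1 0 0" and v: "KQ 0 0 1 0 * r = r * KQ 0 0 1 0" using False by auto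
  have 2: "x = - x \<Longrightarrow> x = 0" for x :: zs by (simp add: zs_eq_iff)
  have c: "r2 * cw r = - cv r" and c': "cv r + r2 * cw r = - cv r"
    using arg_cong[OF u, of c1] arg_cong[OF u, of cw] by (simp_all add: kq_mult_simps algebra_simps)
  from c c' have "cv r = 0" using 2[of "cv r"] by simp
  moreover from this c have "cw r = 0" by (simp add: r2_def zs_eq_iff)
  moreover from calculation have "cu r = 0" using arg_cong[OF v, of c1] by (simp add: kq_mult_simps)
  ultimately have "cu r = 0 \<and> cv r = 0 \<and> cw r = 0" by simp
  then have "r = oK (c1 r)" by (simp add: kq_eq_iff)
  then show ?thesis by (metis qbar_add(7))
qed

text \<open>An element and its conjugate have equal index and their product is the scalar
  \<open>nr r\<close>, so the index is the square root of \<open>Nm (nr r)^4\<close>.\<close>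

lemma ind_eq: assumes "r \<noteq> 0" shows "ind r = (nat (Nm (nr r)))\<^sup>2"
proof -
  have "ind r * ind r = ind (oK (nr r))"
    using ind_mult[of "qbar r" r] assms ind_qbar[of r] by (simp add: mult_qbar)
  also have "\<dots> = (nat (Nm (nr r)))\<^sup>2 * (nat (Nm (nr r)))\<^sup>2"
    using ind_oK[of "nr r"] assms Nm_nr_nonneg[of r] by (simp add: power4_eq_xxxx power2_eq_square mult.assoc)
  finally show ?thesis by (metis power2_eq_square power2_eq_iff_nonneg zero_le)
qed

lemma Nm_nr_pos: "x \<noteq> 0 \<Longrightarrow> Nm (nr x) > 0"
  using Nm_nr_nonneg[of x] Nm_eq_0[of "nr x"] by (simp add: less_le)

lemma lid_index: "r \<noteq> 0 \<Longrightarrow> add_index UNIV (lid r) = (nat (Nm (nr r)))\<^sup>2"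
  using ind_eq by (simp add: ind_def)

lemma qbar_image_lid: "qbar ` lid r = rid (qbar r)" and qbar_image_rid: "qbar ` rid r = lid (qbar r)"
proof -
  have s: "qbar ` UNIV = UNIV" by (metis qbar_add(4) surjI)
  have "qbar ` lid r = (\<lambda>k. qbar r * k) ` (qbar ` UNIV)" by (simp add: lid_def image_image qbar_mult)
  then show "qbar ` lid r = rid (qbar r)" by (simp only: s rid_def)
  have "qbar ` rid r = (\<lambda>k. k * qbar r) ` (qbar ` UNIV)" by (simp add: rid_def image_image qbar_mult)
  then show "qbar ` rid r = lid (qbar r)" by (simp only: s lid_def)
qed

lemma inj_qbar: "inj qbar" by (metis injI qbar_add(4))

lemma rid_index: assumes "r \<noteq> 0" shows "add_index UNIV (rid r) = (nat (Nm (nr r)))\<^sup>2"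
proof -
  have "add_index (qbar ` UNIV) (qbar ` lid (qbar r)) = add_index UNIV (lid (qbar r))"
    by (rule add_index_image) (auto simp: inj_qbar)
  moreover have "qbar ` UNIV = UNIV" by (metis qbar_add(4) surjI)
  ultimately show ?thesis using lid_index[of "qbar r"] assms by (simp add: qbar_image_lid)
qed

lemma sandwich_index: assumes "a \<noteq> 0" "b \<noteq> 0"
  shows "add_index UNIV (range (\<lambda>k. a * k * b)) = (nat (Nm (nr a)) * nat (Nm (nr b)))\<^sup>2"
proof -
  have "add_index UNIV (range (\<lambda>k. a * k * b))
    = add_index UNIV (rid a) * add_index (rid a) (range (\<lambda>k. a * k * b))"
    by (rule add_index_tower) (auto intro!: add_closed_rangeI simp: algebra_simps rid_mult)
  also have "add_index (rid a) (range (\<lambda>k. a * k * b)) = ind b"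
    using add_index_sandwich[of 1 a b] assms by (simp add: rid_def mult.assoc)
  finally show ?thesis using assms by (simp add: rid_index ind_eq power_mult_distrib)
qed

section \<open>Euclidean division in the cubian ring\<close>

text \<open>Integers of equal parity, halved, are the coordinates of Hurwitz quaternions. The
  candidates are a nearest integral point, with error \<open>t\<close>, and a nearest half-odd
  point, with error \<open>b\<close>. Their squared lengths are at most \<open>T / 2\<close> and
  \<open>1 - T / 2\<close>, so one is at most 1/2. In the extreme case there are several nearest
  points, and one of them has an error that is not orthogonal to \<open>d\<close>.\<close>

lemma hurwitz_rounding:
  fixes a d :: "real^4"
  assumes "d \<noteq> 0"
  obtains m :: "4 \<Rightarrow> int" and e :: "real^4"
  where "\<And>i j. even (m i - m j)" "\<And>i. e $ i = a $ i - of_int (m i) / 2"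
    "e \<bullet> e < 1/2 \<or> (e \<bullet> e \<le> 1/2 \<and> e \<bullet> d \<noteq> 0)"
proof -
  define n where "n i = round (a $ i)" for i
  define t where "t = (\<chi> i. a $ i - of_int (n i))"
  define s :: "4 \<Rightarrow> int" where "s i = (if t $ i \<ge> 0 then 1 else -1)" for i
  define b where "b = (\<chi> i. t $ i - of_int (s i) / 2)"
  define T where "T = (\<Sum>i\<in>UNIV. \<bar>t $ i\<bar>)"
  have t: "\<bar>t $ i\<bar> \<le> 1/2" for i
    using of_int_round_abs_le[of "a $ i"] by (simp add: t_def n_def abs_minus_commute)
  have b: "\<bar>b $ i\<bar> = 1/2 - \<bar>t $ i\<bar>" for i
    using t[of i] by (auto simp: b_def s_def)
  have sq: "x * x \<le> \<bar>x\<bar> / 2" if "\<bar>x\<bar> \<le> 1/2" for x :: real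
    using mult_left_mono[OF that, of "\<bar>x\<bar>"] by (simp add: abs_mult[symmetric])
  have tt: "t \<bullet> t \<le> T / 2"
    unfolding inner_vec_def T_def sum_divide_distrib by (rule sum_mono) (use sq t in auto)
  have "b \<bullet> b \<le> (\<Sum>i\<in>(UNIV::4 set). (1/2 - \<bar>t $ i\<bar>) / 2)"
    unfolding inner_vec_def
  proof (rule sum_mono)
    fix i
    have "\<bar>b $ i\<bar> \<le> 1/2" using b[of i] by simp
    from sq[OF this] show "b $ i \<bullet> b $ i \<le> (1/2 - \<bar>t $ i\<bar>) / 2" by (simp add: b)
  qed
  also have "\<dots> = 1 - T / 2" by (simp add: T_def sum_4 field_simps)
  finally have bb: "b \<bullet> b \<le> 1 - T / 2" .
  have et: "t $ i = a $ i - of_int (2 * n i) / 2" for i by (simp add: t_def)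
  have eb: "b $ i = a $ i - of_int (2 * n i + s i) / 2" for i by (simp add: b_def t_def field_simps)
  have os: "odd (s i)" for i by (simp add: s_def)
  show thesis
  proof (cases "t \<bullet> t < 1/2 \<or> b \<bullet> b < 1/2")
    case True
    then show thesis using that[OF _ et] that[OF _ eb] os by auto
  next
    case False
    then have T: "T = 1" and tt': "t \<bullet> t = T / 2" "t \<bullet> t = 1/2" "b \<bullet> b = 1/2" using tt bb by auto
    \<comment> \<open>Equality in the sum forces equality in each term of \<open>sq\<close>, so that
      every coordinate is 0 or plus or minus 1/2.\<close>
    have "\<bar>t $ i\<bar> / 2 - t $ i * t $ i = 0" for i
    proof -
      have "(\<Sum>i\<in>UNIV. \<bar>t $ i\<bar> / 2 - t $ i * t $ i) = 0"
        using tt'(1) by (simp add: inner_vec_def T_def sum_subtractf sum_divide_distrib)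
      moreover have "\<forall>i\<in>UNIV. 0 \<le> \<bar>t $ i\<bar> / 2 - t $ i * t $ i" using sq t by simp
      ultimately show ?thesis using sum_nonneg_eq_0_iff[of UNIV "\<lambda>i. \<bar>t $ i\<bar> / 2 - t $ i * t $ i"] by simp
    qed
    then have "\<bar>t $ i\<bar> * (1/2 - \<bar>t $ i\<bar>) = 0" for i
      by (simp only: right_diff_distrib abs_mult_self_eq) simp
    then have t0: "t $ i = 0 \<or> \<bar>t $ i\<bar> = 1/2" for i
      unfolding mult_eq_0_iff by (metis abs_eq_0 eq_iff_diff_eq_0)
    obtain k where k: "d $ k \<noteq> 0" using assms by (auto simp: vec_eq_iff)
    show thesis
    proof (cases "t $ k = 0")
      case True
      \<comment> \<open>Coordinate \<open>k\<close> of \<open>b\<close> is plus or minus 1/2, so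
        changing its sign leads to another equally near half-odd point, while the inner product with
        \<open>d\<close> moves by the non-zero \<open>d $ k\<close> up to sign.\<close>
      define b' where "b' = b + axis k (of_int (s k))"
      have sk: "real_of_int (s k) * real_of_int (s k) = 1" by (simp add: s_def)
      have bk: "b $ k = - of_int (s k) / 2" using True by (simp add: b_def)
      have "b' \<bullet> b' = b \<bullet> b"
        unfolding b'_def by (simp add: inner_add inner_axis inner_axis' bk sk)
      moreover have "b' \<bullet> d = b \<bullet> d + of_int (s k) * d $ k"
        by (simp add: b'_def inner_add inner_axis')
      moreover have "of_int (s k) * d $ k \<noteq> 0" using k sk by auto
      ultimately have b'd: "b' \<bullet> b' \<le> 1/2 \<and> b' \<bullet> d \<noteq> 0" if "b \<bullet> d = 0" using that tt'(3) by simp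
      have b'e: "b' $ i = a $ i - of_int (2 * n i + s i - (if i = k then 2 * s k else 0)) / 2" for i
        by (simp add: b'_def eb axis_def field_simps)
      show thesis
      proof (cases "b \<bullet> d = 0")
        case True
        show thesis by (rule that[OF _ b'e]) (use os b'd[OF True] in auto)
      next
        case False
        show thesis by (rule that[OF _ eb]) (use os tt'(3) False in auto)
      qed
    next
      case False
      define t' where "t' = t - axis k (2 * t $ k)"
      define q where "q = (if t $ k > 0 then 1 else -1 :: int)"
      have q: "2 * t $ k = of_int q" using t0[of k] False by (auto simp: q_def)
      have "t' \<bullet> t' = t \<bullet> t"
        unfolding t'_def by (simp add: inner_diff inner_axis inner_axis')
      moreover have "t' \<bullet> d = t \<bullet> d - 2 * t $ k * d $ k"
        by (simp add: t'_def inner_diff inner_axis')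
      moreover have "2 * t $ k * d $ k \<noteq> 0" using k False by auto
      ultimately have t'd: "t' \<bullet> t' \<le> 1/2 \<and> t' \<bullet> d \<noteq> 0" if "t \<bullet> d = 0" using that tt'(2) by simp
      have t'e: "t' $ i = a $ i - of_int (2 * n i + (if i = k then 2 * q else 0)) / 2" for i
      proof -
        have "t' $ i = t $ i - of_int (if i = k then 2 * q else 0) / 2"
          by (simp add: t'_def axis_def q)
        then show ?thesis unfolding et by (simp add: add_divide_distrib)
      qed
      show thesis
      proof (cases "t \<bullet> d = 0")
        case True
        show thesis by (rule that[OF _ t'e]) (use t'd[OF True] in auto)
      next
        case False
        show thesis by (rule that[OF _ et]) (use tt'(2) False in auto)
      qed
    qed
  qed
qed

text \<open>The cubian ring is \<open>H + u H\<close> for the Hurwitz order \<open>H\<close>; these are twice the coordinates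
  of the two components.\<close>
definition hur1 :: "kq \<Rightarrow> 4 \<Rightarrow> int" where
  "hur1 x i = (if i = 1 then 2 * rat_part (c1 x) + 2 * irr_part (cu x) + 2 * irr_part (cv x) + rat_part (cw x)
     else if i = 2 then 2 * irr_part (cu x) + rat_part (cw x)
     else if i = 3 then 2 * irr_part (cv x) + rat_part (cw x) else rat_part (cw x))"

definition hur2 :: "kq \<Rightarrow> 4 \<Rightarrow> int" where
  "hur2 x i = (if i = 1 then 2 * irr_part (c1 x) + 2 * rat_part (cu x) + rat_part (cv x) + 2 * irr_part (cw x)
     else if i = 2 then - 2 * irr_part (c1 x) - rat_part (cv x)
     else if i = 3 then rat_part (cv x) + 2 * irr_part (cw x) else - rat_part (cv x))"

lemma hur_diff: "hur1 (x - y) i = hur1 x i - hur1 y i" "hur2 (x - y) i = hur2 x i - hur2 y i"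
  by (simp_all add: hur1_def hur2_def)

lemma hur_smul: "hur1 (oK (of_int n) * x) i = n * hur1 x i" "hur2 (oK (of_int n) * x) i = n * hur2 x i"
  by (simp_all add: hur1_def hur2_def algebra_simps)

text \<open>For \<open>x = a + u b\<close> with Hurwitz quaternions \<open>a\<close> and
  \<open>b\<close>, the rational part of the norm is \<open>|a|^2 + |b|^2\<close> and the irrational
  part is the inner product of \<open>a\<close> with \<open>(1 + i) b\<close>. The factors 4 come
  from the doubled coordinates.\<close>

lemma nr_hur:
  "4 * rat_part (nr x) = (\<Sum>i\<in>UNIV. (hur1 x i)\<^sup>2) + (\<Sum>i\<in>UNIV. (hur2 x i)\<^sup>2)"
  "4 * irr_part (nr x) = hur1 x 1 * (hur2 x 1 - hur2 x 2) + hur1 x 2 * (hur2 x 1 + hur2 x 2)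
     + hur1 x 3 * (hur2 x 3 - hur2 x 4) + hur1 x 4 * (hur2 x 3 + hur2 x 4)"
  by (simp_all add: nr_def hur1_def hur2_def sum_4 power2_eq_square algebra_simps)

lemma hur_surj:
  assumes "\<And>i j. even (m i - m j)" "\<And>i j. even (m' i - m' j)"
  obtains g where "hur1 g = m" "hur2 g = m'"
proof -
  have "\<exists>z. m i - m 4 = 2 * z" "\<exists>z. m' i - m' 4 = 2 * z" for i using assms by (simp_all add: dvd_def[symmetric])
  then obtain z z' where z: "\<And>i. m i - m 4 = 2 * z i" "\<And>i. m' i - m' 4 = 2 * z' i" by metis
  define g where "g = KQ (ZS (z 1 - z 2 - z 3) (- z' 2)) (ZS (z' 1 + m' 4 + z' 2 - (z' 3 + m' 4)) (z 2))
     (ZS (- m' 4) (z 3)) (ZS (m 4) (z' 3 + m' 4))"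
  have "hur1 g i = m i" "hur2 g i = m' i" for i
    using z[of 1] z[of 2] z[of 3] exhaust_4[of i] by (auto simp: g_def hur1_def hur2_def)
  then have "hur1 g = m" "hur2 g = m'" by auto
  then show thesis by (rule that)
qed

text \<open>Both Hurwitz components can be rounded to squared distance at most 1/2, so that the rational
  part of the norm is at most \<open>n\<^sup>2\<close>.  When it equals \<open>n\<^sup>2\<close>, a nearest lattice point with non-zero
  irrational part of the norm makes the integer norm smaller.\<close>
lemma kq_division_int:
  fixes n :: int
  assumes n: "n > 0"
  obtains g where "Nm (nr (x - oK (of_int n) * g)) < n ^ 4"
proof -
  define a :: "real^4" where "a = (\<chi> i. of_int (hur1 x i) / of_int (2 * n))"
  define c :: "real^4" where "c = (\<chi> i. of_int (hur2 x i) / of_int (2 * n))"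
  \<comment> \<open>An arbitrary non-zero direction, for the roundings in which only the length of
    the error matters.\<close>
  have ax: "axis 1 1 \<noteq> (0 :: real^4)" by (simp add: axis_eq_0_iff)
  obtain m' e' where m'0: "\<And>i j. even (m' i - m' j)"
    "\<And>i. e' $ i = c $ i - of_int (m' i) / 2"
    "e' \<bullet> e' < 1/2 \<or> (e' \<bullet> e' \<le> 1/2 \<and> e' \<bullet> axis 1 1 \<noteq> 0)"
    using hurwitz_rounding[OF ax, of c thesis] by blast
  then have m': "\<And>i j. even (m' i - m' j)"
    "\<And>i. e' $ i = c $ i - of_int (m' i) / 2" "e' \<bullet> e' \<le> 1/2" by auto
  \<comment> \<open>These are the coordinates of \<open>(1 + i) e'\<close>, so
    \<open>e \<bullet> d\<close> is the irrational part of the norm of the error. The vector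
    vanishes only together with \<open>e'\<close>.\<close>
  define d :: "real^4" where
    "d = vector [e' $ 1 - e' $ 2, e' $ 1 + e' $ 2, e' $ 3 - e' $ 4, e' $ 3 + e' $ 4]"
  obtain m e where m: "\<And>i j. even (m i - m j)" "\<And>i. e $ i = a $ i - of_int (m i) / 2"
    and me: "e \<bullet> e + e' \<bullet> e' < 1 \<or> (e \<bullet> e + e' \<bullet> e' \<le> 1 \<and> e \<bullet> d \<noteq> 0)"
  proof (cases "d = 0")
    case True
    then have "e' $ 1 - e' $ 2 = 0" "e' $ 1 + e' $ 2 = 0" "e' $ 3 - e' $ 4 = 0" "e' $ 3 + e' $ 4 = 0"
      by (simp_all add: d_def vec_eq_iff forall_4 vector_4)
    then have "e' \<bullet> e' = 0" by (simp add: inner_4)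
    obtain m e where "\<And>i j. even (m i - m j)" "\<And>i. e $ i = a $ i - of_int (m i) / 2"
      and e: "e \<bullet> e < 1/2 \<or> (e \<bullet> e \<le> 1/2 \<and> e \<bullet> axis 1 1 \<noteq> 0)"
      using hurwitz_rounding[OF ax, of a thesis] by blast
    moreover have "e \<bullet> e + e' \<bullet> e' < 1" using e \<open>e' \<bullet> e' = 0\<close> by auto
    ultimately show thesis using that by blast
  next
    case False
    obtain m e where "\<And>i j. even (m i - m j)" "\<And>i. e $ i = a $ i - of_int (m i) / 2"
      and e: "e \<bullet> e < 1/2 \<or> (e \<bullet> e \<le> 1/2 \<and> e \<bullet> d \<noteq> 0)"
      using hurwitz_rounding[OF False, of a thesis] by blast
    moreover have "e \<bullet> e + e' \<bullet> e' < 1 \<or> (e \<bullet> e + e' \<bullet> e' \<le> 1 \<and> e \<bullet> d \<noteq> 0)"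
      using e m'(3) by auto
    ultimately show thesis using that by blast
  qed
  obtain g where g: "hur1 g = m" "hur2 g = m'" using hur_surj[of m m'] m(1) m'(1) by blast
  define z where "z = x - oK (of_int n) * g"
  have ha: "of_int (hur1 x i) = 2 * of_int n * a $ i" and hc: "of_int (hur2 x i) = 2 * of_int n * c $ i" for i
    using n by (simp_all add: a_def c_def)
  have h1: "of_int (hur1 z i) = 2 * of_int n * e $ i" for i
    unfolding z_def hur_diff hur_smul g m(2) of_int_diff of_int_mult ha by (simp add: algebra_simps)
  have h2: "of_int (hur2 z i) = 2 * of_int n * e' $ i" for i
    unfolding z_def hur_diff hur_smul g m'(2) of_int_diff of_int_mult hc by (simp add: algebra_simps)
  have "4 * real_of_int (rat_part (nr z)) = real_of_int (4 * rat_part (nr z))" by simp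
  also have "\<dots> = 4 * (of_int n)\<^sup>2 * (e \<bullet> e + e' \<bullet> e')"
    unfolding nr_hur inner_4 by (simp only: of_int_add of_int_mult h1 h2 sum_4 power2_eq_square) (simp add: algebra_simps)
  finally have r: "real_of_int (rat_part (nr z)) = (of_int n)\<^sup>2 * (e \<bullet> e + e' \<bullet> e')" by simp
  have "4 * real_of_int (irr_part (nr z)) = real_of_int (4 * irr_part (nr z))" by simp
  also have "\<dots> = 4 * (of_int n)\<^sup>2 * (e \<bullet> d)"
    unfolding nr_hur inner_4 d_def vector_4
    by (simp only: of_int_add of_int_diff of_int_mult h1 h2 power2_eq_square) (simp add: algebra_simps)
  finally have i: "real_of_int (irr_part (nr z)) = (of_int n)\<^sup>2 * (e \<bullet> d)" by simp
  let ?S = "e \<bullet> e + e' \<bullet> e'"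
  have S0: "0 \<le> ?S" by simp
  have "?S\<^sup>2 - 2 * (e \<bullet> d)\<^sup>2 < 1"
    using me
  proof
    assume "?S < 1"
    then have "?S\<^sup>2 < 1" using S0 by (metis abs_of_nonneg abs_square_less_1)
    then show ?thesis using zero_le_power2[of "e \<bullet> d"] by linarith
  next
    assume "?S \<le> 1 \<and> e \<bullet> d \<noteq> 0"
    then have "?S\<^sup>2 \<le> 1" "(e \<bullet> d)\<^sup>2 > 0" using S0 by (auto simp: power_le_one)
    then show ?thesis by linarith
  qed
  then have "(of_int n)^4 * (?S\<^sup>2 - 2 * (e \<bullet> d)\<^sup>2) < (of_int n :: real) ^ 4 * 1"
    using n by (intro mult_strict_left_mono) auto
  moreover have "real_of_int (Nm (nr z)) = (of_int n)^4 * (?S\<^sup>2 - 2 * (e \<bullet> d)\<^sup>2)"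
  proof -
    have p: "((of_int n :: real)\<^sup>2 * S)\<^sup>2 = (of_int n)^4 * S\<^sup>2" for S
      by (simp add: power_mult_distrib flip: power_mult)
    have "real_of_int (Nm (nr z)) = (real_of_int (rat_part (nr z)))\<^sup>2 - 2 * (real_of_int (irr_part (nr z)))\<^sup>2"
      by (simp add: Nm_def)
    then show ?thesis unfolding r i p by (simp only: right_diff_distrib mult.left_commute)
  qed
  ultimately have "real_of_int (Nm (nr z)) < real_of_int (n ^ 4)" by simp
  then have "Nm (nr z) < n ^ 4" by (simp only: of_int_less_iff)
  then show thesis using that by (simp add: z_def)
qed

text \<open>Multiplication by \<open>qbar b * oK (gconj (nr b))\<close> turns the divisor into the
  rational integer \<open>n = Nm (nr b)\<close>. The multiplier has norm \<open>n^3\<close>, so the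
  bound \<open>n^4\<close> of the integral division cancels to \<open>n\<close>.\<close>

lemma kq_division:
  assumes "b \<noteq> 0"
  obtains g where "Nm (nr (a - g * b)) < Nm (nr b)"
proof -
  define n where "n = Nm (nr b)"
  have n: "n > 0" using Nm_nr_pos[OF assms] by (simp add: n_def)
  define y where "y = a * qbar b * oK (gconj (nr b))"
  obtain g where g: "Nm (nr (y - oK (of_int n) * g)) < n ^ 4" using kq_division_int[OF n] by blast
  have "(a - g * b) * (qbar b * oK (gconj (nr b))) = y - g * (b * qbar b) * oK (gconj (nr b))"
    by (simp add: y_def algebra_simps)
  also have "g * (b * qbar b) * oK (gconj (nr b)) = oK (of_int n) * g"
    by (simp add: mult_qbar mult.assoc n_def flip: oK_mult) (simp add: mult_gconj oK_comm)
  finally have "Nm (nr (a - g * b)) * Nm (nr (qbar b * oK (gconj (nr b)))) < n ^ 4"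
    using g by (metis Nm_mult nr_mult)
  then have "Nm (nr (a - g * b)) * n ^ 3 < n * n ^ 3"
    by (simp add: nr_mult Nm_mult n_def[symmetric] power3_eq_cube power4_eq_xxxx mult.assoc)
  then have "Nm (nr (a - g * b)) < n" using n by simp
  then show thesis using that by (simp add: n_def)
qed

definition is_lideal :: "kq set \<Rightarrow> bool" where
  "is_lideal I \<longleftrightarrow> add_closed I \<and> (\<forall>k. \<forall>x\<in>I. k * x \<in> I)"

theorem left_ideal_principal:
  assumes "is_lideal I"
  obtains x where "I = lid x"
proof (cases "I = {0}")
  case True
  then show thesis using that[of 0] by (auto simp: lid_def)
next
  case False
  have ac: "add_closed I" and m: "\<And>k x. x \<in> I \<Longrightarrow> k * x \<in> I" using assms by (auto simp: is_lideal_def)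
  from False obtain x0 where "x0 \<in> I" "x0 \<noteq> 0" using add_closedD(1)[OF ac] by blast
  then obtain b where b: "b \<in> I" "b \<noteq> 0" "\<And>y. y \<in> I \<Longrightarrow> y \<noteq> 0 \<Longrightarrow> nat (Nm (nr b)) \<le> nat (Nm (nr y))"
    using ex_has_least_nat[of "\<lambda>x. x \<in> I \<and> x \<noteq> 0" x0 "\<lambda>x. nat (Nm (nr x))"] by blast
  have "a \<in> lid b" if "a \<in> I" for a
  proof -
    obtain g where g: "Nm (nr (a - g * b)) < Nm (nr b)" using kq_division[OF b(2)] by blast
    have "a - g * b \<in> I" using add_closedD(2)[OF ac that m[OF b(1)]] .
    then have "a - g * b = 0" using b(3)[of "a - g * b"] g Nm_nr_nonneg[of "a - g * b"] by (auto simp: nat_le_eq_zle)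
    then show ?thesis by (auto simp: lid_def)
  qed
  moreover have "lid b \<subseteq> I" using m[OF b(1)] by (auto simp: lid_def)
  ultimately show thesis using that by blast
qed

section \<open>Reduction modulo a prime\<close>

definition qcong :: "zs \<Rightarrow> kq \<Rightarrow> kq \<Rightarrow> bool" where
  "qcong p x y \<longleftrightarrow> x - y \<in> lid (oK p)"

lemma pK_iff: "x \<in> lid (oK p) \<longleftrightarrow> (\<exists>y. x = oK p * y)"
  by (auto simp: lid_def oK_comm)

lemma pK_right: "x \<in> lid (oK p) \<Longrightarrow> x * k \<in> lid (oK p)"
  by (auto simp: pK_iff mult.assoc)

lemma qcong_refl [simp]: "qcong p x x"
  by (simp add: qcong_def add_closedD(1))

lemma qcong_sym: "qcong p x y \<Longrightarrow> qcong p y x"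
  unfolding qcong_def using add_closedD(3)[OF add_closed_ids(2)] by fastforce

lemma qcong_trans [trans]: "qcong p x y \<Longrightarrow> qcong p y z \<Longrightarrow> qcong p x z"
  unfolding qcong_def using add_closedD(4)[OF add_closed_ids(2), of "x - y" "oK p" "y - z"] by simp

lemma qcong_left: "qcong p x y \<Longrightarrow> qcong p (k * x) (k * y)"
  unfolding qcong_def using lid_mult[of "x - y" "oK p" k] by (simp add: right_diff_distrib)

lemma qcong_right: "qcong p x y \<Longrightarrow> qcong p (x * k) (y * k)"
  unfolding qcong_def using pK_right[of "x - y" p k] by (simp add: left_diff_distrib)

lemma coset_pK: "coset (lid (oK p)) x = coset (lid (oK p)) y \<longleftrightarrow> qcong p x y"
  by (simp add: coset_eq_iff qcong_def)

lemma qbar_pK [simp]: "qbar x \<in> lid (oK p) \<longleftrightarrow> x \<in> lid (oK p)"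
proof -
  have "qbar x \<in> lid (oK p)" if "x \<in> lid (oK p)" for x
    using that by (auto simp: pK_iff qbar_mult oK_comm)
  from this this[of "qbar x"] show ?thesis by auto
qed

lemma nr_add: "nr (x + y) = nr x + nr y + tr (x * qbar y)"
  by (simp add: nr_def tr_def kq_mult_simps algebra_simps r2_r2)

lemma nr_dvd_of_mult: "p dvd nr x \<Longrightarrow> qcong p y (k * x) \<Longrightarrow> p dvd nr y"
proof -
  assume x: "p dvd nr x" and "qcong p y (k * x)"
  then obtain z where "y = k * x + oK p * z" by (auto simp: qcong_def pK_iff algebra_simps)
  then show ?thesis using x
    by (simp add: nr_add nr_mult qbar_mult oK_comm)
qed

lemma zs_bezout:
  fixes p a :: zs assumes "prime_elem p" "\<not> p dvd a"
  obtains c where "p dvd c * a - 1"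
proof -
  have "gcd a p = 1" using prime_elem_imp_coprime[OF assms] by (simp add: coprime_iff_gcd_eq_1 gcd.commute)
  moreover obtain x y where "bezout_coefficients a p = (x, y)" by fastforce
  ultimately have "x * a + y * p = 1" using bezout_coefficients[of a p x y] by simp
  then have "x * a - 1 = p * (- y)" by (simp add: algebra_simps)
  then show thesis using that[of x] by simp
qed

lemma trace_one:
  assumes "prime_elem p" "x \<notin> lid (oK p)"
  obtains t where "p dvd tr (x * t) - 1"
proof -
  obtain y where "\<not> p dvd tr (x * y)" using trace_form_unimodular[of p x] assms(2) by (auto simp: pK_iff)
  from zs_bezout[OF assms(1) this] obtain c where "p dvd c * tr (x * y) - 1" .
  then show thesis using that[of "oK c * y"] by (simp add: oK_comm)
qed

text \<open>This comes from replacing \<open>x * t\<close> by its trace minus its conjugate. Modulo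
  a prime that divides \<open>nr x\<close> the last term disappears and \<open>x * t * x\<close>
  becomes a scalar multiple of \<open>x\<close>, as for a matrix of rank one.\<close>

lemma sandwich_identity: "x * t * x = oK (tr (x * t)) * x - oK (nr x) * qbar t"
proof -
  have "x * t = oK (tr (x * t)) - qbar t * qbar x"
    by (metis qbar_mult plus_qbar add_diff_cancel_right')
  then have "x * t * x = oK (tr (x * t)) * x - qbar t * (qbar x * x)"
    by (metis left_diff_distrib mult.assoc)
  then show ?thesis by (simp add: qbar_mult_self oK_comm)
qed

lemma unit_inverse:
  assumes "is_unit (nr a)" obtains b where "b * a = 1" "a * b = 1" "is_unit (nr b)"
proof -
  obtain c where "1 = nr a * c" using assms by (rule dvdE)
  then have c: "nr a * c = 1" by simp
  have "(oK c * qbar a) * a = oK (c * nr a)" "a * (oK c * qbar a) = oK (c * nr a)"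
    by (simp_all add: mult.assoc qbar_mult_self oK_comm(2) mult_qbar oK_mult)
  then have "(oK c * qbar a) * a = 1" "a * (oK c * qbar a) = 1" using c by (simp_all add: mult.commute)
  moreover from this(1) have "nr (oK c * qbar a) * nr a = 1" by (metis nr_mult nr_1)
  then have "is_unit (nr (oK c * qbar a))" by (metis dvd_triv_left)
  ultimately show thesis using that by blast
qed

lemma lid_eq_unit: assumes "is_unit (nr a)" shows "lid (a * x) = lid x"
proof -
  obtain b where "b * a = 1" using unit_inverse[OF assms] .
  then have "x = b * (a * x)" by (simp add: mult.assoc[symmetric])
  then have "x \<in> lid (a * x)" by (metis lid_mult lid_self)
  moreover have "a * x \<in> lid x" using lid_mult[OF lid_self] .
  ultimately show ?thesis by (simp add: lid_subset_iff subset_antisym)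
qed

lemma lid_eqI:
  assumes "x \<in> lid y" "nr y \<noteq> 0" "nr x dvd nr y" shows "lid x = lid y"
proof -
  obtain a where a: "x = a * y" using assms by (auto simp: lid_def)
  then have "nr a * nr y dvd 1 * nr y" using assms by (simp add: nr_mult)
  then have "is_unit (nr a)" using assms(2) by (subst (asm) dvd_times_right_cancel_iff) auto
  then show ?thesis using a lid_eq_unit by simp
qed

lemma nr_dvd_lid: "x \<in> lid y \<Longrightarrow> nr y dvd nr x"
  by (auto simp: lid_def nr_mult)

section \<open>Left ideals of given reduced norm\<close>

definition lids :: "zs \<Rightarrow> kq set set" where
  "lids n = {lid x | x. normalize (nr x) = normalize n}"

lemma lids_norm: assumes "lid x \<in> lids n" shows "normalize (nr x) = normalize n"
proof -
  obtain y where y: "lid x = lid y" "normalize (nr y) = normalize n" using assms by (auto simp: lids_def)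
  then have "x \<in> lid y" "y \<in> lid x" using lid_self[of x] lid_self[of y] by simp_all
  then have "normalize (nr x) = normalize (nr y)" using nr_dvd_lid by (auto intro: associatedI)
  then show ?thesis using y by simp
qed

text \<open>The left ideal \<open>K x + p K\<close> has a generator \<open>w\<close> with
  \<open>oK p = a * w\<close>, and \<open>p\<close> divides \<open>nr w\<close>. Writing
  \<open>nr w = p * c\<close> gives \<open>p = nr a * c\<close>. If \<open>nr a\<close> were a unit,
  \<open>x\<close> would lie in \<open>p K\<close>; so \<open>c\<close> is a unit and the ideal has
  norm \<open>p\<close>.\<close>

lemma pmult_ideal:
  assumes p: "prime_elem p" and x: "x \<notin> lid (oK p)" "p dvd nr x"
  shows "{y. \<exists>k. qcong p y (k * x)} \<in> lids p"
proof -
  let ?I = "{y. \<exists>k. qcong p y (k * x)}"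
  have "is_lideal ?I"
    unfolding is_lideal_def add_closed_def
  proof (intro conjI ballI allI)
    show "0 \<in> ?I" by (auto intro: exI[of _ 0])
    fix y assume "y \<in> ?I"
    then obtain k where k: "qcong p y (k * x)" by blast
    show "c * y \<in> ?I" for c using qcong_left[OF k, of c] by (auto simp: mult.assoc[symmetric])
    fix z assume "z \<in> ?I"
    then obtain l where l: "qcong p z (l * x)" by blast
    have "qcong p (y - z) ((k - l) * x)"
      using add_closedD(2)[OF add_closed_ids(2) k[unfolded qcong_def] l[unfolded qcong_def]]
      by (simp add: qcong_def algebra_simps)
    then show "y - z \<in> ?I" by blast
  qed
  then obtain w where w: "?I = lid w" using left_ideal_principal by blast
  have "oK p \<in> ?I" by (auto intro!: exI[of _ 0] simp: qcong_def)
  then obtain a where a: "oK p = a * w" unfolding w by (auto simp: lid_def)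
  have "w \<in> ?I" unfolding w by simp
  then have pw: "p dvd nr w" using nr_dvd_of_mult x by blast
  then obtain c where c: "nr w = p * c" by blast
  have "p * p = nr a * (p * c)" using arg_cong[OF a, of nr] by (simp add: nr_mult c)
  then have pe: "p = nr a * c" using p by (metis mult.left_commute mult_left_cancel prime_elem_not_zeroI)
  have "\<not> is_unit (nr a)"
  proof
    assume "is_unit (nr a)"
    then obtain b where "b * a = 1" using unit_inverse by blast
    then have "w = b * oK p" using a by (simp add: mult.assoc[symmetric])
    then have "lid w \<subseteq> lid (oK p)" using lid_mult[OF lid_self] by (simp add: lid_subset_iff)
    moreover have "x \<in> ?I" by (auto intro!: exI[of _ 1])
    ultimately show False using x w by auto
  qed
  then have "is_unit c" using pe p by (metis irreducibleD prime_elem_imp_irreducible)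
  then have "normalize (nr w) = normalize p" using c by simp
  then show ?thesis unfolding w lids_def by blast
qed

text \<open>An ideal of norm \<open>p\<close> contains \<open>p K\<close>, hence also
  \<open>K x + p K\<close>, and the two have the same norm. So an element outside \<open>p K\<close>
  lies in at most one left ideal of norm \<open>p\<close>.\<close>

lemma pmult_ideal_unique:
  assumes p: "prime_elem p" and x: "x \<notin> lid (oK p)" "I \<in> lids p" "x \<in> I"
  shows "I = {y. \<exists>k. qcong p y (k * x)}" "p dvd nr x"
proof -
  obtain w where w: "I = lid w" "normalize (nr w) = normalize p" using x by (auto simp: lids_def)
  show px: "p dvd nr x" using x nr_dvd_lid[of x w] w by (metis dvd_trans associatedD2)
  from pmult_ideal[OF p x(1) px] obtain w' where w': "{y. \<exists>k. qcong p y (k * x)} = lid w'"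
    "normalize (nr w') = normalize p" by (auto simp: lids_def)
  have "oK p \<in> lid w"
  proof -
    obtain c where "p = c * nr w" using w by (metis associatedD1 dvdE mult.commute)
    then have "oK p = oK c * qbar w * w" by (simp add: oK_mult mult.assoc qbar_mult_self)
    then show ?thesis using lid_mult[OF lid_self] by simp
  qed
  then have pI: "oK p * z \<in> I" for z using lid_mult[of "oK p" w z] by (simp add: w oK_comm)
  have "w' \<in> {y. \<exists>k. qcong p y (k * x)}" unfolding w' by simp
  then obtain k z where "w' = k * x + oK p * z" by (auto simp: qcong_def pK_iff algebra_simps)
  then have "w' \<in> lid w" using pI x lid_mult add_closedD(4)[OF add_closed_ids(2)] unfolding w by metis
  moreover have "nr w' dvd nr w" using w w' by (metis associatedD1)
  moreover have "nr w \<noteq> 0" using w p by auto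
  ultimately have "lid w' = lid w" using lid_eqI by blast
  then show "I = {y. \<exists>k. qcong p y (k * x)}" using w w' by simp
qed

section \<open>Right ideals of prime norm, through conjugation\<close>

definition rids :: "zs \<Rightarrow> kq set set" where
  "rids n = {rid x | x. normalize (nr x) = normalize n}"

lemma qbar_image_lids: "I \<in> lids n \<Longrightarrow> qbar ` I \<in> rids n" and qbar_image_rids: "I \<in> rids n \<Longrightarrow> qbar ` I \<in> lids n"
  unfolding lids_def rids_def using qbar_image_lid qbar_image_rid by (force)+

lemma qbar_qbar_image [simp]: "qbar ` qbar ` I = I"
  by (simp add: image_image)

lemma qbar_qcong: "qcong p (qbar x) y \<longleftrightarrow> qcong p x (qbar y)"
  unfolding qcong_def using qbar_pK[of "x - qbar y"] by simp

lemma qbar_image_pmult: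
  "qbar ` {y. \<exists>k. qcong p y (k * qbar x)} = {y. \<exists>k. qcong p y (x * k)}"
proof -
  have "y \<in> qbar ` {y. \<exists>k. qcong p y (k * qbar x)} \<longleftrightarrow> (\<exists>k. qcong p (qbar y) (k * qbar x))" for y
  proof
    assume "y \<in> qbar ` {y. \<exists>k. qcong p y (k * qbar x)}"
    then show "\<exists>k. qcong p (qbar y) (k * qbar x)" by auto
  next
    assume "\<exists>k. qcong p (qbar y) (k * qbar x)"
    then show "y \<in> qbar ` {y. \<exists>k. qcong p y (k * qbar x)}"
      by (intro image_eqI[of _ _ "qbar y"]) auto
  qed
  moreover have "(\<exists>k. qcong p (qbar y) (k * qbar x)) \<longleftrightarrow> (\<exists>k. qcong p y (x * k))" for y
  proof
    assume "\<exists>k. qcong p (qbar y) (k * qbar x)"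
    then obtain k where "qcong p y (x * qbar k)" by (auto simp: qbar_qcong qbar_mult)
    then show "\<exists>k. qcong p y (x * k)" by blast
  next
    assume "\<exists>k. qcong p y (x * k)"
    then obtain k where "qcong p (qbar y) (qbar k * qbar x)" by (auto simp: qbar_qcong qbar_mult)
    then show "\<exists>k. qcong p (qbar y) (k * qbar x)" by blast
  qed
  ultimately show ?thesis by blast
qed

lemma pmult_rideal:
  assumes p: "prime_elem p" and x: "x \<notin> lid (oK p)" "p dvd nr x"
  shows "{y. \<exists>k. qcong p y (x * k)} \<in> rids p"
  using qbar_image_lids[OF pmult_ideal[OF p, of "qbar x"]] x by (simp add: qbar_image_pmult)

lemma pmult_rideal_unique:
  assumes p: "prime_elem p" and x: "x \<notin> lid (oK p)" "I \<in> rids p" "x \<in> I"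
  shows "I = {y. \<exists>k. qcong p y (x * k)}" "p dvd nr x"
proof -
  have "qbar x \<in> qbar ` I" using x by blast
  note u = pmult_ideal_unique[OF p _ qbar_image_rids[OF x(2)] this]
  have "qbar ` qbar ` I = qbar ` {y. \<exists>k. qcong p y (k * qbar x)}" using u x by simp
  then show "I = {y. \<exists>k. qcong p y (x * k)}" unfolding qbar_image_pmult by simp
  show "p dvd nr x" using u x by simp
qed

text \<open>If \<open>tr (x * t)\<close> is 1 modulo \<open>p\<close>, then \<open>x\<close> agrees
  with \<open>x * t * x\<close>. Hence, modulo \<open>p\<close>,
  \<open>y = k x = k x t x = y t x = x (l t) x\<close>, which is a scalar multiple of
  \<open>x\<close>. So a left and a right ideal of norm \<open>p\<close> that share \<open>x\<close>
  meet in a line.\<close>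

lemma left_right_line:
  assumes p: "prime_elem p" and x: "x \<notin> lid (oK p)" "p dvd nr x"
    and y: "qcong p y (k * x)" "qcong p y (x * l)"
  shows "\<exists>c. qcong p y (oK c * x)"
proof -
  obtain t where t: "p dvd tr (x * t) - 1" using trace_one[OF p x(1)] .
  have xtx: "qcong p (x * u * x) (oK (tr (x * u)) * x)" for u
    using x(2) by (auto simp: qcong_def sandwich_identity pK_iff oK_mult mult.assoc elim!: dvdE
        intro: exI[of _ "- (oK _ * qbar u)"])
  have x1: "qcong p (x * t * x) x"
  proof -
    obtain e where e: "tr (x * t) = 1 + p * e" using t by (metis dvdE add.commute diff_add_cancel)
    have "oK (tr (x * t)) * x - x = oK p * (oK e * x)"
      by (simp add: e oK_mult distrib_right mult.assoc)
    then have "qcong p (oK (tr (x * t)) * x) x" unfolding qcong_def pK_iff by blast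
    then show ?thesis using xtx qcong_trans by blast
  qed
  have "qcong p y (k * (x * t * x))" using qcong_trans[OF y(1) qcong_left[OF qcong_sym[OF x1]]] .
  also have "k * (x * t * x) = (k * x) * (t * x)" by (simp add: mult.assoc)
  also have "qcong p \<dots> (y * (t * x))" using qcong_right[OF qcong_sym[OF y(1)]] .
  also have "qcong p \<dots> ((x * l) * (t * x))" using qcong_right[OF y(2)] .
  also have "(x * l) * (t * x) = x * (l * t) * x" by (simp add: mult.assoc)
  also have "qcong p \<dots> (oK (tr (x * (l * t))) * x)" by (rule xtx)
  finally show ?thesis by blast
qed

lemma pK_subset_lids: "I \<in> lids p \<Longrightarrow> lid (oK p) \<subseteq> I"
proof -
  assume "I \<in> lids p"
  then obtain w where w: "I = lid w" "normalize (nr w) = normalize p" by (auto simp: lids_def)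
  then obtain c where "p = c * nr w" by (metis associatedD1 dvdE mult.commute)
  then have "oK p = oK c * qbar w * w" by (simp add: oK_mult mult.assoc qbar_mult_self)
  then show ?thesis using lid_mult[OF lid_self] by (simp add: w lid_subset_iff)
qed

lemma pK_subset_rids: "I \<in> rids p \<Longrightarrow> lid (oK p) \<subseteq> I"
  using pK_subset_lids[OF qbar_image_rids] by (metis (no_types, lifting) image_eqI qbar_add(4) qbar_pK qbar_qbar_image subset_eq)

lemma line_cosets:
  assumes p: "prime_elem p" and x: "x \<notin> lid (oK p)"
  shows "card (coset (lid (oK p)) ` {y. \<exists>c. qcong p y (oK c * x)}) = nat \<bar>Nm p\<bar>"
proof -
  let ?C = "coset (lid (oK p))"
  have "?C ` {y. \<exists>c. qcong p y (oK c * x)} = range (\<lambda>c. ?C (oK c * x))"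
  proof (intro equalityI subsetI)
    fix z assume "z \<in> ?C ` {y. \<exists>c. qcong p y (oK c * x)}"
    then show "z \<in> range (\<lambda>c. ?C (oK c * x))" using coset_pK by blast
  next
    fix z assume "z \<in> range (\<lambda>c. ?C (oK c * x))"
    then show "z \<in> ?C ` {y. \<exists>c. qcong p y (oK c * x)}" using qcong_refl by blast
  qed
  moreover have "card (range (\<lambda>c. ?C (oK c * x))) = add_index UNIV (oid p)"
  proof (rule add_index_fun[symmetric])
    fix a b
    have e: "oK a * x - oK b * x = oK (a - b) * x" by (simp add: left_diff_distrib)
    have "qcong p (oK a * x) (oK b * x) \<longleftrightarrow> p dvd (a - b)"
    proof
      assume q: "qcong p (oK a * x) (oK b * x)"
      show "p dvd a - b"
        using x prime_elem_dvd_mult_iff[OF p] q unfolding qcong_def e pK_mem smul_sel by blast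
    next
      assume "p dvd a - b"
      then show "qcong p (oK a * x) (oK b * x)"
        unfolding qcong_def e pK_mem smul_sel by simp
    qed
    then show "?C (oK a * x) = ?C (oK b * x) \<longleftrightarrow> a - b \<in> oid p"
      by (simp add: coset_pK oid_mem)
  qed simp
  ultimately show ?thesis using oid_index[of p] p by auto
qed

lemma Nm_prime_gt_1: "prime_elem p \<Longrightarrow> \<bar>Nm p\<bar> > 1"
  using zs_is_unit_iff[of p] Nm_eq_0[of p] unfolding prime_elem_def by linarith

lemma Nm_prime_mult_less:
  assumes "prime_elem p" "k \<noteq> 0" shows "nat \<bar>Nm k\<bar> < nat \<bar>Nm (p * k)\<bar>"
proof -
  have "1 * \<bar>Nm k\<bar> < \<bar>Nm p\<bar> * \<bar>Nm k\<bar>"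
    using Nm_prime_gt_1[OF assms(1)] assms(2) by (intro mult_strict_right_mono) auto
  then show ?thesis by (simp add: Nm_mult abs_mult)
qed

lemma index_norm_prime:
  assumes p: "prime_elem p"
  shows "I \<in> lids p \<Longrightarrow> add_index I (lid (oK p)) = (nat \<bar>Nm p\<bar>)\<^sup>2"
    "I \<in> rids p \<Longrightarrow> add_index I (lid (oK p)) = (nat \<bar>Nm p\<bar>)\<^sup>2"
proof -
  let ?q = "nat \<bar>Nm p\<bar>"
  have q: "?q > 0" using Nm_prime_gt_1[OF p] by auto
  have N: "nat (Nm (nr w)) = ?q" if "normalize (nr w) = normalize p" for w
    using that Nm_nr_nonneg[of w] by (metis abs_Nm_normalize abs_of_nonneg)
  have *: "add_index I (lid (oK p)) = ?q\<^sup>2"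
    if "add_index UNIV I = ?q\<^sup>2" "add_closed I" "lid (oK p) \<subseteq> I" for I
  proof -
    have "p \<noteq> 0" using p by auto
    have "?q ^ 4 = add_index UNIV I * add_index I (lid (oK p))"
      unfolding pK_index[OF \<open>p \<noteq> 0\<close>, symmetric]
      by (rule add_index_tower[OF _ that(2) _ that(3)]) auto
    then have "?q\<^sup>2 * ?q\<^sup>2 = ?q\<^sup>2 * add_index I (lid (oK p))"
      unfolding that(1) by (simp only: power4_eq_xxxx power2_eq_square mult.assoc)
    moreover have "?q\<^sup>2 \<noteq> 0" using q by simp
    ultimately show ?thesis by (metis mult_left_cancel)
  qed
  show "add_index I (lid (oK p)) = ?q\<^sup>2" if I: "I \<in> lids p"
  proof -
    obtain w where w: "I = lid w" "normalize (nr w) = normalize p" using I by (auto simp: lids_def)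
    have "w \<noteq> 0" using w p by auto
    then show ?thesis using * w N pK_subset_lids[OF I] lid_index by simp
  qed
  show "add_index I (lid (oK p)) = ?q\<^sup>2" if I: "I \<in> rids p"
  proof -
    obtain w where w: "I = rid w" "normalize (nr w) = normalize p" using I by (auto simp: rids_def)
    have "w \<noteq> 0" using w p by auto
    then show ?thesis using * w N pK_subset_rids[OF I] rid_index by simp
  qed
qed

lemma finite_cosets_pK: "m \<noteq> 0 \<Longrightarrow> finite (range (coset (lid (oK m))))"
  using pK_index[of m] by (intro card_ge_0_finite) (simp add: add_index_coset)

text \<open>Otherwise \<open>T\<close> would be a left and a right ideal of norm \<open>p\<close> at once, hence contained in a
  line by \<open>left_right_line\<close>, whose index is too large.\<close>
lemma simple_mod_prime:
  assumes p: "prime_elem p" and T: "add_closed T" "\<And>k y. y \<in> T \<Longrightarrow> k * y \<in> T" "\<And>k y. y \<in> T \<Longrightarrow> y * k \<in> T"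
    and pT: "lid (oK p) \<subseteq> T" and x: "x \<in> T" "x \<notin> lid (oK p)"
  shows "1 \<in> T"
proof (rule ccontr)
  assume 1: "1 \<notin> T"
  \<comment> \<open>Otherwise \<open>qbar y * y\<close> would yield a scalar prime to
    \<open>p\<close> in \<open>T\<close>, and together with \<open>p K\<close> this produces
    1.\<close>
  have nrT: "p dvd nr y" if "y \<in> T" for y
  proof (rule ccontr)
    assume "\<not> p dvd nr y"
    then obtain c where c: "p dvd c * nr y - 1" using zs_bezout[OF p] by blast
    have "oK (c * nr y) \<in> T" using T(2)[OF that, of "oK c * qbar y"] by (simp add: oK_mult mult.assoc qbar_mult_self)
    moreover have "oK (c * nr y - 1) \<in> T" using pT c by (auto simp: pK_mem)
    ultimately have "oK (c * nr y) - oK (c * nr y - 1) \<in> T" using add_closedD(2)[OF T(1)] by blast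
    then show False using 1 by simp
  qed
  have sub: "y \<in> T" if "qcong p y z" "z \<in> T" for y z
    using add_closedD(4)[OF T(1), of "y - z" z] that pT by (auto simp: qcong_def)
  \<comment> \<open>An ideal of norm \<open>p\<close> is maximal among the left ideals whose
    elements all have norm divisible by \<open>p\<close>.\<close>
  have eq: "S \<in> lids p \<Longrightarrow> S \<subseteq> T' \<Longrightarrow> T' = S"
    if "is_lideal T'" and prT: "\<And>y. y \<in> T' \<Longrightarrow> p dvd nr y" for S T'
  proof -
    assume S: "S \<in> lids p" "S \<subseteq> T'"
    then obtain w where w: "S = lid w" "normalize (nr w) = normalize p" by (auto simp: lids_def)
    obtain v where v: "T' = lid v" using left_ideal_principal[OF \<open>is_lideal T'\<close>] by blast
    have "p dvd nr v" using prT[of v] v by simp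
    then have "nr w dvd nr v" using w by (metis associatedD1 dvd_trans)
    moreover have "w \<in> lid v" using S v w lid_self by blast
    moreover have "nr v \<noteq> 0" using nr_dvd_lid[OF \<open>w \<in> lid v\<close>] w p by auto
    ultimately show "T' = S" using lid_eqI v w by blast
  qed
  have l: "T = {y. \<exists>k. qcong p y (k * x)}"
  proof (rule eq)
    show "is_lideal T" using T by (simp add: is_lideal_def)
    show "{y. \<exists>k. qcong p y (k * x)} \<in> lids p" by (rule pmult_ideal[OF p x(2) nrT[OF x(1)]])
  qed (use sub T x nrT in auto)
  have "qbar ` T = {y. \<exists>k. qcong p y (k * qbar x)}"
  proof (rule eq)
    show "is_lideal (qbar ` T)"
      unfolding is_lideal_def add_closed_def
    proof (intro conjI ballI allI)
      show "0 \<in> qbar ` T" using add_closedD(1)[OF T(1)] by (metis image_eqI qbar_add(5))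
      fix y assume "y \<in> qbar ` T"
      then obtain a where a: "a \<in> T" "y = qbar a" by blast
      show "k * y \<in> qbar ` T" for k
        using T(3)[OF a(1), of "qbar k"] by (simp add: a(2)) (metis imageI qbar_mult qbar_add(4))
      fix z assume "z \<in> qbar ` T"
      then obtain b where b: "b \<in> T" "z = qbar b" by blast
      show "y - z \<in> qbar ` T" using add_closedD(2)[OF T(1) a(1) b(1)] a b by (metis imageI qbar_add(2))
    qed
    show "{y. \<exists>k. qcong p y (k * qbar x)} \<in> lids p"
      by (rule pmult_ideal[OF p]) (use x nrT in auto)
    show "{y. \<exists>k. qcong p y (k * qbar x)} \<subseteq> qbar ` T"
    proof
      fix y assume "y \<in> {y. \<exists>k. qcong p y (k * qbar x)}"
      then obtain k where "qcong p y (k * qbar x)" by blast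
      then have "qcong p (qbar y) (x * qbar k)" using qbar_qcong[of p "qbar y"] by (simp add: qbar_mult)
      then have "qbar y \<in> T" using sub T(3) x by blast
      then show "y \<in> qbar ` T" by (metis imageI qbar_add(4))
    qed
  qed (use nrT in auto)
  then have r: "T = {y. \<exists>k. qcong p y (x * k)}" using qbar_image_pmult by (metis qbar_qbar_image)
  have "T \<subseteq> {y. \<exists>c. qcong p y (oK c * x)}"
  proof
    fix y assume "y \<in> T"
    then obtain k l where "qcong p y (k * x)" "qcong p y (x * l)" using l r by blast
    then show "y \<in> {y. \<exists>c. qcong p y (oK c * x)}" using left_right_line[OF p x(2) nrT[OF x(1)]] by blast
  qed
  then have "T = {y. \<exists>c. qcong p y (oK c * x)}" using sub T(2) x by blast
  then have "add_index T (lid (oK p)) = nat \<bar>Nm p\<bar>"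
    using line_cosets[OF p x(2)] by (simp add: add_index_coset)
  moreover have "T \<in> lids p" unfolding l by (rule pmult_ideal[OF p x(2) nrT[OF x(1)]])
  ultimately have "(nat \<bar>Nm p\<bar>)\<^sup>2 = nat \<bar>Nm p\<bar>" using index_norm_prime(1)[OF p] by simp
  then show False using Nm_prime_gt_1[OF p] by (auto simp: power2_eq_square)
qed

text \<open>The elements \<open>z\<close> with \<open>z K y\<close> inside \<open>p K\<close> form a
  two-sided ideal containing \<open>p K\<close>. If some \<open>x\<close> outside \<open>p K\<close>
  belonged to it, simplicity would put 1 into it and therefore \<open>y\<close> into
  \<open>p K\<close>.\<close>

lemma prime_mod_prime:
  assumes p: "prime_elem p" and xy: "\<And>k. x * k * y \<in> lid (oK p)" and y: "y \<notin> lid (oK p)"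
  shows "x \<in> lid (oK p)"
proof (rule ccontr)
  assume x: "x \<notin> lid (oK p)"
  let ?T = "{z. \<forall>k. z * k * y \<in> lid (oK p)}"
  have "1 \<in> ?T"
  proof (rule simple_mod_prime[OF p, of ?T x])
    show "add_closed ?T"
      using add_closedD(1,2)[OF add_closed_ids(2)[of "oK p"]] unfolding add_closed_def
      by (simp add: left_diff_distrib)
    show "k * z \<in> ?T" if "z \<in> ?T" for k z using that lid_mult by (auto simp: mult.assoc)
    show "z * k \<in> ?T" if "z \<in> ?T" for k z
    proof -
      have "z * (k * l) * y \<in> lid (oK p)" for l using that by blast
      then show ?thesis by (simp add: mult.assoc)
    qed
    show "lid (oK p) \<subseteq> ?T" using pK_right by (auto simp: mult.assoc)
  qed (use xy x in auto)
  then have "1 * 1 * y \<in> lid (oK p)" by blast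
  then show False using y by simp
qed

text \<open>The residues \<open>a^2\<close> and \<open>-1 - b^2\<close> each fill more than half of
  the residue field, so some \<open>a^2 + b^2 + 1\<close> is divisible by \<open>p\<close>. The
  prime above 2 is treated by \<open>1 + u\<close>, whose norm is \<open>2 + sqrt 2\<close>.\<close>

lemma isotropic_exists:
  assumes p: "prime_elem p"
  obtains x where "x \<notin> lid (oK p)" "p dvd nr x"
proof (cases "p dvd r2")
  case True
  have "\<not> p dvd 1" using p by (simp add: prime_elem_def)
  moreover have "nr (KQ 1 1 0 0) = r2 * (r2 + 1)" by (simp add: nr_def algebra_simps r2_r2)
  ultimately show thesis using True that[of "KQ 1 1 0 0"] by (simp add: pK_mem)
next
  case False
  let ?C = "coset (oid p)" and ?q = "nat \<bar>Nm p\<bar>"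
  have C: "?C a = ?C b \<longleftrightarrow> p dvd a - b" for a b by (simp add: coset_eq_iff oid_mem)
  have cardX: "card (range ?C) = ?q" using oid_index[of p] p by (auto simp: add_index_coset)
  have finX: "finite (range ?C)" using cardX Nm_prime_gt_1[OF p] by (intro card_ge_0_finite) auto
  define f where "f a = ?C (a * a)" for a
  define g where "g b = ?C (- 1 - b * b)" for b
  have finf: "finite (range f)" by (rule finite_subset[OF _ finX]) (auto simp: f_def)
  have fing: "finite (range g)" by (rule finite_subset[OF _ finX]) (auto simp: g_def)
  have fib: "{?C a | a. f a = s} \<subseteq> {?C b, ?C (- b)}" if "f b = s" for b s
  proof
    fix z assume "z \<in> {?C a | a. f a = s}"
    then obtain a where a: "z = ?C a" "f a = s" by blast
    then have "?C (a * a) = ?C (b * b)" using that by (simp add: f_def)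
    then have "p dvd a * a - b * b" by (simp only: C)
    moreover have "a * a - b * b = (a - b) * (a - (- b))" by (simp add: algebra_simps)
    ultimately have "p dvd a - b \<or> p dvd a - (- b)" using p by (metis prime_elem_dvd_mult_iff)
    then show "z \<in> {?C b, ?C (- b)}" using a C by blast
  qed
  \<comment> \<open>Squaring is at most two-to-one, and one-to-one at 0. The residue saved there
    makes the set of squares larger than half of the field.\<close>
  have card_fib: "card {?C a | a. f a = s} \<le> (if s = f 0 then 1 else 2)" if "s \<in> range f" for s
  proof -
    obtain b where b: "f b = s" using \<open>s \<in> range f\<close> by blast
    show ?thesis
    proof (cases "s = f 0")
      case True
      then have "{?C a | a. f a = s} \<subseteq> {?C 0}" using fib[of 0 s] by simp
      then have "card {?C a | a. f a = s} \<le> card {?C 0}" by (rule card_mono[rotated]) simp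
      then show ?thesis using True by simp
    next
      case False
      have "card {?C a | a. f a = s} \<le> card {?C b, ?C (- b)}" using fib[OF b] by (rule card_mono[rotated]) simp
      also have "\<dots> \<le> 2" by (simp add: card_insert_if)
      finally show ?thesis using False by simp
    qed
  qed
  have "range ?C = (\<Union>s\<in>range f. {?C a | a. f a = s})" by blast
  then have "?q \<le> (\<Sum>s\<in>range f. card {?C a | a. f a = s})"
    using card_UN_le[OF finf, of "\<lambda>s. {?C a | a. f a = s}"] cardX by simp
  also have "\<dots> \<le> (\<Sum>s\<in>range f. if s = f 0 then 1 else 2)" by (rule sum_mono) (rule card_fib)
  also have "\<dots> = 1 + (\<Sum>s\<in>range f - {f 0}. 2)"
    by (subst sum.remove[OF finf, of "f 0"]) auto
  also have "\<dots> = 1 + 2 * (card (range f) - 1)" by (simp add: card_Diff_singleton)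
  finally have q: "?q \<le> 1 + 2 * (card (range f) - 1)" .
  have pos: "card (range f) > 0" using finf by (simp add: card_gt_0_iff)
  have "card (range g) = card (range f)"
    by (rule card_image_cong_kernel) (simp add: f_def g_def C dvd_diff_commute)
  moreover have "range f \<inter> range g \<noteq> {}"
  proof
    assume "range f \<inter> range g = {}"
    then have "card (range f \<union> range g) = card (range f) + card (range g)"
      using finf fing by (simp add: card_Un_disjoint)
    moreover have "card (range f \<union> range g) \<le> ?q"
      unfolding cardX[symmetric] by (rule card_mono[OF finX]) (auto simp: f_def g_def)
    ultimately show False using q pos \<open>card (range g) = card (range f)\<close> by linarith
  qed
  ultimately obtain a b where "f a = g b" by blast
  then have ab: "p dvd a * a + b * b + 1" by (simp add: f_def g_def C algebra_simps)
  \<comment> \<open>This element is \<open>a + b i + j\<close>. Its coefficient \<open>r2\<close> at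
    \<open>v\<close> is not divisible by \<open>p\<close>.\<close>
  have "nr (KQ (a - b - 1) (b * r2) r2 0) = a * a + b * b + 1"
    by (simp add: nr_def algebra_simps r2_r2)
  then show thesis using that[of "KQ (a - b - 1) (b * r2) r2 0"] ab False by (simp add: pK_mem)
qed

text \<open>Each left ideal of norm \<open>p\<close> meets a fixed right ideal \<open>R\<close> of norm \<open>p\<close> in one line modulo \<open>p\<close>,
  so the left ideals are counted by the lines of \<open>R / p K\<close>.\<close>
lemma card_lids_prime:
  assumes p: "prime_elem p"
  shows "card (lids p) = nat \<bar>Nm p\<bar> + 1"
proof -
  let ?C = "coset (lid (oK p))" and ?q = "nat \<bar>Nm p\<bar>"
  obtain x0 where x0: "x0 \<notin> lid (oK p)" "p dvd nr x0" using isotropic_exists[OF p] .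
  define R where "R = {y. \<exists>k. qcong p y (x0 * k)}"
  have R: "R \<in> rids p" unfolding R_def by (rule pmult_rideal[OF p x0])
  then obtain w where w: "R = rid w" "normalize (nr w) = normalize p" by (auto simp: rids_def)
  have pR: "lid (oK p) \<subseteq> R" by (rule pK_subset_rids[OF R])
  have acR: "add_closed R" using w by simp
  have p0: "p \<noteq> 0" using p by auto
  have q: "?q > 1" using Nm_prime_gt_1[OF p] by simp
  have C0: "?C y = ?C 0 \<longleftrightarrow> y \<in> lid (oK p)" for y by (simp add: coset_pK qcong_def)
  define W where "W = ?C ` (R - lid (oK p))"
  have W: "W = ?C ` R - {?C 0}" using C0 by (auto simp: W_def)
  have finR: "finite (?C ` R)" using finite_cosets_pK[OF p0] by (rule finite_subset[rotated]) auto
  have "card (?C ` R) = ?q\<^sup>2" using index_norm_prime(2)[OF p R] by (simp add: add_index_coset)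
  moreover have "?C 0 \<in> ?C ` R" using add_closedD(1)[OF acR] by blast
  ultimately have cardW: "card W = ?q\<^sup>2 - 1" using finR by (simp add: W card_Diff_singleton)
  have finW: "finite W" using finR by (simp add: W)
  define psi where "psi v = {z. \<exists>k. \<exists>y\<in>v. qcong p z (k * y)}" for v
  have psi: "psi (?C y) = {z. \<exists>k. qcong p z (k * y)}" for y
  proof -
    have "y \<in> ?C y" using add_closedD(1)[OF add_closed_ids(2)] by (force simp: coset_def)
    moreover have "qcong p y' y" if "y' \<in> ?C y" for y' using that by (auto simp: coset_def qcong_def)
    ultimately show ?thesis unfolding psi_def using qcong_trans qcong_left by blast
  qed
  have notp2: "v \<notin> lid (oK p)" if "normalize (nr v) = normalize p" for v
  proof
    assume "v \<in> lid (oK p)"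
    then obtain u where "v = oK p * u" by (auto simp: pK_iff)
    then have "p * p dvd nr v" by (simp add: nr_mult)
    then have "p * p dvd p * 1" using that by (metis associatedD1 dvd_trans mult_1_right)
    then have "p dvd 1" using p0 by (subst (asm) dvd_times_left_cancel_iff) auto
    then show False using p by (simp add: prime_elem_def)
  qed
  have nrR: "p dvd nr y" if "y \<in> R - lid (oK p)" for y
    using pmult_rideal_unique(2)[OF p _ R] that by blast
  have img: "psi ` W = lids p"
  proof (intro equalityI subsetI)
    fix I assume "I \<in> psi ` W"
    then show "I \<in> lids p" using pmult_ideal[OF p] nrR by (auto simp: W_def psi)
  next
    fix I assume I: "I \<in> lids p"
    then obtain v where v: "I = lid v" "normalize (nr v) = normalize p" by (auto simp: lids_def)
    \<comment> \<open>As \<open>K / p K\<close> is a prime ring, \<open>w K v\<close> is not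
      contained in \<open>p K\<close>, which gives \<open>R\<close> and \<open>I\<close> a common
      element outside \<open>p K\<close>.\<close>
    have "\<exists>k. w * k * v \<notin> lid (oK p)" using prime_mod_prime[OF p, of w v] notp2 w v by blast
    then obtain k where k: "w * k * v \<notin> lid (oK p)" by blast
    have "w * k * v \<in> I" using lid_mult[OF lid_self] v by blast
    then have "I = psi (?C (w * k * v))" using pmult_ideal_unique(1)[OF p k I] psi by simp
    moreover have "w * k * v \<in> R" using rid_mult[OF rid_self, of w "k * v"] w by (simp add: mult.assoc)
    ultimately show "I \<in> psi ` W" using k unfolding W_def by blast
  qed
  have fib: "card {v \<in> W. psi v = I} = ?q - 1" if I: "I \<in> lids p" for I
  proof -
    obtain y where y: "y \<in> R - lid (oK p)" "I = psi (?C y)" using I unfolding img[symmetric] W_def by blast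
    have "{v \<in> W. psi v = I} = ?C ` {z. \<exists>c. qcong p z (oK c * y)} - {?C 0}"
    proof (intro equalityI subsetI)
      fix v assume "v \<in> {v \<in> W. psi v = I}"
      then obtain z where z: "z \<in> R" "z \<notin> lid (oK p)" "v = ?C z" "psi (?C z) = I" by (auto simp: W_def)
      then have "z \<in> I" using qcong_refl[of p z] unfolding psi by (metis (mono_tags, lifting) mem_Collect_eq mult_1)
      then obtain k where k: "qcong p z (k * y)" using y psi by auto
      obtain l where l: "qcong p z (y * l)" using pmult_rideal_unique(1)[OF p _ R, of y] y z by blast
      obtain c where "qcong p z (oK c * y)" using left_right_line[OF p _ nrR[OF y(1)] k l] y by blast
      then show "v \<in> ?C ` {z. \<exists>c. qcong p z (oK c * y)} - {?C 0}" using z C0 by blast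
    next
      fix v assume "v \<in> ?C ` {z. \<exists>c. qcong p z (oK c * y)} - {?C 0}"
      then obtain z c where z: "v = ?C z" "qcong p z (oK c * y)" "z \<notin> lid (oK p)" using C0 by blast
      have "oK c * y \<in> R" using y rid_mult[of y w "oK c"] by (simp add: w oK_comm)
      then have zR: "z \<in> R" using add_closedD(4)[OF acR, of "z - oK c * y" "oK c * y"] z pR by (auto simp: qcong_def)
      have "z \<in> I" unfolding y psi using z by blast
      then have "I = psi (?C z)" using pmult_ideal_unique(1)[OF p z(3) I] psi by simp
      then show "v \<in> {v \<in> W. psi v = I}" using z zR by (auto simp: W_def)
    qed
    moreover have "?C 0 \<in> ?C ` {z. \<exists>c. qcong p z (oK c * y)}"
      by (rule imageI) (auto intro: exI[of _ 0])
    moreover have "card (?C ` {z. \<exists>c. qcong p z (oK c * y)}) = ?q" using line_cosets[OF p] y by blast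
    ultimately show ?thesis by (simp add: card_Diff_singleton)
  qed
  have "card W = (\<Sum>I\<in>psi ` W. \<Sum>v\<in>{v. v \<in> W \<and> psi v = I}. 1)"
    using sum.image_gen[OF finW, of "\<lambda>_. 1 :: nat" psi] by simp
  also have "\<dots> = (\<Sum>I\<in>lids p. ?q - 1)" unfolding img using fib by (intro sum.cong) auto
  finally have "?q\<^sup>2 - 1 = card (lids p) * (?q - 1)" using cardW by simp
  moreover have "?q\<^sup>2 - 1 = (?q + 1) * (?q - 1)" by (simp add: power2_eq_square algebra_simps)
  ultimately have "card (lids p) * (?q - 1) = (?q + 1) * (?q - 1)" by simp
  moreover have "?q - 1 \<noteq> 0" using q by simp
  ultimately show ?thesis using mult_cancel2[of "card (lids p)" "?q - 1" "?q + 1"] by metis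
qed

section \<open>Counting left ideals\<close>

lemma normalize_mult_cong:
  fixes a b c d :: zs
  assumes "normalize a = normalize c" "normalize b = normalize d"
  shows "normalize (a * b) = normalize (c * d)"
  using assms by (meson associatedD1 associatedD2 associatedI mult_dvd_mono)

lemma normalize_mult_cancel:
  fixes a b c d :: zs
  assumes "normalize (a * b) = normalize (c * d)" "normalize b = normalize d" "d \<noteq> 0"
  shows "normalize a = normalize c"
proof -
  have "normalize (a * d) = normalize (c * d)"
    using assms(1) normalize_mult_cong[of a a b d] assms(2) by simp
  then have "a * d dvd c * d" "c * d dvd a * d" using associatedD1 associatedD2 by blast+
  then have "a dvd c" "c dvd a" using assms(3) by simp_all
  then show ?thesis by (rule associatedI)
qed

text \<open>An ideal in \<open>lids n\<close> contains \<open>n K\<close>, so it is determined by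
  its image in the finite quotient \<open>K / n K\<close>.\<close>

lemma finite_lids: assumes "n \<noteq> 0" shows "finite (lids n)"
proof -
  let ?C = "coset (lid (oK n))"
  have "inj_on (\<lambda>I. ?C ` I) (lids n)"
  proof (rule inj_onI)
    have *: "I \<subseteq> J" if IJ: "?C ` I \<subseteq> ?C ` J" "J \<in> lids n" for I J
    proof
      fix x assume "x \<in> I"
      then obtain y where y: "y \<in> J" "?C x = ?C y" using IJ by blast
      then have "x - y \<in> lid (oK n)" by (simp add: coset_pK qcong_def)
      then have "x - y \<in> J" using pK_subset_lids[OF IJ(2)] by blast
      moreover have "add_closed J" using IJ(2) by (auto simp: lids_def)
      ultimately show "x \<in> J" using add_closedD(4)[of J "x - y" y] y by simp
    qed
    fix I J assume "I \<in> lids n" "J \<in> lids n" "?C ` I = ?C ` J"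
    then show "I = J" using *[of I J] *[of J I] by simp
  qed
  moreover have "(\<lambda>I. ?C ` I) ` lids n \<subseteq> Pow (range ?C)" by blast
  ultimately show ?thesis using finite_cosets_pK[OF assms] by (metis finite_Pow_iff inj_on_finite)
qed

text \<open>Right multiplication by a generator of \<open>J\<close> identifies \<open>K\<close> with
  \<open>J\<close> and \<open>lids p\<close> with these ideals.\<close>

lemma card_sublids:
  assumes "n \<noteq> 0" "J \<in> lids n"
  shows "card {I \<in> lids (p * n). I \<subseteq> J} = card (lids p)"
proof -
  obtain y where y: "J = lid y" "normalize (nr y) = normalize n" using assms(2) by (auto simp: lids_def)
  have y0: "y \<noteq> 0" using y assms(1) by auto
  have im: "(\<lambda>k. k * y) ` lid a = lid (a * y)" for a by (simp add: lid_def image_image mult.assoc)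
  have "{I \<in> lids (p * n). I \<subseteq> J} = (\<lambda>I. (\<lambda>k. k * y) ` I) ` lids p"
  proof (intro equalityI subsetI)
    fix I assume "I \<in> {I \<in> lids (p * n). I \<subseteq> J}"
    then obtain x where x: "I = lid x" "normalize (nr x) = normalize (p * n)" "x \<in> lid y"
      by (auto simp: lids_def y lid_subset_iff)
    then obtain a where a: "x = a * y" by (auto simp: lid_def)
    then have "normalize (nr a) = normalize p" using normalize_mult_cancel[of "nr a" "nr y" p n] x y assms by (simp add: nr_mult)
    then have "lid a \<in> lids p" by (auto simp: lids_def)
    then show "I \<in> (\<lambda>I. (\<lambda>k. k * y) ` I) ` lids p" using im[of a] a x by blast
  next
    fix I assume "I \<in> (\<lambda>I. (\<lambda>k. k * y) ` I) ` lids p"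
    then obtain a where a: "normalize (nr a) = normalize p" "I = (\<lambda>k. k * y) ` lid a" unfolding lids_def by blast
    note a = a(1) a(2)[unfolded im]
    then have "normalize (nr (a * y)) = normalize (p * n)" using normalize_mult_cong[OF a(1) y(2)] by (simp add: nr_mult)
    then show "I \<in> {I \<in> lids (p * n). I \<subseteq> J}" using a y lid_mult[OF lid_self] by (auto simp: lids_def lid_subset_iff)
  qed
  moreover have "inj_on (\<lambda>I. (\<lambda>k. k * y) ` I) (lids p)"
    by (intro inj_onI) (use y0 in \<open>simp add: inj_image_eq_iff inj_def\<close>)
  ultimately show ?thesis by (simp add: card_image)
qed

text \<open>A left ideal above \<open>lid x\<close> is \<open>lid y\<close> with \<open>x = a * y\<close>; multiplied by \<open>p\<close> it becomes
  \<open>lid (qbar a) * x\<close>.\<close>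
lemma card_superlids:
  assumes p: "p \<noteq> 0" and n: "n \<noteq> 0" and x: "normalize (nr x) = normalize (p * n)"
  shows "card {J \<in> lids n. lid x \<subseteq> J} = card {I \<in> lids p. \<forall>r\<in>I. r * x \<in> lid (oK p)}"
proof -
  have x0: "x \<noteq> 0" using assms by auto
  let ?f = "\<lambda>J. (\<lambda>z. oK p * z) ` J" and ?g = "\<lambda>I. (\<lambda>k. k * x) ` I"
  have im: "?g (lid a) = lid (a * x)" for a by (simp add: lid_def image_image mult.assoc)
  have im': "?f (lid a) = lid (oK p * a)" for a by (simp add: lid_def image_image oK_comm(2))
  have eq: "?f ` {J \<in> lids n. lid x \<subseteq> J} = ?g ` {I \<in> lids p. \<forall>r\<in>I. r * x \<in> lid (oK p)}"
  proof (intro equalityI subsetI)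
    fix S assume "S \<in> ?f ` {J \<in> lids n. lid x \<subseteq> J}"
    then obtain y where y: "S = lid (oK p * y)" "normalize (nr y) = normalize n" "x \<in> lid y"
      by (auto simp: lids_def lid_subset_iff im')
    then obtain a where a: "x = a * y" by (auto simp: lid_def)
    have na: "normalize (nr a) = normalize p"
      using normalize_mult_cancel[of "nr a" "nr y" p n] x y a n by (simp add: nr_mult)
    then obtain u where u: "is_unit u" "nr a = u * p" by (rule associatedE1)
    have ax: "qbar a * x = oK u * (oK p * y)"
      by (simp add: a mult.assoc[symmetric] qbar_mult_self u oK_mult)
    have "is_unit (nr (oK u))" using u(1) by (simp add: mult_unit_dvd_iff)
    then have "lid (qbar a * x) = S" unfolding ax y by (rule lid_eq_unit)
    then have S: "S = ?g (lid (qbar a))" by (simp add: im)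
    have "r * x \<in> lid (oK p)" if r: "r \<in> lid (qbar a)" for r
    proof -
      obtain k where k: "r = k * qbar a" using r by (auto simp: lid_def)
      have "oK u * (oK p * y) = oK p * (oK u * y)" by (metis oK_mult mult.assoc mult.commute)
      then have "r * x = k * (oK p * (oK u * y))" by (simp add: k mult.assoc ax)
      then have "r * x = oK p * (k * (oK u * y))" by (simp only: oK_comm(2)[of k])
      then show ?thesis by (auto simp: pK_iff)
    qed
    moreover have "lid (qbar a) \<in> lids p" using na by (auto simp: lids_def intro!: exI[of _ "qbar a"])
    ultimately show "S \<in> ?g ` {I \<in> lids p. \<forall>r\<in>I. r * x \<in> lid (oK p)}" using S by blast
  next
    fix S assume "S \<in> ?g ` {I \<in> lids p. \<forall>r\<in>I. r * x \<in> lid (oK p)}"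
    then obtain r where r: "S = lid (r * x)" "normalize (nr r) = normalize p" "r * x \<in> lid (oK p)"
      using lid_self by (auto simp: lids_def im)
    then obtain y where y: "r * x = oK p * y" by (auto simp: pK_iff)
    have S: "S = ?f (lid y)" using r y by (simp add: im')
    obtain u where u: "is_unit u" "nr r = u * p" using r(2) by (rule associatedE1)
    have "nr r * nr x = p * p * nr y" using arg_cong[OF y, of nr] by (simp add: nr_mult)
    then have "p * (u * nr x) = p * (p * nr y)" using u by (simp add: mult_ac)
    then have "u * nr x = p * nr y" using p by simp
    then have "normalize (nr y * p) = normalize (n * p)" using x u(1)
      by (metis mult.commute normalize_mult_unit_left)
    then have ny: "normalize (nr y) = normalize n" using normalize_mult_cancel p by blast
    have "oK p * (oK u * x) = oK p * (qbar r * y)"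
    proof -
      have "oK p * (oK u * x) = oK (nr r) * x" by (simp add: u mult.commute[of u p] oK_mult mult.assoc)
      also have "\<dots> = qbar r * (r * x)" by (simp add: qbar_mult_self mult.assoc[symmetric])
      also have "\<dots> = oK p * (qbar r * y)" by (simp add: y oK_comm(2))
      finally show ?thesis .
    qed
    then have e: "oK u * x = qbar r * y" using p by simp
    have "x \<in> lid (oK u * x)" using lid_eq_unit[of "oK u" x] u(1) by (simp add: mult_unit_dvd_iff)
    then have "x \<in> lid y" using e lid_mult[OF lid_self, of "qbar r" y] lid_subset_iff by auto
    then have "lid y \<in> {J \<in> lids n. lid x \<subseteq> J}" using ny by (auto simp: lids_def lid_subset_iff)
    then show "S \<in> ?f ` {J \<in> lids n. lid x \<subseteq> J}" using S by blast
  qed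
  have i: "inj (\<lambda>z. oK p * z)" "inj (\<lambda>k. k * x)" using p x0 by (auto simp: inj_def)
  have f: "inj_on ?f A" for A by (rule inj_onI) (simp only: inj_image_eq_iff[OF i(1)])
  have g: "inj_on ?g B" for B by (rule inj_onI) (simp only: inj_image_eq_iff[OF i(2)])
  have "card {J \<in> lids n. lid x \<subseteq> J} = card (?f ` {J \<in> lids n. lid x \<subseteq> J})"
    by (rule card_image[OF f, symmetric])
  also have "\<dots> = card (?g ` {I \<in> lids p. \<forall>r\<in>I. r * x \<in> lid (oK p)})" by (rule arg_cong[OF eq])
  also have "\<dots> = card {I \<in> lids p. \<forall>r\<in>I. r * x \<in> lid (oK p)}" by (rule card_image[OF g])
  finally show ?thesis .
qed

text \<open>Outside \<open>p K\<close> the element \<open>x\<close> acts like a matrix of rank one,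
  and its left annihilator is the single ideal \<open>K qbar x + p K\<close>: if
  \<open>r * x\<close> is in \<open>p K\<close> and \<open>nr r\<close> is associated to
  \<open>p\<close>, then \<open>qbar x\<close> is a left multiple of \<open>r\<close>.\<close>

lemma card_annihilators:
  assumes p: "prime_elem p" and x: "p dvd nr x"
  shows "card {I \<in> lids p. \<forall>r\<in>I. r * x \<in> lid (oK p)}
    = (if x \<in> lid (oK p) then nat \<bar>Nm p\<bar> + 1 else 1)"
proof (cases "x \<in> lid (oK p)")
  case True
  then have "{I \<in> lids p. \<forall>r\<in>I. r * x \<in> lid (oK p)} = lids p" using lid_mult by blast
  then show ?thesis using True card_lids_prime[OF p] by simp
next
  case False
  have p0: "p \<noteq> 0" using p by auto
  let ?J = "{y. \<exists>k. qcong p y (k * qbar x)}"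
  have J: "?J \<in> lids p" by (rule pmult_ideal[OF p]) (use False x in auto)
  have "{I \<in> lids p. \<forall>r\<in>I. r * x \<in> lid (oK p)} = {?J}"
  proof (intro equalityI subsetI)
    fix I assume "I \<in> {I \<in> lids p. \<forall>r\<in>I. r * x \<in> lid (oK p)}"
    then have I: "I \<in> lids p" "\<forall>r\<in>I. r * x \<in> lid (oK p)" by auto
    then obtain r where r: "I = lid r" "normalize (nr r) = normalize p" by (auto simp: lids_def)
    then have "r * x \<in> lid (oK p)" using I lid_self[of r] by blast
    then obtain y where y: "r * x = oK p * y" by (auto simp: pK_iff)
    obtain u where u: "is_unit u" "nr r = u * p" using r(2) by (rule associatedE1)
    obtain c where c: "u * c = 1" using u(1) by (metis dvdE)
    have "oK p * (oK u * x) = oK (nr r) * x" by (simp add: u mult.commute[of u p] oK_mult mult.assoc)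
    also have "\<dots> = qbar r * (r * x)" by (simp add: qbar_mult_self mult.assoc[symmetric])
    also have "\<dots> = oK p * (qbar r * y)" by (simp add: y oK_comm(2))
    finally have "oK u * x = qbar r * y" using p0 by simp
    then have "oK (c * u) * x = oK c * (qbar r * y)" by (simp only: oK_mult mult.assoc)
    then have "x = oK c * (qbar r * y)" using c by (simp only: mult.commute[of c u] oK_hom mult_1)
    then have "qbar x = oK c * (qbar y * r)" by (simp add: qbar_mult oK_comm)
    then have "qbar x \<in> I" using r lid_mult[OF lid_self] by (metis mult.assoc)
    then have "I = ?J" using pmult_ideal_unique(1)[OF p _ I(1), of "qbar x"] False by simp
    then show "I \<in> {?J}" by simp
  next
    fix I assume "I \<in> {?J}"
    then have I: "I = ?J" by simp
    have "r * x \<in> lid (oK p)" if r: "r \<in> ?J" for r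
    proof -
      obtain k where "qcong p r (k * qbar x)" using r by blast
      then have "qcong p (r * x) (k * qbar x * x)" by (rule qcong_right)
      moreover have "k * qbar x * x = oK (nr x) * k" by (simp add: mult.assoc qbar_mult_self oK_comm)
      moreover have "oK (nr x) * k \<in> lid (oK p)" using x by (auto simp: pK_mem)
      ultimately show ?thesis unfolding qcong_def using add_closedD(4)[OF add_closed_ids(2)] by fastforce
    qed
    then show "I \<in> {I \<in> lids p. \<forall>r\<in>I. r * x \<in> lid (oK p)}" using J I by blast
  qed
  then show ?thesis using False by simp
qed

text \<open>Each \<open>J\<close> lies above \<open>N p + 1\<close> ideals \<open>I\<close>. Each
  \<open>I\<close> lies below one \<open>J\<close>, or below \<open>N p + 1\<close> of them if it is
  contained in \<open>p K\<close>; this surplus is the second term, as in the relation for Hecke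
  operators.\<close>

lemma hecke_recursion:
  assumes p: "prime_elem p" and n: "n \<noteq> 0"
  shows "card (lids (p * n)) + nat \<bar>Nm p\<bar> * card {I \<in> lids (p * n). I \<subseteq> lid (oK p)}
    = (nat \<bar>Nm p\<bar> + 1) * card (lids n)"
proof -
  let ?q = "nat \<bar>Nm p\<bar>" and ?B = "{I \<in> lids (p * n). I \<subseteq> lid (oK p)}"
  have p0: "p \<noteq> 0" using p by auto
  have fin: "finite (lids (p * n))" "finite (lids n)" using finite_lids p0 n by auto
  have "(\<Sum>J\<in>lids n. \<Sum>I | I \<in> lids (p * n) \<and> I \<subseteq> J. 1)
     = (\<Sum>I\<in>lids (p * n). \<Sum>J | J \<in> lids n \<and> I \<subseteq> J. 1 :: nat)"
    by (rule sum.swap_restrict[OF fin(2,1)])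
  moreover have "(\<Sum>J\<in>lids n. \<Sum>I | I \<in> lids (p * n) \<and> I \<subseteq> J. 1) = (\<Sum>J\<in>lids n. ?q + 1)"
    using card_sublids[OF n] card_lids_prime[OF p] by (intro sum.cong) auto
  moreover have "(\<Sum>I\<in>lids (p * n). \<Sum>J | J \<in> lids n \<and> I \<subseteq> J. 1)
      = (\<Sum>I\<in>lids (p * n). 1 + (if I \<subseteq> lid (oK p) then ?q else 0))"
  proof (rule sum.cong)
    fix I assume "I \<in> lids (p * n)"
    then obtain x where x: "I = lid x" "normalize (nr x) = normalize (p * n)" by (auto simp: lids_def)
    have "p dvd nr x" using x(2) by (metis associatedD2 dvd_trans dvd_triv_left)
    then show "(\<Sum>J | J \<in> lids n \<and> I \<subseteq> J. 1) = 1 + (if I \<subseteq> lid (oK p) then ?q else 0)"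
      using card_superlids[OF p0 n x(2)] card_annihilators[OF p, of x] x(1) by (simp add: lid_subset_iff)
  qed simp
  moreover have "(\<Sum>I\<in>lids (p * n). 1 + (if I \<subseteq> lid (oK p) then ?q else 0)) = card (lids (p * n)) + ?q * card ?B"
    using fin by (simp only: sum.distrib) (simp add: sum.If_cases Int_def)
  ultimately have "(\<Sum>J\<in>lids n. ?q + 1) = card (lids (p * n)) + ?q * card ?B" by (simp only:)
  then show ?thesis by (simp add: mult.commute)
qed

text \<open>An ideal inside \<open>p K\<close> is \<open>p\<close> times an ideal whose norm is
  smaller by the factor \<open>p^2\<close>; this turns \<open>p * n\<close> into
  \<open>n div p\<close>.\<close>

lemma card_imprimitive_lids:
  assumes p: "prime_elem p" and n: "n \<noteq> 0"
  shows "card {I \<in> lids (p * n). I \<subseteq> lid (oK p)} = (if p dvd n then card (lids (n div p)) else 0)"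
proof -
  have p0: "p \<noteq> 0" using p by auto
  have *: "normalize (p * nr y) = normalize n" if "normalize (nr (oK p * y)) = normalize (p * n)" for y
    using normalize_mult_cancel[of "p * nr y" p n p] that p0 by (simp add: nr_mult mult_ac)
  show ?thesis
  proof (cases "p dvd n")
    case False
    have "{I \<in> lids (p * n). I \<subseteq> lid (oK p)} = {}"
    proof (intro equalityI subsetI)
      fix I assume "I \<in> {I \<in> lids (p * n). I \<subseteq> lid (oK p)}"
      then obtain x where x: "normalize (nr x) = normalize (p * n)" "x \<in> lid (oK p)"
        by (auto simp: lids_def lid_subset_iff)
      then obtain y where "x = oK p * y" by (auto simp: pK_iff)
      then have "normalize (p * nr y) = normalize n" using * x by simp
      then have "p dvd n" by (metis associatedD1 dvd_trans dvd_triv_left)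
      then show "I \<in> {}" using False by simp
    qed simp
    then show ?thesis using False by (simp only: if_False card.empty)
  next
    case True
    then obtain m where m: "n = p * m" by (rule dvdE)
    have im': "(\<lambda>z. oK p * z) ` lid a = lid (oK p * a)" for a
      by (simp add: lid_def image_image oK_comm(2))
    have "{I \<in> lids (p * n). I \<subseteq> lid (oK p)} = (\<lambda>I. (\<lambda>z. oK p * z) ` I) ` lids m"
    proof (intro equalityI subsetI)
      fix I assume "I \<in> {I \<in> lids (p * n). I \<subseteq> lid (oK p)}"
      then obtain x where x: "I = lid x" "normalize (nr x) = normalize (p * n)" "x \<in> lid (oK p)"
        by (auto simp: lids_def lid_subset_iff)
      then obtain y where y: "x = oK p * y" by (auto simp: pK_iff)
      then have "normalize (p * nr y) = normalize n" using * x by simp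
      then have "normalize (nr y) = normalize m"
        using normalize_mult_cancel[of "nr y" p m p] p0 by (simp add: m mult.commute)
      then have "lid y \<in> lids m" by (auto simp: lids_def)
      then show "I \<in> (\<lambda>I. (\<lambda>z. oK p * z) ` I) ` lids m" using x y im' by blast
    next
      fix I assume "I \<in> (\<lambda>I. (\<lambda>z. oK p * z) ` I) ` lids m"
      then obtain y where y: "I = lid (oK p * y)" "normalize (nr y) = normalize m" by (auto simp: lids_def im')
      have "normalize (nr (oK p * y)) = normalize (p * n)"
        using normalize_mult_cong[of "p * p" "p * p" "nr y" m] y by (simp add: nr_mult m mult.assoc)
      then show "I \<in> {I \<in> lids (p * n). I \<subseteq> lid (oK p)}"
        using y by (auto simp: lids_def lid_subset_iff pK_iff)
    qed
    moreover have "inj_on (\<lambda>I. (\<lambda>z. oK p * z) ` I) (lids m)"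
      by (intro inj_onI) (use p0 in \<open>simp add: inj_image_eq_iff inj_def\<close>)
    ultimately show ?thesis using True m p0 by (simp add: card_image)
  qed
qed

section \<open>Divisor sums in Z[sqrt 2]\<close>

definition divs :: "zs \<Rightarrow> zs set" where "divs n = {d. d dvd n \<and> normalize d = d}"

definition sigma :: "zs \<Rightarrow> nat" where "sigma n = (\<Sum>d\<in>divs n. nat \<bar>Nm d\<bar>)"

lemma zs_cong_residues:
  assumes "rat_part d mod m = rat_part d' mod m" "irr_part d mod m = irr_part d' mod m"
  shows "of_int m dvd d - d'"
proof -
  have "m dvd rat_part (d - d')" "m dvd irr_part (d - d')" using assms by (simp_all add: mod_eq_dvd_iff)
  then obtain a b where "rat_part (d - d') = m * a" "irr_part (d - d') = m * b" by (auto elim!: dvdE)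
  then have "d - d' = of_int m * ZS a b" by (simp add: zs_eq_iff)
  then show ?thesis by simp
qed

text \<open>A divisor \<open>d\<close> of \<open>m\<close> is \<open>gcd d m\<close>, and this depends only on \<open>d\<close> modulo \<open>m\<close>.\<close>
lemma inj_residues:
  "inj_on (\<lambda>d. (rat_part d mod m, irr_part d mod m)) (divs (of_int m))"
proof (rule inj_onI)
  fix d d' assume d: "d \<in> divs (of_int m)" "d' \<in> divs (of_int m)"
    "(rat_part d mod m, irr_part d mod m) = (rat_part d' mod m, irr_part d' mod m)"
  then have "of_int m dvd d - d'" by (intro zs_cong_residues) auto
  moreover have "of_int m dvd d' - d" using d by (intro zs_cong_residues) auto
  moreover have "d dvd of_int m" "d' dvd of_int m" using d by (auto simp: divs_def)
  ultimately have "d dvd d - d'" "d' dvd d' - d" using dvd_trans by blast+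
  then have "d dvd d'" "d' dvd d" by (metis dvd_diff_right_iff dvd_refl)+
  then show "d = d'" using d by (metis (mono_tags, lifting) associatedI divs_def mem_Collect_eq)
qed

lemma finite_divs: assumes "n \<noteq> 0" shows "finite (divs n)"
proof -
  let ?m = "\<bar>Nm n\<bar>"
  have "n dvd of_int ?m" using dvd_of_int_Nm[of n] by (cases "Nm n \<ge> 0") auto
  then have sub: "divs n \<subseteq> divs (of_int ?m)" using dvd_trans by (auto simp: divs_def)
  have m: "?m > 0" using assms by simp
  have "(\<lambda>d. (rat_part d mod ?m, irr_part d mod ?m)) ` divs n \<subseteq> {0..<?m} \<times> {0..<?m}"
    using m by auto
  then show ?thesis by (rule inj_on_finite[OF inj_on_subset[OF inj_residues sub]]) simp
qed

text \<open>The divisors of \<open>p * n\<close> that \<open>p\<close> divides contribute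
  \<open>N p * sigma n\<close>. The others are the divisors of \<open>n\<close> not divisible by
  \<open>p\<close>; they contribute \<open>sigma n\<close> less the share of those divisible by
  \<open>p\<close>, which is \<open>N p * sigma (n div p)\<close> or 0.\<close>

lemma sigma_recursion:
  assumes p: "prime_elem p" and n: "n \<noteq> 0"
  shows "sigma (p * n) + nat \<bar>Nm p\<bar> * (if p dvd n then sigma (n div p) else 0)
    = (nat \<bar>Nm p\<bar> + 1) * sigma n"
proof -
  let ?N = "\<lambda>d. nat \<bar>Nm d\<bar>" and ?q = "nat \<bar>Nm p\<bar>"
  have p0: "p \<noteq> 0" using p by auto
  have mult: "(\<Sum>d | d \<in> divs (p * m) \<and> p dvd d. ?N d) = ?q * sigma m" if m: "m \<noteq> 0" for m
  proof -
    have "sum ?N {d \<in> divs (p * m). p dvd d} = sum (\<lambda>d. ?N (normalize (p * d))) (divs m)"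
    proof (rule sum.reindex_cong[of "\<lambda>d. normalize (p * d)"])
      show "inj_on (\<lambda>d. normalize (p * d)) (divs m)"
      proof (rule inj_onI)
        fix d d' assume d: "d \<in> divs m" "d' \<in> divs m" "normalize (p * d) = normalize (p * d')"
        then have "normalize d = normalize d'" using normalize_mult_cancel[of d p d' p] p0 by (simp add: mult.commute)
        then show "d = d'" using d by (simp add: divs_def)
      qed
      show "{d \<in> divs (p * m). p dvd d} = (\<lambda>d. normalize (p * d)) ` divs m"
      proof (intro equalityI subsetI)
        fix d assume "d \<in> {d \<in> divs (p * m). p dvd d}"
        then have d: "p dvd d" "d dvd p * m" "normalize d = d" by (auto simp: divs_def)
        from d(1) obtain e where "d = p * e" by (rule dvdE)
        with d have e: "d = p * e" "d dvd p * m" "normalize d = d" by auto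
        then have "normalize e \<in> divs m" using p0 by (simp add: divs_def)
        moreover have "d = normalize (p * normalize e)" using e normalize_mult_cong[of p p "normalize e" e] by simp
        ultimately show "d \<in> (\<lambda>d. normalize (p * d)) ` divs m" by blast
      qed (auto simp: divs_def)
    qed simp
    also have "\<dots> = ?q * sigma m" by (simp add: sigma_def sum_distrib_left Nm_mult abs_mult nat_mult_distrib)
    finally show ?thesis .
  qed
  have split: "sigma m = (\<Sum>d | d \<in> divs m \<and> p dvd d. ?N d) + (\<Sum>d | d \<in> divs m \<and> \<not> p dvd d. ?N d)" if "m \<noteq> 0" for m
  proof -
    have "divs m = {d \<in> divs m. p dvd d} \<union> {d \<in> divs m. \<not> p dvd d}" by blast
    then show ?thesis unfolding sigma_def using finite_divs[OF that]
      by (subst (1) \<open>divs m = _\<close>) (rule sum.union_disjoint, auto)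
  qed
  have cop: "{d \<in> divs (p * n). \<not> p dvd d} = {d \<in> divs n. \<not> p dvd d}"
  proof -
    have "d dvd n" if "d dvd p * n" "\<not> p dvd d" for d
      using that prime_elem_imp_coprime[OF p that(2)] by (metis coprime_commute coprime_dvd_mult_right_iff)
    then show ?thesis by (auto simp: divs_def)
  qed
  have pn: "(\<Sum>d | d \<in> divs n \<and> p dvd d. ?N d) = ?q * (if p dvd n then sigma (n div p) else 0)"
  proof (cases "p dvd n")
    case True
    then obtain m where "n = p * m" by (rule dvdE)
    then show ?thesis using mult[of m] n p0 by simp
  next
    case False
    then have "{d. d \<in> divs n \<and> p dvd d} = {}" by (auto simp: divs_def dest: dvd_trans)
    then show ?thesis using False by (simp only: sum.empty if_False mult_0_right)
  qed
  show ?thesis using split[of "p * n"] split[OF n] mult[OF n] pn p0 n by (simp add: cop)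
qed

theorem card_lids: "n \<noteq> 0 \<Longrightarrow> card (lids n) = sigma n"
proof (induction "nat \<bar>Nm n\<bar>" arbitrary: n rule: less_induct)
  case less
  show ?case
  proof (cases "is_unit n")
    case True
    have "lids n = {UNIV}"
    proof -
      have "lid x = UNIV" if "normalize (nr x) = normalize n" for x
      proof -
        have "is_unit (nr x)" using that True by (metis associatedD1 dvd_unit_imp_unit)
        then have "lid (x * 1) = lid 1" by (rule lid_eq_unit)
        then show ?thesis by (simp add: lid_def)
      qed
      moreover have "lid 1 \<in> lids n" using True by (auto simp: lids_def is_unit_normalize intro!: exI[of _ 1])
      ultimately show ?thesis by (auto simp: lids_def)
    qed
    moreover have "divs n = {1}" using True by (auto simp: divs_def is_unit_normalize dest: dvd_unit_imp_unit)
    ultimately show ?thesis by (simp add: sigma_def)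
  next
    case False
    obtain p where "prime p" "p dvd n" using prime_divisorE[OF less.prems False] .
    then have p: "prime_elem p" by simp
    obtain m where m: "n = p * m" using \<open>p dvd n\<close> by (rule dvdE)
    have m0: "m \<noteq> 0" using m less.prems by auto
    note lt = Nm_prime_mult_less[OF p]
    have 1: "card (lids m) = sigma m" using less.hyps[of m] lt[OF m0] m m0 by simp
    have 2: "(if p dvd m then card (lids (m div p)) else 0) = (if p dvd m then sigma (m div p) else 0)"
    proof (cases "p dvd m")
      case True
      then obtain k where k: "m = p * k" by (rule dvdE)
      have k0: "k \<noteq> 0" using k m0 by auto
      have "card (lids k) = sigma k" using less.hyps[of k] lt[OF k0] lt[OF m0] m k k0 by simp
      then show ?thesis using k p by auto
    qed simp
    show ?thesis
      using hecke_recursion[OF p m0] sigma_recursion[OF p m0]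
      unfolding card_imprimitive_lids[OF p m0] 1 2 m by simp
  qed
qed

section \<open>Counting by rational norm\<close>

definition norm_reps :: "nat \<Rightarrow> zs set" where "norm_reps m = {d. normalize d = d \<and> nat \<bar>Nm d\<bar> = m}"

text \<open>The coefficients of the Dedekind zeta function, because each ideal of
  \<open>Z[sqrt 2]\<close> has exactly one normalised generator.\<close>

definition num_ideals :: "nat \<Rightarrow> nat" where "num_ideals m = card (norm_reps m)"

definition dconv :: "(nat \<Rightarrow> 'a::comm_semiring_1) \<Rightarrow> (nat \<Rightarrow> 'a) \<Rightarrow> nat \<Rightarrow> 'a" where
  "dconv f g m = (\<Sum>a | a dvd m. f a * g (m div a))"

lemma norm_reps_subset_divs: "norm_reps m \<subseteq> divs (of_int (int m))"
proof
  fix d assume d: "d \<in> norm_reps m"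
  then have "int m = \<bar>Nm d\<bar>" by (auto simp: norm_reps_def)
  then have "d dvd of_int (int m)" using dvd_of_int_Nm[of d] by (cases "Nm d \<ge> 0") auto
  then show "d \<in> divs (of_int (int m))" using d by (simp add: divs_def norm_reps_def)
qed

lemma finite_norm_reps: "m > 0 \<Longrightarrow> finite (norm_reps m)"
  using finite_divs[of "of_int (int m)"] norm_reps_subset_divs by (auto simp: zs_eq_iff intro: finite_subset)

text \<open>By \<open>inj_residues\<close> the normalised elements of norm \<open>m\<close> are
  distinct modulo \<open>m\<close>. This crude bound is enough for the non-vanishing of the zeta
  function at \<open>4 s\<close>.\<close>

lemma num_ideals_le: assumes "m > 0" shows "num_ideals m \<le> m\<^sup>2"
proof -
  let ?f = "\<lambda>d. (rat_part d mod int m, irr_part d mod int m)"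
  have "card (norm_reps m) = card (?f ` norm_reps m)"
    using inj_on_subset[OF inj_residues norm_reps_subset_divs] by (rule card_image[symmetric])
  also have "\<dots> \<le> card ({0..<int m} \<times> {0..<int m})" using assms by (intro card_mono) auto
  finally show ?thesis by (simp add: num_ideals_def card_cartesian_product power2_eq_square)
qed

lemma norm_reps_nonzero: "d \<in> norm_reps m \<Longrightarrow> m > 0 \<Longrightarrow> d \<noteq> 0"
  by (auto simp: norm_reps_def)

lemma num_ideals_1 [simp]: "num_ideals 1 = 1" "num_ideals (Suc 0) = 1"
proof -
  have "norm_reps 1 = {1}"
  proof (intro equalityI subsetI)
    fix x assume "x \<in> norm_reps 1"
    then have x: "normalize x = x" "\<bar>Nm x\<bar> = 1" by (auto simp: norm_reps_def)
    then have "is_unit x" by (simp add: zs_is_unit_iff)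
    then show "x \<in> {1}" using x(1) by (simp add: is_unit_normalize)
  qed (simp add: norm_reps_def)
  then show "num_ideals 1 = 1" by (simp add: num_ideals_def)
  then show "num_ideals (Suc 0) = 1" by simp
qed

lemma norm_reps_normalizeI: "nat \<bar>Nm d\<bar> = m \<Longrightarrow> normalize d \<in> norm_reps m"
  by (simp add: norm_reps_def)

lemma normalize_mult_normalize [simp]:
  "normalize (normalize a * (b::zs)) = normalize (a * b)" "normalize (a * normalize b) = normalize (a * b)"
  by (rule normalize_mult_cong; simp)+

text \<open>Here \<open>m\<close> is the norm of the reduced norm, whose square is the index of the
  ideal.\<close>

definition num_lideals :: "nat \<Rightarrow> nat" where
  "num_lideals m = card {I. \<exists>x. x \<noteq> 0 \<and> I = lid x \<and> nat (Nm (nr x)) = m}"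

lemma lids_of_norm:
  assumes "m > 0"
  shows "{I. \<exists>x. x \<noteq> 0 \<and> I = lid x \<and> nat (Nm (nr x)) = m} = (\<Union>n\<in>norm_reps m. lids n)"
proof (intro equalityI subsetI)
  fix I assume "I \<in> {I. \<exists>x. x \<noteq> 0 \<and> I = lid x \<and> nat (Nm (nr x)) = m}"
  then obtain x where x: "x \<noteq> 0" "I = lid x" "nat (Nm (nr x)) = m" by blast
  then have "normalize (nr x) \<in> norm_reps m" using Nm_nr_nonneg[of x] by (intro norm_reps_normalizeI) simp
  moreover have "I \<in> lids (normalize (nr x))" using x by (auto simp: lids_def)
  ultimately show "I \<in> (\<Union>n\<in>norm_reps m. lids n)" by blast
next
  fix I assume "I \<in> (\<Union>n\<in>norm_reps m. lids n)"
  then obtain n x where x: "n \<in> norm_reps m" "I = lid x" "normalize (nr x) = n" by (auto simp: lids_def norm_reps_def)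
  then have "nat (Nm (nr x)) = m" using Nm_nr_nonneg[of x] abs_Nm_normalize[of "nr x"] by (auto simp: norm_reps_def)
  moreover have "x \<noteq> 0" using calculation assms by auto
  ultimately show "I \<in> {I. \<exists>x. x \<noteq> 0 \<and> I = lid x \<and> nat (Nm (nr x)) = m}" using x by blast
qed

lemma finite_lids_of_norm:
  "m > 0 \<Longrightarrow> finite {I. \<exists>x. x \<noteq> 0 \<and> I = lid x \<and> nat (Nm (nr x)) = m}"
  unfolding lids_of_norm using finite_norm_reps finite_lids norm_reps_nonzero by blast

text \<open>Summing \<open>sigma n\<close> over the normalised \<open>n\<close> of norm
  \<open>m\<close> amounts to summing the norm of \<open>d\<close> over all factorisations of these
  \<open>n\<close> into \<open>d\<close> and \<open>e\<close>. It is the coefficient identity behind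
  \<open>zeta(s - 1) * zeta(s)\<close>.\<close>

lemma num_lideals_eq: assumes "m > 0" shows "num_lideals m = dconv (\<lambda>a. a * num_ideals a) num_ideals m"
proof -
  have "num_lideals m = (\<Sum>n\<in>norm_reps m. card (lids n))"
    unfolding num_lideals_def lids_of_norm[OF assms]
  proof (rule card_UN_disjoint)
    show "\<forall>i\<in>norm_reps m. \<forall>j\<in>norm_reps m. i \<noteq> j \<longrightarrow> lids i \<inter> lids j = {}"
    proof (intro ballI impI)
      fix i j assume ij: "i \<in> norm_reps m" "j \<in> norm_reps m" "i \<noteq> j"
      have "False" if I: "I \<in> lids i" "I \<in> lids j" for I
      proof -
        obtain x where "I = lid x" using I by (auto simp: lids_def)
        then have "normalize i = normalize j" using lids_norm I by metis
        then show False using ij by (simp add: norm_reps_def)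
      qed
      then show "lids i \<inter> lids j = {}" by blast
    qed
  qed (use finite_norm_reps[OF assms] finite_lids norm_reps_nonzero[OF _ assms] in auto)
  also have "\<dots> = (\<Sum>n\<in>norm_reps m. \<Sum>d\<in>divs n. nat \<bar>Nm d\<bar>)"
    using card_lids norm_reps_nonzero[OF _ assms] by (intro sum.cong) (auto simp: sigma_def)
  also have "\<dots> = (\<Sum>(n, d)\<in>(SIGMA n:norm_reps m. divs n). nat \<bar>Nm d\<bar>)"
    using finite_norm_reps[OF assms] finite_divs norm_reps_nonzero[OF _ assms] by (intro sum.Sigma) auto
  also have "\<dots> = (\<Sum>(a, d, e)\<in>(SIGMA a:{a. a dvd m}. norm_reps a \<times> norm_reps (m div a)). a)"
  proof (rule sum.reindex_bij_witness[where
      i = "\<lambda>(a, d, e). (normalize (d * e), d)" and j = "\<lambda>(n, d). (nat \<bar>Nm d\<bar>, d, normalize (n div d))"])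
    fix z assume "z \<in> (SIGMA n:norm_reps m. divs n)"
    then obtain n d where z: "z = (n, d)" "n \<in> norm_reps m" "d dvd n" "normalize d = d" by (auto simp: divs_def)
    then obtain e where e: "n = d * e" by (auto elim: dvdE)
    have n0: "n \<noteq> 0" using z norm_reps_nonzero assms by blast
    have d0: "d \<noteq> 0" using n0 e by auto
    have m: "m = nat \<bar>Nm d\<bar> * nat \<bar>Nm e\<bar>" using z e by (simp add: norm_reps_def Nm_mult abs_mult nat_mult_distrib)
    have "n = normalize (d * e)" using z e by (simp add: norm_reps_def)
    then show "(case case z of (n, d) \<Rightarrow> (nat \<bar>Nm d\<bar>, d, normalize (n div d)) of (a, d, e) \<Rightarrow> (normalize (d * e), d)) = z"
      using z e d0 by simp
    show "(case z of (n, d) \<Rightarrow> (nat \<bar>Nm d\<bar>, d, normalize (n div d))) \<in> (SIGMA a:{a. a dvd m}. norm_reps a \<times> norm_reps (m div a))"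
      using z e d0 m by (simp add: norm_reps_def)
    show "(case case z of (n, d) \<Rightarrow> (nat \<bar>Nm d\<bar>, d, normalize (n div d)) of (a, d, e) \<Rightarrow> a) = (case z of (n, d) \<Rightarrow> nat \<bar>Nm d\<bar>)"
      using z by simp
  next
    fix z assume "z \<in> (SIGMA a:{a. a dvd m}. norm_reps a \<times> norm_reps (m div a))"
    then obtain a d e where z: "z = (a, d, e)" "a dvd m" "d \<in> norm_reps a" "e \<in> norm_reps (m div a)" by auto
    then obtain b where b: "m = a * b" by (auto elim: dvdE)
    have ab: "a > 0" "b > 0" using b assms by auto
    have d0: "d \<noteq> 0" using z(3) ab by (intro norm_reps_nonzero)
    have "m div a = b" using ab b by simp
    then have N: "nat \<bar>Nm d\<bar> = a" "nat \<bar>Nm e\<bar> = b" "normalize d = d" "normalize e = e" using z by (auto simp: norm_reps_def)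
    have "normalize (d * e) \<in> norm_reps m"
      using N b by (intro norm_reps_normalizeI) (simp add: Nm_mult abs_mult nat_mult_distrib)
    then show "(case z of (a, d, e) \<Rightarrow> (normalize (d * e), d)) \<in> (SIGMA n:norm_reps m. divs n)"
      using z N by (simp add: divs_def)
    have "normalize (normalize (d * e) div d) = e"
    proof -
      have "normalize (d * e) = d * (normalize (d * e) div d)" by simp
      then have "normalize ((normalize (d * e) div d) * d) = normalize (e * d)" by (metis mult.commute normalize_idem)
      then show ?thesis using normalize_mult_cancel d0 N by metis
    qed
    then show "(case case z of (a, d, e) \<Rightarrow> (normalize (d * e), d) of (n, d) \<Rightarrow> (nat \<bar>Nm d\<bar>, d, normalize (n div d))) = z"
      using z N by simp
  qed
  also have "\<dots> = (\<Sum>a | a dvd m. \<Sum>(d, e)\<in>norm_reps a \<times> norm_reps (m div a). a)"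
  proof (subst sum.Sigma)
    show "finite {a. a dvd m}" using assms by simp
    show "\<forall>a\<in>{a. a dvd m}. finite (norm_reps a \<times> norm_reps (m div a))"
      using assms finite_norm_reps by (auto elim!: dvdE)
  qed simp
  also have "\<dots> = dconv (\<lambda>a. a * num_ideals a) num_ideals m"
    unfolding dconv_def by (rule sum.cong) (auto simp: num_ideals_def card_cartesian_product split_def)
  finally show ?thesis .
qed

lemma coprime_of_nat_zs: assumes "coprime m n" shows "coprime (of_nat m :: zs) (of_nat n)"
proof (rule coprimeI)
  fix c :: zs assume c: "c dvd of_nat m" "c dvd of_nat n"
  have "coprime (int m) (int n)" using assms by simp
  then obtain x y where "bezout_coefficients (int m) (int n) = (x, y)" "gcd (int m) (int n) = 1" by fastforce
  then have "x * int m + y * int n = 1" using bezout_coefficients[of "int m" "int n" x y] by simp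
  then have "of_int x * of_nat m + of_int y * of_nat n = (1::zs)" by (metis of_int_1 of_int_add of_int_mult of_int_of_nat_eq)
  then show "is_unit c" using c by (metis dvd_add dvd_mult)
qed

text \<open>A product \<open>d * e\<close> gives back its factors as greatest common divisors with
  \<open>m\<close> and \<open>n\<close>. Conversely, an element of norm \<open>m * n\<close> divides
  \<open>m * n\<close> and splits as \<open>b * c\<close> with \<open>b\<close> dividing
  \<open>m\<close> and \<open>c\<close> dividing \<open>n\<close>. The norm of \<open>b\<close>
  divides \<open>m^2\<close> and that of \<open>c\<close> divides \<open>n^2\<close>, so coprimality
  forces them to be \<open>m\<close> and \<open>n\<close>.\<close>

lemma num_ideals_coprime: assumes "m > 0" "n > 0" "coprime m n" shows "num_ideals (m * n) = num_ideals m * num_ideals n"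
proof -
  let ?f = "\<lambda>(d, e). normalize (d * e) :: zs"
  have dvd: "d dvd of_nat m" if "d \<in> norm_reps m" for d m using that norm_reps_subset_divs by (auto simp: divs_def)
  have cop: "coprime (of_nat m :: zs) (of_nat n)" by (rule coprime_of_nat_zs[OF assms(3)])
  have "inj_on ?f (norm_reps m \<times> norm_reps n)"
  proof (rule inj_onI)
    have g: "gcd (normalize (d * e)) (of_nat m) = d" "gcd (normalize (d * e)) (of_nat n) = e"
      if de: "d \<in> norm_reps m" "e \<in> norm_reps n" for d e
    proof -
      have "coprime (of_nat m) e" "coprime (of_nat n) d"
        using cop dvd[OF de(1)] dvd[OF de(2)] by (meson coprime_commute coprime_divisors dvd_refl)+
      then have "gcd (d * e) (of_nat m) = gcd d (of_nat m)" "gcd (d * e) (of_nat n) = gcd e (of_nat n)"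
        by (simp_all add: gcd_mult_left_right_cancel gcd_mult_left_left_cancel)
      moreover have "gcd d (of_nat m) = normalize d" "gcd e (of_nat n) = normalize e"
        using dvd de by (simp_all add: gcd_proj1_iff)
      ultimately show "gcd (normalize (d * e)) (of_nat m) = d" "gcd (normalize (d * e)) (of_nat n) = e"
        using de by (simp_all add: norm_reps_def)
    qed
    fix z z' assume "z \<in> norm_reps m \<times> norm_reps n" "z' \<in> norm_reps m \<times> norm_reps n" "?f z = ?f z'"
    then show "z = z'" using g by (metis (no_types, lifting) SigmaE case_prod_conv)
  qed
  moreover have "?f ` (norm_reps m \<times> norm_reps n) = norm_reps (m * n)"
  proof (intro equalityI subsetI)
    fix z assume "z \<in> ?f ` (norm_reps m \<times> norm_reps n)"
    then show "z \<in> norm_reps (m * n)" by (auto simp: norm_reps_def Nm_mult abs_mult nat_mult_distrib)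
  next
    fix z assume z: "z \<in> norm_reps (m * n)"
    have "z dvd of_nat m * of_nat n" using dvd[OF z] by simp
    then obtain b c where bc: "z = b * c" "b dvd of_nat m" "c dvd of_nat n" using division_decomp by blast
    let ?b = "nat \<bar>Nm b\<bar>" and ?c = "nat \<bar>Nm c\<bar>"
    have N: "?b * ?c = m * n" using z bc by (simp add: norm_reps_def Nm_mult abs_mult nat_mult_distrib)
    have k: "nat \<bar>Nm x\<bar> dvd k\<^sup>2" if x: "x dvd of_nat k" for x k
    proof -
      have "Nm (of_nat k) = (int k)\<^sup>2" using Nm_of_int[of "int k"] by simp
      then have "\<bar>Nm x\<bar> dvd int (k\<^sup>2)" using Nm_dvd[OF x] by simp
      then show ?thesis by (simp add: nat_dvd_iff)
    qed
    have "?b dvd m\<^sup>2" "?c dvd n\<^sup>2" using k bc by auto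
    then have "coprime ?b n" "coprime ?c m" using assms(3)
      by (meson coprime_commute coprime_divisors coprime_power_left_iff dvd_refl)+
    then have "?b dvd m" "?c dvd n" using N by (metis coprime_dvd_mult_left_iff coprime_dvd_mult_right_iff dvd_triv_left dvd_triv_right)+
    then obtain k l where kl: "m = ?b * k" "n = ?c * l" unfolding dvd_def by blast
    then have "?b * ?c * 1 = ?b * ?c * (k * l)" using N by (simp add: mult_ac)
    moreover have "?b * ?c \<noteq> 0" using N assms by simp
    ultimately have "k * l = 1" by simp
    then have "?b = m" "?c = n" using kl by simp_all
    then have "normalize b \<in> norm_reps m" "normalize c \<in> norm_reps n" by (auto intro: norm_reps_normalizeI)
    moreover have "z = ?f (normalize b, normalize c)" using bc z by (simp add: norm_reps_def)
    ultimately show "z \<in> ?f ` (norm_reps m \<times> norm_reps n)" by blast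
  qed
  ultimately show ?thesis unfolding num_ideals_def by (metis card_cartesian_product card_image)
qed

section \<open>Similarity submodules are two-sided translates\<close>

definition kI :: kq where "kI = KQ (- 1) r2 0 0"
definition kJ :: kq where "kJ = KQ (- 1) 0 r2 0"
definition kK :: kq where "kK = KQ 1 (- r2) (- r2) 2"

lemma unit_table:
  "kI * kI = - 1" "kJ * kJ = - 1" "kK * kK = - 1"
  "kI * kJ = kK" "kJ * kI = - kK" "kJ * kK = kI" "kK * kJ = - kI" "kK * kI = kJ" "kI * kK = - kJ"
  by (simp_all add: kI_def kJ_def kK_def kq_eq_iff kq_mult_simps algebra_simps r2_r2)

lemma unit_table_assoc:
  "kI * (kI * x) = - x" "kJ * (kJ * x) = - x" "kK * (kK * x) = - x"
  "kI * (kJ * x) = kK * x" "kJ * (kI * x) = - (kK * x)" "kJ * (kK * x) = kI * x"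
  "kK * (kJ * x) = - (kI * x)" "kK * (kI * x) = kJ * x" "kI * (kK * x) = - (kJ * x)"
  by (simp_all add: unit_table flip: mult.assoc)

lemma nr_units: "nr kI = 1" "nr kJ = 1" "nr kK = 1"
  by (simp_all add: kI_def kJ_def kK_def nr_def algebra_simps r2_r2)

lemma tr_units: "tr kI = 0" "tr kJ = 0" "tr kK = 0"
  "tr (qbar kI * kJ) = 0" "tr (qbar kJ * kK) = 0" "tr (qbar kI * kK) = 0"
  by (simp_all add: kI_def kJ_def kK_def tr_def kq_mult_simps algebra_simps r2_r2)

text \<open>The span of \<open>1, i, j, k\<close> over \<open>Z[sqrt 2]\<close> is smaller than
  \<open>K\<close> but contains \<open>2 K\<close>. Hence linear identities may be checked on the
  four units and divided by 2 afterwards.\<close>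

lemma twice_span: "oK 2 * x = oK (2 * c1 x + r2 * cu x + r2 * cv x + cw x) * 1
  + oK (r2 * cu x + cw x) * kI + oK (r2 * cv x + cw x) * kJ + oK (cw x) * kK"
  by (simp add: kI_def kJ_def kK_def kq_eq_iff algebra_simps r2_r2)

lemma self_adjoint_central: assumes "qbar z = z" shows "z = oK (c1 z)"
proof -
  have 2: "- x = x \<Longrightarrow> x = 0" for x :: zs by (simp add: zs_eq_iff)
  have "- cu z = cu z" "- cv z = cv z" "- cw z = cw z"
    using arg_cong[OF assms, of cu] arg_cong[OF assms, of cv] arg_cong[OF assms, of cw] by simp_all
  then have "cu z = 0" "cv z = 0" "cw z = 0" using 2 by blast+
  then show ?thesis by (simp add: kq_eq_iff)
qed

text \<open>What a map \<open>\<alpha> R\<close> of the cubian ring into itself becomes in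
  coordinates: real linearity leaves linearity over \<open>Z[sqrt 2]\<close>, and
  \<open>\<alpha>^2\<close>, the norm of the image of 1, becomes an element \<open>n\<close> of the
  ring.\<close>

locale similitude =
  fixes \<tau> :: "kq \<Rightarrow> kq" and n :: zs
  assumes add: "\<tau> (x + y) = \<tau> x + \<tau> y" and smul: "\<tau> (oK a * x) = oK a * \<tau> x"
    and nr_tau: "nr (\<tau> x) = n * nr x" and n0: "n \<noteq> 0"
begin

lemma tr_tau: "tr (\<tau> x * qbar (\<tau> y)) = n * tr (x * qbar y)"
  using nr_tau[of "x + y"] by (simp add: add nr_add nr_tau distrib_left)

text \<open>\<open>s / n\<close> would be a linear isometry fixing 1. The denominator is kept out,
  so the relations below carry powers of \<open>n\<close>.\<close>

definition s where "s x = qbar (\<tau> 1) * \<tau> x"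

lemma s_one: "s 1 = oK n"
  by (simp add: s_def qbar_mult_self nr_tau)

lemma nr_s: "nr (s x) = n * n * nr x"
  by (simp add: s_def nr_mult nr_tau)

lemma tr_s: "tr (s x) = n * tr x"
  unfolding s_def using tr_tau[of x 1] by (simp add: tr_mult_commute)

lemma tr_s_s: "tr (qbar (s x) * s y) = n * n * tr (qbar x * y)"
proof -
  have "qbar (s x) * s y = qbar (\<tau> x) * (\<tau> 1 * qbar (\<tau> 1)) * \<tau> y"
    by (simp add: s_def qbar_mult mult.assoc)
  also have "\<dots> = oK n * (qbar (\<tau> x) * \<tau> y)"
    by (simp add: mult_qbar nr_tau oK_comm(1) mult.assoc)
  finally have "tr (qbar (s x) * s y) = n * tr (\<tau> y * qbar (\<tau> x))"
    by (simp add: tr_mult_commute)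
  then show ?thesis by (simp add: tr_tau tr_mult_commute)
qed

lemma s_pure: assumes "tr e = 0" "nr e = 1" shows "qbar (s e) = - s e" "s e * s e = - oK (n * n)"
proof -
  show 1: "qbar (s e) = - s e" using assms by (simp add: qbar_eq tr_s)
  have "- (s e * s e) = oK (n * n)" using mult_qbar[of "s e"] assms by (simp add: 1 nr_s)
  then show "s e * s e = - oK (n * n)" by (metis minus_minus)
qed

lemma s_anticommute:
  assumes "tr e = 0" "nr e = 1" "tr f = 0" "nr f = 1" "tr (qbar e * f) = 0"
  shows "s f * s e = - (s e * s f)"
proof -
  have "qbar (s e) * s f + qbar (qbar (s e) * s f) = 0"
    unfolding plus_qbar by (simp add: tr_s_s assms)
  then show ?thesis by (simp add: qbar_mult s_pure[OF assms(1,2)] s_pure[OF assms(3,4)] add_eq_0_iff)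
qed

abbreviation "si \<equiv> s kI"
abbreviation "sj \<equiv> s kJ"
abbreviation "sk \<equiv> s kK"

lemmas pure_rules = s_pure[OF tr_units(1) nr_units(1)] s_pure[OF tr_units(2) nr_units(2)]
  s_pure[OF tr_units(3) nr_units(3)]

lemmas anti_rules = s_anticommute[OF tr_units(1) nr_units(1) tr_units(2) nr_units(2) tr_units(4)]
  s_anticommute[OF tr_units(2) nr_units(2) tr_units(3) nr_units(3) tr_units(5)]
  s_anticommute[OF tr_units(1) nr_units(1) tr_units(3) nr_units(3) tr_units(6)]

text \<open>The sign distinguishes orientation preserving from orientation reversing similitudes.\<close>
lemma triple_product: "si * sj * sk = oK (n * n * n) \<or> si * sj * sk = - oK (n * n * n)"
proof -
  let ?z = "si * sj * sk"
  \<comment> \<open>Conjugating three pure factors costs three signs, and so does reversing the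
    order of three pairwise anticommuting ones. The product is therefore self-conjugate, hence a
    scalar, and its norm fixes it up to sign.\<close>
  have "qbar ?z = - (sk * (sj * si))" by (simp add: qbar_mult pure_rules(1,3,5))
  also have "\<dots> = (sk * si) * sj" by (simp only: anti_rules(1)) (simp add: mult.assoc)
  also have "\<dots> = - (si * (sk * sj))" by (simp only: anti_rules(3)) (simp add: mult.assoc)
  also have "\<dots> = ?z" by (simp only: anti_rules(2)) (simp add: mult.assoc)
  finally have z: "?z = oK (c1 ?z)" by (rule self_adjoint_central)
  have "c1 ?z * c1 ?z = nr ?z" by (subst (3) z) simp
  also have "\<dots> = (n * n * n) * (n * n * n)" by (simp add: nr_mult nr_s nr_units mult_ac)
  finally have "(c1 ?z - n * n * n) * (c1 ?z + n * n * n) = 0" by (simp add: algebra_simps)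
  then have "c1 ?z = n * n * n \<or> c1 ?z = - (n * n * n)" by (auto simp: eq_neg_iff_add_eq_0)
  then show ?thesis using z by (metis oK_hom(5))
qed

text \<open>With this sign \<open>s / n\<close> respects the multiplication table of
  \<open>i, j, k\<close> and is an automorphism of the algebra. A non-zero \<open>p\<close> with
  \<open>s x * p = oK n * (p * x)\<close> exhibits it as a conjugation; multiplying by
  \<open>\<tau> 1\<close> on the left and by \<open>qbar p\<close> on the right gives the two-sided
  form of \<open>\<tau>\<close>.\<close>

lemma proper_similitude:
  assumes "si * sj * sk = - oK (n * n * n)"
  shows "\<exists>m a b. m \<noteq> 0 \<and> a \<noteq> 0 \<and> b \<noteq> 0 \<and> (\<forall>x. oK m * \<tau> x = a * x * b)"
proof -
  have c: "oK n * x = oK n * y \<Longrightarrow> x = y" "oK (n * n) * x = oK (n * n) * y \<Longrightarrow> x = y" for x y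
    using n0 by auto
  have nn: "oK (n * n) * x = oK n * (oK n * x)" "oK (n * n * n) * x = oK n * (oK n * (oK n * x))" for x
    by (simp_all add: oK_mult mult.assoc)
  have ij: "si * sj = oK n * sk"
  proof -
    have "oK (n * n) * (si * sj) = - (si * sj * (sk * sk))" by (simp only: pure_rules(6)) (simp add: oK_comm(1)[of "si * sj"])
    also have "\<dots> = - (si * sj * sk * sk)" by (simp add: mult.assoc)
    also have "\<dots> = oK (n * n) * (oK n * sk)" by (simp only: assms) (simp add: oK_mult mult.assoc)
    finally show ?thesis by (rule c(2))
  qed
  have jk: "sj * sk = oK n * si"
  proof -
    have "oK (n * n) * (sj * sk) = - (si * si * (sj * sk))" by (simp only: pure_rules(2)) simp
    also have "\<dots> = - (si * (si * sj * sk))" by (simp add: mult.assoc)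
    also have "\<dots> = oK (n * n) * (oK n * si)" 
      by (simp only: assms mult_minus_right minus_minus oK_comm(1)[of si]) (simp add: oK_mult mult.assoc)
    finally show ?thesis by (rule c(2))
  qed
  have ik: "si * sk = - (oK n * sj)"
  proof -
    have "oK n * (si * sk) = si * (si * sj)" unfolding ij by (simp only: oK_comm(2))
    also have "\<dots> = - (oK (n * n) * sj)" by (simp add: pure_rules flip: mult.assoc)
    also have "\<dots> = oK n * (- (oK n * sj))" by (simp add: oK_mult mult.assoc)
    finally show ?thesis by (rule c(1))
  qed
  note tab = ij jk ik anti_rules pure_rules(2,4,6)
  have tab': "si * (sj * x) = oK n * (sk * x)" "sj * (sk * x) = oK n * (si * x)" "si * (sk * x) = - (oK n * (sj * x))"
    "sj * (si * x) = - (oK n * (sk * x))" "sk * (sj * x) = - (oK n * (si * x))" "sk * (si * x) = oK n * (sj * x)"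
    "si * (si * x) = - (oK n * (oK n * x))" "sj * (sj * x) = - (oK n * (oK n * x))" "sk * (sk * x) = - (oK n * (oK n * x))" for x
    by (simp_all add: tab nn flip: mult.assoc)
  \<comment> \<open>averaging over the group of basis units gives an element intertwining \<open>s x\<close> and \<open>n x\<close>\<close>
  define P where "P d = oK n * d - si * (d * kI) - sj * (d * kJ) - sk * (d * kK)" for d
  have "\<exists>d. P d \<noteq> 0"
  proof (rule ccontr)
    assume "\<not> (\<exists>d. P d \<noteq> 0)"
    \<comment> \<open>In this combination each of the terms with \<open>si\<close>,
      \<open>sj\<close>, \<open>sk\<close> occurs twice with either sign, so they cancel and
      \<open>4 n\<close> is left.\<close>
    then have "P 1 - P kI * kI - P kJ * kJ - P kK * kK = 0" by simp
    then have "oK n + oK n + oK n + oK n = 0"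
      by (simp add: P_def algebra_simps unit_table unit_table_assoc)
    then have "oK (4 * n) = 0" by (simp add: kq_eq_iff)
    then show False using n0 by (simp add: zs_eq_iff)
  qed
  then obtain d where d: "P d \<noteq> 0" by blast
  define p where "p = P d"
  have L: "s e * p = oK n * (p * e)" if "e \<in> {1, kI, kJ, kK}" for e
    using that unfolding p_def P_def
    by (auto simp: s_one) (simp_all add: algebra_simps tab' unit_table unit_table_assoc oK_comm(2)[of si] oK_comm(2)[of sj] oK_comm(2)[of sk])
  have sadd: "s (x + y) = s x + s y" "s (oK a * x) = oK a * s x" for x y a
    by (simp_all add: s_def add smul distrib_left oK_comm(2)[of "qbar _"])
  have sp: "s x * p = oK n * (p * x)" for x
  proof -
    have lin: "s (oK a * y) * p = oK n * (p * (oK a * y))" if "s y * p = oK n * (p * y)" for a y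
    proof -
      have "s (oK a * y) * p = oK a * (oK n * (p * y))" by (simp only: sadd mult.assoc that)
      also have "\<dots> = oK n * (oK a * (p * y))" by (rule oK_comm(2))
      finally show ?thesis by (simp only: oK_comm(2)[of p])
    qed
    have "oK 2 * (s x * p) = s (oK 2 * x) * p" by (simp add: sadd mult.assoc)
    also have "\<dots> = oK n * (p * (oK 2 * x))"
      unfolding twice_span[of x] sadd(1) distrib_right[of _ _ p] distrib_left
      using L by (simp only: lin insert_iff simp_thms)
    also have "\<dots> = oK 2 * (oK n * (p * x))" by (metis oK_comm(2))
    finally show ?thesis by (simp add: zs_eq_iff)
  qed
  define m where "m = nr p"
  have "oK m * \<tau> x = (\<tau> 1 * p) * x * qbar p" for x
  proof -
    have "oK n * (\<tau> x * p) = \<tau> 1 * (s x * p)"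
      by (simp add: s_def mult_qbar nr_tau flip: mult.assoc)
    also have "\<dots> = oK n * (\<tau> 1 * (p * x))" unfolding sp by (rule oK_comm(2))
    finally have "\<tau> x * p = \<tau> 1 * (p * x)" by (rule c(1))
    then have "\<tau> x * (p * qbar p) = \<tau> 1 * p * x * qbar p" by (simp add: mult.assoc[symmetric])
    then show ?thesis by (simp add: m_def mult_qbar oK_comm(1))
  qed
  moreover have "m \<noteq> 0" "qbar p \<noteq> 0" using d by (simp_all add: m_def p_def)
  moreover have "\<tau> 1 * p \<noteq> 0" using d nr_tau[of 1] n0 by (auto simp: p_def)
  ultimately show ?thesis
    by (intro exI[of _ m] exI[of _ "\<tau> 1 * p"] exI[of _ "qbar p"]) simp
qed

end

text \<open>Conjugation maps \<open>K\<close> onto itself, so composing with it keeps the range and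
  reverses the sign of the triple product. Orientation reversing maps thus give no further
  submodules.\<close>

lemma similitude_range:
  assumes "similitude \<tau> n"
  obtains a b m where "m \<noteq> 0" "a \<noteq> 0" "b \<noteq> 0" "(\<lambda>x. oK m * x) ` range \<tau> = range (\<lambda>k. a * k * b)"
proof -
  interpret similitude \<tau> n by fact
  show thesis
  proof (cases "si * sj * sk = - oK (n * n * n)")
    case True
    obtain a b m where "m \<noteq> 0" "a \<noteq> 0" "b \<noteq> 0" "\<And>x. oK m * \<tau> x = a * x * b"
      using proper_similitude[OF True] by blast
    then show thesis using that by (simp add: image_image)
  next
    case False
    then have z: "si * sj * sk = oK (n * n * n)" using triple_product by blast
    interpret B: similitude "\<lambda>x. \<tau> (qbar x)" n
      using add smul nr_tau n0 by unfold_locales (auto simp: qbar_mult oK_comm(1))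
    have B: "B.s x = s (qbar x)" for x by (simp add: B.s_def s_def)
    have neg: "s (- x) = - s x" for x
    proof -
      have "- x = oK (- 1) * x" by simp
      then show ?thesis unfolding s_def by (simp only: smul) simp
    qed
    have "qbar kI = - kI" "qbar kJ = - kJ" "qbar kK = - kK" by (simp_all add: qbar_eq tr_units)
    then have "B.si * B.sj * B.sk = - oK (n * n * n)" by (simp add: B neg z)
    from B.proper_similitude[OF this] obtain a b m
      where ab: "m \<noteq> 0" "a \<noteq> 0" "b \<noteq> 0" "\<And>x. oK m * \<tau> (qbar x) = a * x * b" by blast
    have "range \<tau> = \<tau> ` (qbar ` UNIV)" by (metis qbar_add(4) surjI)
    then have "range \<tau> = range (\<lambda>x. \<tau> (qbar x))" by (simp only: image_image)
    then have "(\<lambda>x. oK m * x) ` range \<tau> = range (\<lambda>k. a * k * b)" using ab(4) by (simp add: image_image)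
    then show thesis using that ab by blast
  qed
qed

definition sandwich :: "kq \<Rightarrow> kq \<Rightarrow> kq set" where "sandwich P Q = range (\<lambda>k. P * k * Q)"

lemma sandwich_unit: assumes "is_unit (nr u)"
  shows "sandwich (P * u) Q = sandwich P Q" "sandwich P (u * Q) = sandwich P Q"
proof -
  obtain v where v: "v * u = 1" "u * v = 1" using unit_inverse[OF assms] .
  have *: "range (\<lambda>k. P * (u * k) * Q) = range (\<lambda>k. P * k * Q)" "range (\<lambda>k. P * (k * u) * Q) = range (\<lambda>k. P * k * Q)"
  proof -
    have "P * k * Q = P * (u * (v * k)) * Q" "P * k * Q = P * ((k * v) * u) * Q" for k
      using v by (simp_all add: mult.assoc[symmetric]) (simp_all add: mult.assoc)
    then show "range (\<lambda>k. P * (u * k) * Q) = range (\<lambda>k. P * k * Q)" "range (\<lambda>k. P * (k * u) * Q) = range (\<lambda>k. P * k * Q)"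
      by blast+
  qed
  show "sandwich (P * u) Q = sandwich P Q" "sandwich P (u * Q) = sandwich P Q"
    using * unfolding sandwich_def by (simp_all add: mult.assoc)
qed

text \<open>A prime divisor of \<open>m\<close> divides every \<open>a * k * b\<close>, hence \<open>a\<close> or \<open>b\<close>, and can be cancelled.\<close>
lemma clear_denominator:
  assumes "m \<noteq> 0" "a \<noteq> 0" "b \<noteq> 0" "(\<lambda>x. oK m * x) ` S = sandwich a b"
  shows "\<exists>P Q. P \<noteq> 0 \<and> Q \<noteq> 0 \<and> S = sandwich P Q"
  using assms
proof (induction "nat \<bar>Nm m\<bar>" arbitrary: m a b rule: less_induct)
  case less
  have inj: "inj (\<lambda>x. oK k * x)" if "k \<noteq> 0" for k using that by (auto simp: inj_def)
  show ?case
  proof (cases "is_unit m")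
    case True
    then obtain c where c: "1 = m * c" by (rule dvdE)
    have c0: "c \<noteq> 0" using c by auto
    have "oK c * (oK m * x) = x" for x using c by (simp add: mult.commute flip: mult.assoc oK_mult)
    then have "S = (\<lambda>x. oK c * x) ` sandwich a b" unfolding less.prems(4)[symmetric] by (simp add: image_image)
    then have "S = sandwich (oK c * a) b" by (simp add: sandwich_def image_image mult.assoc)
    then show ?thesis using less.prems c0 by (metis mult_eq_0_iff oK_eq_0)
  next
    case False
    obtain p where "prime p" "p dvd m" using prime_divisorE[OF less.prems(1) False] .
    then have p: "prime_elem p" by simp
    have p0: "p \<noteq> 0" using p by auto
    obtain m' where m: "m = p * m'" using \<open>p dvd m\<close> by (rule dvdE)
    have m0: "m' \<noteq> 0" using m less.prems by auto
    have lt: "nat \<bar>Nm m'\<bar> < nat \<bar>Nm m\<bar>" unfolding m by (rule Nm_prime_mult_less[OF p m0])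
    have pK: "a * k * b \<in> lid (oK p)" for k
    proof -
      have "a * k * b \<in> (\<lambda>x. oK m * x) ` S" unfolding less.prems(4) by (auto simp: sandwich_def)
      then show ?thesis by (auto simp: pK_iff m oK_mult mult.assoc)
    qed
    have cancel: "(\<lambda>x. oK m' * x) ` S = A" if "(\<lambda>x. oK m * x) ` S = (\<lambda>x. oK p * x) ` A" for A
    proof -
      have "(\<lambda>x. oK p * x) ` ((\<lambda>x. oK m' * x) ` S) = (\<lambda>x. oK p * x) ` A"
        using that by (simp add: image_image m oK_mult mult.assoc)
      then show ?thesis by (simp only: inj_image_eq_iff[OF inj[OF p0]])
    qed
    show ?thesis
    proof (cases "b \<in> lid (oK p)")
      case True
      then obtain b' where b': "b = oK p * b'" by (auto simp: pK_iff)
      have "sandwich a b = (\<lambda>x. oK p * x) ` sandwich a b'" by (simp add: sandwich_def image_image b' oK_comm(2)[of "a * _"])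
      then show ?thesis using less.hyps[OF lt m0 less.prems(2), of b'] cancel[of "sandwich a b'"] less.prems b' by auto
    next
      case False
      then have "a \<in> lid (oK p)" using prime_mod_prime[OF p pK] by blast
      then obtain a' where a': "a = oK p * a'" by (auto simp: pK_iff)
      have "sandwich a b = (\<lambda>x. oK p * x) ` sandwich a' b" by (simp add: sandwich_def image_image a' mult.assoc)
      then show ?thesis using less.hyps[OF lt m0 _ less.prems(3), of a'] cancel[of "sandwich a' b"] less.prems a' by auto
    qed
  qed
qed

section \<open>Similarity submodules of the cubian lattice\<close>

lemma qmult_linear:
  "qmult (x + y) z = qmult x z + qmult y z" "qmult z (x + y) = qmult z x + qmult z y"
  "qmult (c *\<^sub>R x) z = c *\<^sub>R qmult x z" "qmult z (c *\<^sub>R x) = c *\<^sub>R qmult z x"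
  by (simp_all add: vec_eq_iff forall_4 qmult_nth algebra_simps)

lemma norm_qmult: "norm (qmult x y) = norm x * norm y"
proof -
  have "qmult x y \<bullet> qmult x y = (x \<bullet> x) * (y \<bullet> y)"
    by (simp add: inner_4 qmult_nth algebra_simps)
  then show ?thesis by (simp add: norm_eq_sqrt_inner real_sqrt_mult)
qed

theorem is_SSM_cubian_iff:
  "is_SSM cubian M \<longleftrightarrow> (\<exists>P Q. P \<noteq> 0 \<and> Q \<noteq> 0 \<and> M = emb ` sandwich P Q)"
proof
  assume "\<exists>P Q. P \<noteq> 0 \<and> Q \<noteq> 0 \<and> M = emb ` sandwich P Q"
  then obtain P Q where PQ: "P \<noteq> 0" "Q \<noteq> 0" "M = emb ` sandwich P Q" by blast
  define T where "T x = qmult (qmult (emb P) x) (emb Q)" for x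
  define c where "c = norm (emb P) * norm (emb Q)"
  have c0: "c \<noteq> 0" using PQ by (simp add: c_def)
  have lin: "linear T"
    by (rule linearI) (simp_all add: T_def qmult_linear)
  have nT: "norm (T x) = c * norm x" for x by (simp add: T_def norm_qmult c_def)
  have "orthogonal_transformation (\<lambda>x. (1 / c) *\<^sub>R T x)"
    unfolding orthogonal_transformation
    using nT c0 by (auto intro!: linear_compose_scale_right lin simp: c_def)
  moreover have "M = (\<lambda>x. c *\<^sub>R ((1 / c) *\<^sub>R T x)) ` cubian"
    unfolding PQ(3) range_emb[symmetric] using c0 by (simp add: sandwich_def image_image T_def emb_mult)
  moreover have "M \<subseteq> cubian" using PQ(3) range_emb by auto
  ultimately show "is_SSM cubian M" using c0 unfolding is_SSM_def by blast
next
  assume "is_SSM cubian M"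
  then obtain \<alpha> R where M: "M \<subseteq> cubian" "\<alpha> \<noteq> 0" "orthogonal_transformation R"
    "M = (\<lambda>x. \<alpha> *\<^sub>R R x) ` cubian" unfolding is_SSM_def by blast
  define T where "T x = \<alpha> *\<^sub>R R x" for x
  have lin: "linear T" unfolding T_def
    using M(3) by (intro linear_compose_scale_right) (simp add: orthogonal_transformation)
  have inn: "T x \<bullet> T x = \<alpha>\<^sup>2 * (x \<bullet> x)" for x
    using M(3) by (simp add: T_def orthogonal_transformation_def power2_eq_square)
  have "\<exists>k'. emb k' = T (emb k)" for k
  proof -
    have "T (emb k) \<in> M" unfolding M(4) T_def range_emb[symmetric] by blast
    then have "T (emb k) \<in> range emb" using M(1) unfolding range_emb[symmetric] by blast
    then show ?thesis by (metis rangeE)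
  qed
  then obtain \<tau> where \<tau>: "\<And>k. emb (\<tau> k) = T (emb k)" by metis
  \<comment> \<open>Since \<open>R\<close> preserves lengths, \<open>\<alpha>^2\<close> is the
    squared length of the image of 1, which places it in \<open>Z[sqrt 2]\<close>.\<close>
  define n where "n = nr (\<tau> 1)"
  have n: "er n = \<alpha>\<^sup>2"
  proof -
    have "er n = T (emb 1) \<bullet> T (emb 1)" unfolding n_def emb_inner_self[symmetric] \<tau> ..
    also have "\<dots> = \<alpha>\<^sup>2 * er (nr 1)" unfolding inn emb_inner_self ..
    finally show ?thesis by simp
  qed
  have "similitude \<tau> n"
  proof
    fix x y a
    have "emb (\<tau> (x + y)) = emb (\<tau> x + \<tau> y)" by (simp add: \<tau> linear_add[OF lin])
    then show "\<tau> (x + y) = \<tau> x + \<tau> y" by (rule injD[OF inj_emb])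
    have "emb (\<tau> (oK a * x)) = emb (oK a * \<tau> x)" by (simp add: \<tau> linear_scale[OF lin])
    then show "\<tau> (oK a * x) = oK a * \<tau> x" by (rule injD[OF inj_emb])
    have "er (nr (\<tau> x)) = T (emb x) \<bullet> T (emb x)" unfolding emb_inner_self[symmetric] \<tau> ..
    also have "\<dots> = er (n * nr x)" unfolding inn emb_inner_self er_simps n ..
    finally show "nr (\<tau> x) = n * nr x" by (simp only: er_inject)
    show "n \<noteq> 0" using n M(2) by auto
  qed
  then obtain a b m where abm: "m \<noteq> 0" "a \<noteq> 0" "b \<noteq> 0" "(\<lambda>x. oK m * x) ` range \<tau> = sandwich a b"
    unfolding sandwich_def by (rule similitude_range)
  obtain P Q where "P \<noteq> 0" "Q \<noteq> 0" "range \<tau> = sandwich P Q" using clear_denominator[OF abm] by auto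
  moreover have "M = emb ` range \<tau>"
    unfolding M(4) range_emb[symmetric] by (simp add: image_image \<tau> T_def)
  ultimately show "\<exists>P Q. P \<noteq> 0 \<and> Q \<noteq> 0 \<and> M = emb ` sandwich P Q" by blast
qed

section \<open>Counting similarity submodules\<close>

definition primitive :: "kq \<Rightarrow> bool" where
  "primitive x \<longleftrightarrow> x \<noteq> 0 \<and> (\<forall>p. prime_elem p \<longrightarrow> x \<notin> lid (oK p))"

lemma primitive_decomposition:
  assumes "x \<noteq> 0"
  obtains c y where "c \<noteq> 0" "normalize c = c" "primitive y" "x = oK c * y"
proof -
  have "\<exists>c y. c \<noteq> 0 \<and> primitive y \<and> x = oK c * y"
    using assms
  proof (induction "nat (Nm (nr x))" arbitrary: x rule: less_induct)
    case less
    show ?case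
    proof (cases "primitive x")
      case True
      then show ?thesis by (intro exI[of _ 1] exI[of _ x]) simp
    next
      case False
      then obtain p where p: "prime_elem p" "x \<in> lid (oK p)" using less.prems by (auto simp: primitive_def)
      then obtain y where y: "x = oK p * y" by (auto simp: pK_iff)
      have y0: "y \<noteq> 0" using y less.prems by auto
      have "\<bar>Nm p\<bar> > 1" using Nm_prime_gt_1[OF p(1)] .
      then have "\<bar>Nm p\<bar> * \<bar>Nm p\<bar> > 1" by (metis less_1_mult)
      then have "1 * Nm (nr y) < Nm p * Nm p * Nm (nr y)" using Nm_nr_pos[OF y0]
        by (intro mult_strict_right_mono) (auto simp: abs_mult[symmetric])
      then have "nat (Nm (nr y)) < nat (Nm (nr x))" using Nm_nr_pos[OF y0] by (simp add: y nr_mult Nm_mult)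
      then obtain c z where "c \<noteq> 0" "primitive z" "y = oK c * z" using less.hyps y0 by blast
      then show ?thesis using y p by (intro exI[of _ "p * c"] exI[of _ z]) (auto simp: oK_mult mult.assoc)
    qed
  qed
  then obtain c y where cy: "c \<noteq> 0" "primitive y" "x = oK c * y" by blast
  \<comment> \<open>The unit part of the content is moved into the primitive factor, which leaves a
    normalised content.\<close>
  let ?u = "unit_factor c"
  have u: "is_unit ?u" using cy by simp
  have "primitive (oK ?u * y)"
    unfolding primitive_def
  proof (intro conjI allI impI notI)
    show False if "oK ?u * y = 0" using that u cy by (auto simp: primitive_def)
    fix p assume p: "prime_elem p" "oK ?u * y \<in> lid (oK p)"
    obtain v where "1 = ?u * v" using u by (rule dvdE)
    then have "oK v * (oK ?u * y) = y" by (metis mult.assoc mult.commute mult_1 oK_hom(2) oK_mult)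
    then have "y \<in> lid (oK p)" using lid_mult[OF p(2), of "oK v"] by simp
    then show False using cy p by (auto simp: primitive_def)
  qed
  moreover have "x = oK (normalize c) * (oK ?u * y)"
    unfolding cy(3) by (metis mult.assoc mult.commute oK_mult unit_factor_mult_normalize)
  ultimately show thesis using that[of "normalize c" "oK ?u * y"] cy by simp
qed

text \<open>A prime dividing \<open>c'\<close> divides all coordinates of \<open>oK c * x\<close>,
  hence divides \<open>c\<close> because \<open>x\<close> is primitive, and can be
  cancelled.\<close>

lemma content_dvd:
  assumes "primitive x" "c' \<noteq> 0" "oK c * x = oK c' * z"
  shows "c' dvd c"
  using assms(2,3)
proof (induction "nat \<bar>Nm c'\<bar>" arbitrary: c c' rule: less_induct)
  case less
  show ?case
  proof (cases "is_unit c'")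
    case False
    obtain p where "prime p" "p dvd c'" using prime_divisorE[OF less.prems(1) False] .
    then have p: "prime_elem p" by simp
    have p0: "p \<noteq> 0" using p by auto
    obtain d' where d': "c' = p * d'" using \<open>p dvd c'\<close> by (rule dvdE)
    have d0: "d' \<noteq> 0" using d' less.prems by auto
    have "oK c * x \<in> lid (oK p)" using less.prems(2) d' by (auto simp: pK_iff oK_mult mult.assoc)
    moreover have "x \<notin> lid (oK p)" using assms(1) p by (auto simp: primitive_def)
    ultimately have "p dvd c" unfolding pK_mem smul_sel using prime_elem_dvd_mult_iff[OF p] by blast
    then obtain d where d: "c = p * d" by (rule dvdE)
    have "oK p * (oK d * x) = oK p * (oK d' * z)" using less.prems(2) d d' by (simp add: oK_mult mult.assoc)
    then have "oK d * x = oK d' * z" using p0 by simp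
    moreover have "nat \<bar>Nm d'\<bar> < nat \<bar>Nm c'\<bar>" unfolding d' by (rule Nm_prime_mult_less[OF p d0])
    ultimately have "d' dvd d" using less.hyps d0 by blast
    then show ?thesis using d d' by simp
  qed (rule unit_imp_dvd)
qed

lemma lid_eqD:
  assumes "lid x = lid y" "x \<noteq> 0"
  obtains u where "is_unit (nr u)" "x = u * y"
proof -
  have "x \<in> lid y" "y \<in> lid x" using assms lid_self[of x] lid_self[of y] by simp_all
  then obtain a where a: "x = a * y" by (auto simp: lid_def)
  obtain b where b: "y = b * x" using \<open>y \<in> lid x\<close> by (auto simp: lid_def)
  note ab = a b
  have "(a * b) * x = 1 * x" using ab by (metis mult.assoc mult_1)
  then have "a * b = 1" using assms(2) by (simp only: mult_cancel_right) simp
  then have "nr a * nr b = 1" by (metis nr_1 nr_mult)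
  then have "is_unit (nr a)" by (metis dvd_triv_left)
  then show thesis using that ab by blast
qed

lemma primitive_lid_eq:
  assumes "primitive x" "primitive x'" "c \<noteq> 0" "c' \<noteq> 0" "normalize c = c" "normalize c' = c'"
    "lid (oK c * x) = lid (oK c' * x')"
  shows "c = c'" "lid x = lid x'"
proof -
  have x0: "x \<noteq> 0" "x' \<noteq> 0" using assms by (auto simp: primitive_def)
  have *: "c' dvd c" if x: "primitive x" "x \<noteq> 0" "c \<noteq> 0" "c' \<noteq> 0" and l: "lid (oK c * x) = lid (oK c' * x')" for c c' x x'
  proof -
    have "oK c * x \<noteq> 0" using x by simp
    then obtain u where "oK c * x = u * (oK c' * x')" using lid_eqD[OF l] by blast
    then have "oK c * x = oK c' * (u * x')" by (simp only: oK_comm(2)[of u])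
    then show ?thesis using content_dvd x by blast
  qed
  have "c' dvd c" "c dvd c'" using * assms x0 by metis+
  then show c: "c = c'" using assms by (metis associatedI)
  have "oK c * x \<noteq> 0" using x0 assms by simp
  then obtain u where u: "is_unit (nr u)" "oK c * x = u * (oK c' * x')" using lid_eqD[OF assms(7)] by blast
  then have "oK c * x = oK c * (u * x')" using c by (simp add: oK_comm(2)[of u])
  then have "x = u * x'" using assms(3) by simp
  then show "lid x = lid x'" using lid_eq_unit[OF u(1)] by simp
qed

text \<open>The generator \<open>r\<close> of a proper two-sided ideal \<open>T\<close> would have
  norm divisible by some prime \<open>p\<close>, and so would all elements of \<open>T\<close>. Yet
  \<open>T + p K\<close> contains \<open>y\<close>, hence 1 by simplicity, so some element of
  \<open>T\<close> is congruent to 1 modulo \<open>p\<close>.\<close>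

lemma two_sided_primitive:
  assumes T: "add_closed T" "\<And>k y. y \<in> T \<Longrightarrow> k * y \<in> T" "\<And>k y. y \<in> T \<Longrightarrow> y * k \<in> T"
    and y: "y \<in> T" "primitive y"
  shows "1 \<in> T"
proof -
  obtain r where r: "T = lid r" using left_ideal_principal[of T] T by (auto simp: is_lideal_def)
  have "is_unit (nr r)"
  proof (rule ccontr)
    assume nu: "\<not> is_unit (nr r)"
    have "r \<noteq> 0" using y r by (auto simp: lid_def primitive_def)
    then have "nr r \<noteq> 0" by simp
    then obtain p where "prime p" and pr: "p dvd nr r" using prime_divisorE nu by blast
    then have p: "prime_elem p" by simp
    let ?T = "{t. \<exists>s\<in>T. qcong p t s}"
    have "1 \<in> ?T"
    proof (rule simple_mod_prime[OF p, of ?T y])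
      show "add_closed ?T"
        unfolding add_closed_def
      proof (intro conjI ballI)
        show "0 \<in> ?T" using add_closedD(1)[OF T(1)] qcong_refl by blast
        fix a b assume "a \<in> ?T" "b \<in> ?T"
        then obtain a' b' where ab: "a' \<in> T" "b' \<in> T" "qcong p a a'" "qcong p b b'" by blast
        have "qcong p (a - b) (a' - b')"
          using add_closedD(2)[OF add_closed_ids(2) ab(3)[unfolded qcong_def] ab(4)[unfolded qcong_def]]
          by (simp add: qcong_def algebra_simps)
        then show "a - b \<in> ?T" using add_closedD(2)[OF T(1) ab(1,2)] by blast
      qed
      show "k * t \<in> ?T" if "t \<in> ?T" for k t using that T(2) qcong_left by blast
      show "t * k \<in> ?T" if "t \<in> ?T" for k t using that T(3) qcong_right by blast
      show "lid (oK p) \<subseteq> ?T" using add_closedD(1)[OF T(1)] by (auto simp: qcong_def intro!: bexI[of _ 0])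
      show "y \<in> ?T" using y qcong_refl by blast
      show "y \<notin> lid (oK p)" using y p by (auto simp: primitive_def)
    qed
    then obtain s where s: "s \<in> T" "qcong p 1 s" by blast
    have "p dvd nr s" using s pr r nr_dvd_lid dvd_trans by blast
    then have "p dvd nr 1" using nr_dvd_of_mult[of p s 1 1] s by simp
    then show False using p by (simp add: prime_elem_def)
  qed
  then have "lid (r * 1) = lid 1" by (rule lid_eq_unit)
  then show ?thesis using r by simp
qed

text \<open>For primitive \<open>y\<close> the two-sided ideal \<open>K y K\<close> is \<open>K\<close>.\<close>
lemma sandwich_generates:
  assumes V: "add_closed V" "\<And>v k. v \<in> V \<Longrightarrow> v * k \<in> V" and y: "primitive y" and S: "sandwich a (oK b * y) \<subseteq> V"
  shows "a * oK b \<in> V"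
proof -
  let ?T = "{t. \<forall>k. a * k * (oK b * t) \<in> V}"
  have "1 \<in> ?T"
  proof (rule two_sided_primitive[of ?T y])
    show "add_closed ?T"
      using add_closedD(1,2)[OF V(1)] unfolding add_closed_def by (simp add: right_diff_distrib)
    show "k * t \<in> ?T" if "t \<in> ?T" for k t
    proof -
      have "a * l * (oK b * (k * t)) = a * (l * k) * (oK b * t)" for l
        by (simp add: mult.assoc oK_comm(2)[of k])
      then show ?thesis using that by simp
    qed
    show "t * k \<in> ?T" if "t \<in> ?T" for k t
    proof -
      have "a * l * (oK b * (t * k)) = a * l * (oK b * t) * k" for l by (simp add: mult.assoc)
      then show ?thesis using that V(2) by simp
    qed
    show "y \<in> ?T" using S by (auto simp: sandwich_def)
  qed (rule y)
  then have "a * 1 * (oK b * 1) \<in> V" by blast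
  then show ?thesis by simp
qed

lemma sandwich_subset_rid: "sandwich a (oK b * y) \<subseteq> rid (a * oK b)"
proof
  fix z assume "z \<in> sandwich a (oK b * y)"
  then obtain k where "z = a * k * (oK b * y)" by (auto simp: sandwich_def)
  then have "z = (a * oK b) * (k * y)" by (simp add: mult.assoc oK_comm(2)[of k])
  then show "z \<in> rid (a * oK b)" by (auto simp: rid_def)
qed

text \<open>If \<open>b\<close> is the content of \<open>y\<close>, the right ideal generated by the
  submodule is \<open>qbar x * oK b\<close> times \<open>K\<close>. It determines
  \<open>lid x\<close> because \<open>x\<close> is primitive; afterwards \<open>qbar x\<close> can
  be cancelled on the left to recover \<open>lid y\<close>.\<close>

lemma sandwich_eqD:
  assumes x: "primitive x" "primitive x'" and y: "y \<noteq> 0" "y' \<noteq> 0"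
    and eq: "sandwich (qbar x) y = sandwich (qbar x') y'"
  shows "lid x = lid x'" "lid y = lid y'"
proof -
  obtain b z where z: "b \<noteq> 0" "normalize b = b" "primitive z" "y = oK b * z"
    using primitive_decomposition[OF y(1)] .
  obtain b' z' where z': "b' \<noteq> 0" "normalize b' = b'" "primitive z'" "y' = oK b' * z'"
    using primitive_decomposition[OF y(2)] .
  have "sandwich (qbar x) (oK b * z) \<subseteq> rid (qbar x' * oK b')"
    using sandwich_subset_rid[of "qbar x'" b' z'] eq unfolding z(4) z'(4) by simp
  then have "qbar x * oK b \<in> rid (qbar x' * oK b')"
    using sandwich_generates[OF _ _ z(3)] rid_mult add_closed_ids(3) by blast
  moreover have "sandwich (qbar x') (oK b' * z') \<subseteq> rid (qbar x * oK b)"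
    using sandwich_subset_rid[of "qbar x" b z] eq unfolding z(4) z'(4) by simp
  then have "qbar x' * oK b' \<in> rid (qbar x * oK b)"
    using sandwich_generates[OF _ _ z'(3)] rid_mult add_closed_ids(3) by blast
  ultimately have "rid (qbar x * oK b) = rid (qbar x' * oK b')" using rid_subset_iff by blast
  then have "qbar ` rid (qbar x * oK b) = qbar ` rid (qbar x' * oK b')" by simp
  then have "lid (oK b * x) = lid (oK b' * x')" by (simp add: qbar_image_rid qbar_mult)
  then show l: "lid x = lid x'" using primitive_lid_eq(2)[OF x z(1) z'(1) z(2) z'(2)] by blast
  have x0: "x \<noteq> 0" "x' \<noteq> 0" using x by (auto simp: primitive_def)
  obtain u where u: "is_unit (nr u)" "x = u * x'" using lid_eqD[OF l x0(1)] .
  have "sandwich (qbar x) y = sandwich (qbar x') y"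
    using sandwich_unit(1)[of "qbar u" "qbar x'" y] u by (simp add: qbar_mult)
  then have "(\<lambda>k. qbar x' * k) ` lid y = (\<lambda>k. qbar x' * k) ` lid y'"
    using eq by (simp add: sandwich_def lid_def image_image mult.assoc)
  moreover have "inj (\<lambda>k. qbar x' * k)" using x0 by (simp add: inj_def)
  ultimately show "lid y = lid y'" by (simp add: inj_image_eq_iff)
qed

text \<open>By \<open>sandwich_index\<close>, \<open>d\<close> is the square root of the
  index.\<close>

definition sandwiches :: "nat \<Rightarrow> kq set set" where
  "sandwiches d = {S. \<exists>P Q. P \<noteq> 0 \<and> Q \<noteq> 0 \<and> S = sandwich P Q \<and> nat (Nm (nr P)) * nat (Nm (nr Q)) = d}"

definition num_SSM :: "nat \<Rightarrow> nat" where "num_SSM d = card (sandwiches d)"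

abbreviation "qn x \<equiv> nat (Nm (nr x))"

definition lideals_of_norm :: "nat \<Rightarrow> kq set set" where "lideals_of_norm m = {I. \<exists>x. x \<noteq> 0 \<and> I = lid x \<and> qn x = m}"

lemma qn_mult: "qn (x * y) = qn x * qn y"
  using Nm_nr_nonneg by (simp add: nr_mult Nm_mult nat_mult_distrib)

lemma qn_pos: "x \<noteq> 0 \<Longrightarrow> qn x > 0"
  using Nm_nr_pos by simp

lemma qn_oK: "qn (oK c) = (nat \<bar>Nm c\<bar>)\<^sup>2"
  by (simp add: Nm_mult power2_eq_square nat_mult_distrib flip: abs_mult)
     (metis abs_ge_zero abs_mult_self_eq nat_mult_distrib)

lemma lideals_of_norm_memI: "x \<noteq> 0 \<Longrightarrow> lid x \<in> lideals_of_norm (qn x)"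
  unfolding lideals_of_norm_def by blast

text \<open>Both the pairs of left ideals and the pairs (central factor, similarity submodule) are
  parametrised by the same triples, with the same fibres.\<close>
lemma num_SSM_identity:
  assumes N: "N > 0"
  shows "(\<Sum>a | a\<^sup>2 dvd N. num_ideals a * num_SSM (N div a\<^sup>2)) = dconv num_lideals num_lideals N" "finite (sandwiches N)"
proof -
  \<comment> \<open>In a triple \<open>c\<close> is the content of the first left ideal and
    \<open>x\<close> generates its primitive part; \<open>g\<close> keeps \<open>c\<close> apart
    from the submodule.\<close>
  define W where "W = {(c, x, y). normalize c = c \<and> c \<noteq> 0 \<and> primitive x \<and> y \<noteq> 0 \<and> (nat \<bar>Nm c\<bar>)\<^sup>2 * qn x * qn y = N}"
  define f :: "zs \<times> kq \<times> kq \<Rightarrow> kq set \<times> kq set" where "f = (\<lambda>(c, x, y). (lid (oK c * x), lid y))"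
  define g :: "zs \<times> kq \<times> kq \<Rightarrow> zs \<times> kq set" where "g = (\<lambda>(c, x, y). (c, sandwich (qbar x) y))"
  have kernel: "f w = f w' \<longleftrightarrow> g w = g w'" if "w \<in> W" "w' \<in> W" for w w'
  proof -
    obtain c x y where w: "w = (c, x, y)" "normalize c = c" "c \<noteq> 0" "primitive x" "y \<noteq> 0"
      using \<open>w \<in> W\<close> by (auto simp: W_def)
    obtain c' x' y' where w': "w' = (c', x', y')" "normalize c' = c'" "c' \<noteq> 0" "primitive x'" "y' \<noteq> 0"
      using \<open>w' \<in> W\<close> by (auto simp: W_def)
    have x0: "x \<noteq> 0" "x' \<noteq> 0" using w w' by (auto simp: primitive_def)
    show ?thesis
    proof
      assume "f w = f w'"
      then have l: "lid (oK c * x) = lid (oK c' * x')" "lid y = lid y'" by (auto simp: f_def w w')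
      note 1 = primitive_lid_eq[OF w(4) w'(4) w(3) w'(3) w(2) w'(2) l(1)]
      obtain u where u: "is_unit (nr u)" "x = u * x'" using lid_eqD[OF 1(2) x0(1)] .
      obtain v where v: "is_unit (nr v)" "y = v * y'" using lid_eqD[OF l(2) w(5)] .
      have "sandwich (qbar x) y = sandwich (qbar x') y'"
        using sandwich_unit(1)[of "qbar u" "qbar x'" y] sandwich_unit(2)[OF v(1)] u v by (simp add: qbar_mult)
      then show "g w = g w'" using 1 by (simp add: g_def w w')
    next
      assume "g w = g w'"
      then have e: "c = c'" "sandwich (qbar x) y = sandwich (qbar x') y'" by (auto simp: g_def w w')
      note 2 = sandwich_eqD[OF w(4) w'(4) w(5) w'(5) e(2)]
      obtain u where u: "is_unit (nr u)" "x = u * x'" using lid_eqD[OF 2(1) x0(1)] .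
      have "lid (oK c * x) = lid (u * (oK c * x'))" by (simp add: u oK_comm(2)[of u])
      also have "\<dots> = lid (oK c' * x')" using lid_eq_unit[OF u(1)] e by simp
      finally show "f w = f w'" using 2 by (simp add: f_def w w')
    qed
  qed
  have fW: "f ` W = (\<Union>a\<in>{a. a dvd N}. lideals_of_norm a \<times> lideals_of_norm (N div a))"
  proof (intro equalityI subsetI)
    fix z assume "z \<in> f ` W"
    then obtain c x y where w: "z = (lid (oK c * x), lid y)" "c \<noteq> 0" "primitive x" "y \<noteq> 0"
      "(nat \<bar>Nm c\<bar>)\<^sup>2 * qn x * qn y = N" by (auto simp: W_def f_def)
    have x0: "x \<noteq> 0" using w by (auto simp: primitive_def)
    have N': "N = qn (oK c * x) * qn y" using w by (simp only: qn_mult qn_oK)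
    moreover have "qn (oK c * x) > 0" using w x0 by (intro qn_pos) simp
    ultimately have d: "N div qn (oK c * x) = qn y" by (metis nonzero_mult_div_cancel_left not_gr0)
    have "oK c * x \<noteq> 0" using w x0 by simp
    then have "z \<in> lideals_of_norm (qn (oK c * x)) \<times> lideals_of_norm (N div qn (oK c * x))"
      unfolding w(1) d using lideals_of_norm_memI w(4) by (intro SigmaI)
    moreover have "qn (oK c * x) dvd N" using N' by (metis dvd_triv_left)
    ultimately show "z \<in> (\<Union>a\<in>{a. a dvd N}. lideals_of_norm a \<times> lideals_of_norm (N div a))" by blast
  next
    fix z assume "z \<in> (\<Union>a\<in>{a. a dvd N}. lideals_of_norm a \<times> lideals_of_norm (N div a))"
    then obtain x y where z: "z = (lid x, lid y)" "x \<noteq> 0" "y \<noteq> 0" "qn x dvd N" "qn y = N div qn x"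
      by (auto simp: lideals_of_norm_def)
    obtain c x' where x: "c \<noteq> 0" "normalize c = c" "primitive x'" "x = oK c * x'"
      using primitive_decomposition[OF z(2)] .
    have "qn x * qn y = N" using z by simp
    then have "(nat \<bar>Nm c\<bar>)\<^sup>2 * qn x' * qn y = N" by (simp only: x(4) qn_mult qn_oK)
    then have "(c, x', y) \<in> W" using x z by (simp add: W_def)
    moreover have "z = f (c, x', y)" using z x by (simp add: f_def)
    ultimately show "z \<in> f ` W" by blast
  qed
  have gW: "g ` W = (\<Union>a\<in>{a. a\<^sup>2 dvd N}. norm_reps a \<times> sandwiches (N div a\<^sup>2))"
  proof (intro equalityI subsetI)
    fix z assume "z \<in> g ` W"
    then obtain c x y where w: "z = (c, sandwich (qbar x) y)" "normalize c = c" "c \<noteq> 0" "primitive x" "y \<noteq> 0"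
      "(nat \<bar>Nm c\<bar>)\<^sup>2 * qn x * qn y = N" by (auto simp: W_def g_def)
    have x0: "x \<noteq> 0" using w by (auto simp: primitive_def)
    let ?a = "nat \<bar>Nm c\<bar>"
    have N': "N = ?a\<^sup>2 * (qn x * qn y)" using w by simp
    moreover have "?a\<^sup>2 \<noteq> 0" using w by simp
    ultimately have "N div ?a\<^sup>2 = qn x * qn y" by (metis nonzero_mult_div_cancel_left)
    then have "sandwich (qbar x) y \<in> sandwiches (N div ?a\<^sup>2)"
      unfolding sandwiches_def using w x0 by (intro CollectI exI[of _ "qbar x"] exI[of _ y]) simp
    moreover have "?a\<^sup>2 dvd N" using N' by (metis dvd_triv_left)
    moreover have "c \<in> norm_reps ?a" using w by (simp add: norm_reps_def)
    ultimately show "z \<in> (\<Union>a\<in>{a. a\<^sup>2 dvd N}. norm_reps a \<times> sandwiches (N div a\<^sup>2))" unfolding w(1) by blast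
  next
    fix z assume "z \<in> (\<Union>a\<in>{a. a\<^sup>2 dvd N}. norm_reps a \<times> sandwiches (N div a\<^sup>2))"
    then obtain a c P Q where z: "z = (c, sandwich P Q)" "a\<^sup>2 dvd N" "c \<in> norm_reps a" "P \<noteq> 0" "Q \<noteq> 0"
      "qn P * qn Q = N div a\<^sup>2" by (auto simp: sandwiches_def)
    have a0: "a > 0" using z(2) N by (cases "a = 0") auto
    have c: "normalize c = c" "nat \<bar>Nm c\<bar> = a" "c \<noteq> 0" using z(3) a0 by (auto simp: norm_reps_def)
    have "qbar P \<noteq> 0" using z by simp
    \<comment> \<open>The content \<open>e\<close> of the left factor is central and is moved into
      the right factor, so that the submodule gets a primitive left factor.\<close>
    then obtain e x where x: "e \<noteq> 0" "primitive x" "qbar P = oK e * x" using primitive_decomposition by metis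
    have P: "P = oK e * qbar x" using x(3) by (metis oK_comm(1) qbar_add(4,7) qbar_mult)
    have "sandwich P Q = sandwich (qbar x) (oK e * Q)" by (simp add: sandwich_def P mult.assoc oK_comm(2)[of "qbar x"] oK_comm(2))
    moreover have "qn x * qn (oK e * Q) = qn P * qn Q"
      unfolding P qn_mult nr_qbar by (simp only: mult_ac)
    then have "a\<^sup>2 * qn x * qn (oK e * Q) = N" using z(2,6) by (metis dvd_mult_div_cancel mult.assoc)
    then have "(c, x, oK e * Q) \<in> W" using c x z by (simp add: W_def)
    ultimately have "z = g (c, x, oK e * Q)" "(c, x, oK e * Q) \<in> W" using z by (simp_all add: g_def)
    then show "z \<in> g ` W" by blast
  qed
  have pos: "0 < a" if "a dvd N" for a using that N by (cases "a = 0") auto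
  have finl: "finite (lideals_of_norm a)" if "a > 0" for a unfolding lideals_of_norm_def by (rule finite_lids_of_norm[OF that])
  have finN: "finite {a. a dvd N}" using N by simp
  have posdiv: "0 < N div a" if "a dvd N" for a
    using that N by (metis dvd_div_eq_0_iff not_gr0)
  have finf: "finite (f ` W)" unfolding fW using finN finl pos posdiv by auto
  \<comment> \<open>On \<open>W\<close> the map \<open>g\<close> factors through \<open>f\<close>,
    so its image inherits finiteness from the pairs of left ideals.\<close>
  have fing: "finite (g ` W)"
  proof -
    define h where "h v = g (SOME w. w \<in> W \<and> f w = v)" for v
    have h: "h (f w) = g w" if w: "w \<in> W" for w
    proof -
      have "(SOME w'. w' \<in> W \<and> f w' = f w) \<in> W \<and> f (SOME w'. w' \<in> W \<and> f w' = f w) = f w"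
        by (rule someI[of "\<lambda>w'. w' \<in> W \<and> f w' = f w" w]) (use w in simp)
      then show ?thesis unfolding h_def using kernel w by blast
    qed
    have "g ` W \<subseteq> h ` (f ` W)"
    proof
      fix z assume "z \<in> g ` W"
      then obtain w where "w \<in> W" "z = h (f w)" using h by auto
      then show "z \<in> h ` (f ` W)" by blast
    qed
    then show ?thesis using finf finite_surj by blast
  qed
  show finFs: "finite (sandwiches N)"
  proof -
    have "norm_reps 1 \<times> sandwiches (N div 1\<^sup>2) \<subseteq> g ` W" unfolding gW by (rule UN_upper) simp
    then have "norm_reps 1 \<times> sandwiches N \<subseteq> g ` W" by simp
    then have "finite (norm_reps 1 \<times> sandwiches N)" using fing finite_subset by blast
    moreover have "norm_reps 1 \<noteq> {}" using num_ideals_1(1)[unfolded num_ideals_def] by (metis card.empty zero_neq_one)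
    ultimately show ?thesis by (rule finite_cartesian_productD2)
  qed
  have "card (f ` W) = card (g ` W)" using kernel by (rule card_image_cong_kernel)
  moreover have "card (f ` W) = dconv num_lideals num_lideals N"
  proof -
    have disj: "lideals_of_norm a \<inter> lideals_of_norm b = {}" if ab: "a \<noteq> b" for a b
    proof (rule ccontr)
      assume "lideals_of_norm a \<inter> lideals_of_norm b \<noteq> {}"
      then obtain x y where xy: "lid x = lid y" "x \<noteq> 0" "qn x = a" "qn y = b" by (auto simp: lideals_of_norm_def)
      obtain u where u: "is_unit (nr u)" "x = u * y" using lid_eqD[OF xy(1,2)] .
      have "\<bar>Nm (nr u)\<bar> = 1" using u(1) zs_is_unit_iff by blast
      then have "qn u = 1" using Nm_nr_nonneg[of u] by simp
      then have "qn x = qn y" using qn_mult[of u y] u by simp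
      then show False using xy ab by simp
    qed
    have "card (f ` W) = (\<Sum>a | a dvd N. card (lideals_of_norm a \<times> lideals_of_norm (N div a)))"
      unfolding fW
    proof (rule card_UN_disjoint[OF finN])
      show "\<forall>a\<in>{a. a dvd N}. finite (lideals_of_norm a \<times> lideals_of_norm (N div a))" using finl pos posdiv by auto
      show "\<forall>a\<in>{a. a dvd N}. \<forall>b\<in>{a. a dvd N}. a \<noteq> b \<longrightarrow>
          lideals_of_norm a \<times> lideals_of_norm (N div a) \<inter> lideals_of_norm b \<times> lideals_of_norm (N div b) = {}" using disj by blast
    qed
    then show ?thesis by (simp add: card_cartesian_product dconv_def num_lideals_def lideals_of_norm_def)
  qed
  moreover have "card (g ` W) = (\<Sum>a | a\<^sup>2 dvd N. num_ideals a * num_SSM (N div a\<^sup>2))"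
  proof -
    have fin: "finite {a. a\<^sup>2 dvd N}"
    proof (rule finite_subset)
      show "{a. a\<^sup>2 dvd N} \<subseteq> {a. a dvd N}" by (auto simp: power2_eq_square intro: dvd_mult_left)
    qed (rule finN)
    have "card (g ` W) = (\<Sum>a | a\<^sup>2 dvd N. card (norm_reps a \<times> sandwiches (N div a\<^sup>2)))"
      unfolding gW
    proof (rule card_UN_disjoint[OF fin])
      show "\<forall>a\<in>{a. a\<^sup>2 dvd N}. finite (norm_reps a \<times> sandwiches (N div a\<^sup>2))"
      proof
        fix a assume "a \<in> {a. a\<^sup>2 dvd N}"
        then have "norm_reps a \<times> sandwiches (N div a\<^sup>2) \<subseteq> g ` W" unfolding gW by blast
        then show "finite (norm_reps a \<times> sandwiches (N div a\<^sup>2))" using fing finite_subset by blast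
      qed
      have "norm_reps a \<inter> norm_reps b = {}" if "a \<noteq> b" for a b using that by (auto simp: norm_reps_def)
      then show "\<forall>a\<in>{a. a\<^sup>2 dvd N}. \<forall>b\<in>{a. a\<^sup>2 dvd N}. a \<noteq> b \<longrightarrow>
          norm_reps a \<times> sandwiches (N div a\<^sup>2) \<inter> norm_reps b \<times> sandwiches (N div b\<^sup>2) = {}" by blast
    qed
    then show ?thesis by (simp add: card_cartesian_product num_ideals_def num_SSM_def)
  qed
  ultimately show "(\<Sum>a | a\<^sup>2 dvd N. num_ideals a * num_SSM (N div a\<^sup>2)) = dconv num_lideals num_lideals N" by simp
qed

lemma SSM_index: assumes "P \<noteq> 0" "Q \<noteq> 0"
  shows "add_index cubian (emb ` sandwich P Q) = (qn P * qn Q)\<^sup>2"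
proof -
  have "add_index (emb ` UNIV) (emb ` sandwich P Q) = add_index UNIV (sandwich P Q)"
    by (rule add_index_image[OF inj_emb]) (auto simp: sandwich_def algebra_simps intro!: add_closed_rangeI)
  then show ?thesis using sandwich_index[OF assms] by (simp add: range_emb sandwich_def)
qed

lemma SSM_of_index:
  "{M. is_SSM cubian M \<and> add_index cubian M = d\<^sup>2} = (\<lambda>S. emb ` S) ` sandwiches d"
proof (intro equalityI subsetI)
  fix M assume "M \<in> {M. is_SSM cubian M \<and> add_index cubian M = d\<^sup>2}"
  then obtain P Q where PQ: "P \<noteq> 0" "Q \<noteq> 0" "M = emb ` sandwich P Q" "add_index cubian M = d\<^sup>2"
    by (auto simp: is_SSM_cubian_iff)
  then have "qn P * qn Q = d" using SSM_index[of P Q] by (simp add: power2_eq_iff_nonneg)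
  then show "M \<in> (\<lambda>S. emb ` S) ` sandwiches d" using PQ by (auto simp: sandwiches_def)
next
  fix M assume "M \<in> (\<lambda>S. emb ` S) ` sandwiches d"
  then obtain P Q where "P \<noteq> 0" "Q \<noteq> 0" "M = emb ` sandwich P Q" "qn P * qn Q = d" by (auto simp: sandwiches_def)
  then show "M \<in> {M. is_SSM cubian M \<and> add_index cubian M = d\<^sup>2}"
    using SSM_index[of P Q] by (auto simp: is_SSM_cubian_iff)
qed

lemma SSM_count_square: "SSM_count cubian (d\<^sup>2) = num_SSM d"
proof -
  have "inj_on (\<lambda>S. emb ` S) (sandwiches d)" by (rule inj_onI) (simp only: inj_image_eq_iff[OF inj_emb])
  then show ?thesis unfolding SSM_count_def SSM_of_index num_SSM_def by (rule card_image)
qed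

lemma SSM_index_square: "is_SSM cubian M \<Longrightarrow> \<exists>d>0. add_index cubian M = d\<^sup>2"
  using SSM_index qn_pos unfolding is_SSM_cubian_iff by (metis nat_0_less_mult_iff)

section \<open>Multiplicativity\<close>

lemma sum_divisors_coprime:
  fixes f :: "nat \<Rightarrow> 'a::comm_monoid_add"
  assumes "m > 0" "n > 0" "coprime m n"
  shows "(\<Sum>d | d dvd m * n. f d) = (\<Sum>a | a dvd m. \<Sum>b | b dvd n. f (a * b))"
proof -
  have g: "gcd (a * b) m = a" "gcd (a * b) n = b" if "a dvd m" "b dvd n" for a b
  proof -
    have "coprime m b" "coprime n a" using assms(3) that by (meson coprime_commute coprime_divisors dvd_refl)+
    then have "gcd (a * b) m = gcd a m" "gcd (a * b) n = gcd b n"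
      by (simp_all add: gcd_mult_left_right_cancel gcd_mult_left_left_cancel)
    then show "gcd (a * b) m = a" "gcd (a * b) n = b" using that by (simp_all add: gcd_nat.absorb1)
  qed
  have "(\<Sum>d | d dvd m * n. f d) = (\<Sum>(a, b)\<in>{a. a dvd m} \<times> {b. b dvd n}. f (a * b))"
  proof (rule sum.reindex_bij_witness[where i = "\<lambda>(a, b). a * b" and j = "\<lambda>d. (gcd d m, gcd d n)"])
    fix d assume "d \<in> {d. d dvd m * n}"
    then obtain a b where d: "d = a * b" "a dvd m" "b dvd n" using division_decomp[of d m n] by auto
    then show "(case (gcd d m, gcd d n) of (a, b) \<Rightarrow> a * b) = d"
      "(gcd d m, gcd d n) \<in> {a. a dvd m} \<times> {b. b dvd n}"
      "(case (gcd d m, gcd d n) of (a, b) \<Rightarrow> f (a * b)) = f d" using g by simp_all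
  next
    fix z assume "z \<in> {a. a dvd m} \<times> {b. b dvd n}"
    then obtain a b where z: "z = (a, b)" "a dvd m" "b dvd n" by blast
    then show "(gcd (case z of (a, b) \<Rightarrow> a * b) m, gcd (case z of (a, b) \<Rightarrow> a * b) n) = z"
      "(case z of (a, b) \<Rightarrow> a * b) \<in> {d. d dvd m * n}" using g by (simp_all add: mult_dvd_mono)
  qed
  also have "\<dots> = (\<Sum>a | a dvd m. \<Sum>b | b dvd n. f (a * b))"
    using assms by (subst sum.cartesian_product) simp
  finally show ?thesis .
qed

lemma multiplicativeD:
  assumes "multiplicative f"
  shows "f 1 = 1" "f (Suc 0) = 1" "m > 0 \<Longrightarrow> n > 0 \<Longrightarrow> coprime m n \<Longrightarrow> f (m * n) = f m * f n"
  using assms by (auto simp: multiplicative_def)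

lemma coprime_divisors_nat: "coprime m (n::nat) \<Longrightarrow> a dvd m \<Longrightarrow> b dvd n \<Longrightarrow> coprime a b"
  using coprime_divisors by blast

lemma dconv_coprime:
  fixes f g :: "nat \<Rightarrow> nat"
  assumes f: "multiplicative f" and mn: "m > 0" "n > 0" "coprime m n"
  shows "dconv f g (m * n) = (\<Sum>a | a dvd m. \<Sum>b | b dvd n. f a * f b * g ((m div a) * (n div b)))"
  unfolding dconv_def sum_divisors_coprime[OF mn]
proof (intro sum.cong refl)
  fix a b assume "a \<in> {a. a dvd m}" "b \<in> {b. b dvd n}"
  then have ab: "a dvd m" "b dvd n" by auto
  then have pos: "a > 0" "b > 0" using mn by (auto intro: Nat.gr0I)
  have "f (a * b) = f a * f b"
    using multiplicativeD(3)[OF f pos] coprime_divisors_nat[OF mn(3) ab] by simp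
  moreover have "m * n div (a * b) = (m div a) * (n div b)" using ab by (simp add: div_mult_div_if_dvd)
  ultimately show "f (a * b) * g (m * n div (a * b)) = f a * f b * g ((m div a) * (n div b))" by simp
qed

lemma dvd_1_set: "{a. a dvd (1::nat)} = {1}" "{a. a dvd (Suc 0)} = {1}"
  by auto

lemma dconv_1 [simp]: "dconv f g 1 = f 1 * g 1" "dconv f g (Suc 0) = f 1 * g 1"
  by (simp_all add: dconv_def dvd_1_set)

lemma dconv_split_product:
  fixes f g :: "nat \<Rightarrow> nat"
  shows "(\<Sum>a | a dvd m. \<Sum>b | b dvd n. f a * f b * (g (m div a) * g (n div b))) = dconv f g m * dconv f g n"
  unfolding dconv_def sum_product by (intro sum.cong refl) (simp add: mult_ac)

lemma div_pos_of_dvd: "a dvd m \<Longrightarrow> m > 0 \<Longrightarrow> m div a > (0::nat)"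
  by (metis dvd_div_eq_0_iff not_gr0)

lemma multiplicative_dconv:
  fixes f g :: "nat \<Rightarrow> nat"
  assumes f: "multiplicative f" and g: "multiplicative g"
  shows "multiplicative (dconv f g)"
  unfolding multiplicative_def
proof (intro conjI allI impI)
  show "dconv f g 1 = 1" using multiplicativeD(1)[OF f] multiplicativeD(1)[OF g] by simp
  fix m n :: nat assume mn: "m > 0" "n > 0" "coprime m n"
  have "dconv f g (m * n) = (\<Sum>a | a dvd m. \<Sum>b | b dvd n. f a * f b * (g (m div a) * g (n div b)))"
    unfolding dconv_coprime[OF f mn]
  proof (intro sum.cong refl)
    fix a b assume "a \<in> {a. a dvd m}" "b \<in> {b. b dvd n}"
    then have ab: "a dvd m" "b dvd n" by auto
    have "coprime (m div a) (n div b)" using mn(3) ab by (intro coprime_divisors_nat[OF mn(3)]) auto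
    then show "f a * f b * g ((m div a) * (n div b)) = f a * f b * (g (m div a) * g (n div b))"
      using multiplicativeD(3)[OF g] div_pos_of_dvd ab mn by simp
  qed
  then show "dconv f g (m * n) = dconv f g m * dconv f g n" by (simp only: dconv_split_product)
qed

text \<open>Expand \<open>dconv f g (m * n)\<close> over pairs of divisors and compare it with the
  product of the two convolutions. The induction hypothesis matches all terms except the one for
  \<open>(1, 1)\<close>, so that one matches as well.\<close>

lemma multiplicative_of_dconv:
  fixes f g :: "nat \<Rightarrow> nat"
  assumes f: "multiplicative f" and G: "multiplicative G" and eq: "\<And>n. n > 0 \<Longrightarrow> dconv f g n = G n"
  shows "multiplicative g"
  unfolding multiplicative_def
proof (intro conjI allI impI)
  show g1: "g 1 = 1" using eq[of 1] multiplicativeD(1)[OF f] multiplicativeD(1)[OF G] by simp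
  fix m n :: nat assume "m > 0" "n > 0" "coprime m n"
  then show "g (m * n) = g m * g n"
  proof (induction "m * n" arbitrary: m n rule: less_induct)
    case less
    note mn = less.prems
    let ?D = "{a. a dvd m} \<times> {b. b dvd n}"
    let ?l = "\<lambda>(a, b). f a * f b * g ((m div a) * (n div b))"
    let ?r = "\<lambda>(a, b). f a * f b * (g (m div a) * g (n div b))"
    have fin: "finite ?D" and one: "(1, 1) \<in> ?D" using mn by auto
    have "sum ?l ?D = G (m * n)"
      using dconv_coprime[OF f mn, of g] eq[of "m * n"] mn by (simp add: sum.cartesian_product)
    also have "\<dots> = G m * G n" by (rule multiplicativeD(3)[OF G mn])
    also have "\<dots> = sum ?r ?D"
      using dconv_split_product[where f = f and g = g and m = m and n = n] eq mn by (simp add: sum.cartesian_product)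
    finally have "?l (1, 1) + sum ?l (?D - {(1, 1)}) = ?r (1, 1) + sum ?r (?D - {(1, 1)})"
      by (simp only: sum.remove[OF fin one, symmetric])
    moreover have "sum ?l (?D - {(1, 1)}) = sum ?r (?D - {(1, 1)})"
    proof (rule sum.cong)
      fix z assume "z \<in> ?D - {(1, 1)}"
      then obtain a b where z: "z = (a, b)" "a dvd m" "b dvd n" "a \<noteq> 1 \<or> b \<noteq> 1" by auto
      have pos: "m div a > 0" "n div b > 0" using div_pos_of_dvd z mn by auto
      have "m div a \<le> m" "n div b \<le> n" by simp_all
      moreover have "m div a < m \<or> n div b < n"
      proof -
        have "a \<noteq> 0" "b \<noteq> 0" using z mn by auto
        then have "a > 1 \<or> b > 1" using z by linarith
        then show ?thesis using mn by auto
      qed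
      ultimately have "(m div a) * (n div b) < m * n"
        using pos by (metis mult_le_less_imp_less mult_less_le_imp_less mn(1,2) zero_le)
      moreover have "coprime (m div a) (n div b)" using z by (intro coprime_divisors_nat[OF mn(3)]) auto
      ultimately have "g ((m div a) * (n div b)) = g (m div a) * g (n div b)" using less.hyps pos by blast
      then show "?l z = ?r z" using z by simp
    qed simp
    ultimately have "?l (1, 1) = ?r (1, 1)" by simp
    then show ?case using multiplicativeD(1,2)[OF f] by simp
  qed
qed

text \<open>The coefficients of \<open>zeta(2 s)\<close> as a Dirichlet series in \<open>s\<close>.
  With them the sum over \<open>a^2 dvd N\<close> becomes an ordinary Dirichlet convolution.\<close>

definition num_ideals_sq :: "nat \<Rightarrow> nat" where "num_ideals_sq n = (if \<exists>c. n = c\<^sup>2 then num_ideals (THE c. n = c\<^sup>2) else 0)"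

lemma num_ideals_sq_square [simp]: "num_ideals_sq (c\<^sup>2) = num_ideals c"
proof -
  have "(THE d. c\<^sup>2 = d\<^sup>2) = c" by (rule the_equality) (auto simp: power2_eq_iff_nonneg)
  then show ?thesis by (auto simp: num_ideals_sq_def)
qed

lemma num_ideals_sq_nonsquare: "(\<And>c. n \<noteq> c\<^sup>2) \<Longrightarrow> num_ideals_sq n = 0"
  by (simp add: num_ideals_sq_def)

lemma coprime_square_factors:
  fixes m n :: nat
  assumes "coprime m n" "m * n = c\<^sup>2"
  obtains a b where "m = a\<^sup>2" "n = b\<^sup>2" "c = a * b" "coprime a b"
proof -
  have "is_nth_power 2 (m * n)" using assms(2) by (auto simp: is_nth_power_def)
  then have "is_nth_power 2 m \<and> is_nth_power 2 n" using is_nth_power_mult_coprime_nat_iff[OF assms(1)] by simp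
  then obtain a b where ab: "m = a\<^sup>2" "n = b\<^sup>2" by (auto simp: is_nth_power_def)
  then have "(a * b)\<^sup>2 = c\<^sup>2" using assms(2) by (simp add: power_mult_distrib)
  then have "c = a * b" by (simp add: power2_eq_iff_nonneg)
  moreover have "coprime a b" using assms(1) ab by simp
  ultimately show thesis using that ab by blast
qed

lemma multiplicative_num_ideals: "multiplicative num_ideals"
  unfolding multiplicative_def using num_ideals_coprime by simp

lemma multiplicative_num_ideals_sq: "multiplicative num_ideals_sq"
  unfolding multiplicative_def
proof (intro conjI allI impI)
  show "num_ideals_sq 1 = 1" using num_ideals_sq_square[of 1] by simp
  fix m n :: nat assume mn: "m > 0" "n > 0" "coprime m n"
  show "num_ideals_sq (m * n) = num_ideals_sq m * num_ideals_sq n"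
  proof (cases "\<exists>c. m * n = c\<^sup>2")
    case True
    then obtain c where "m * n = c\<^sup>2" by blast
    then obtain a b where ab: "m = a\<^sup>2" "n = b\<^sup>2" "c = a * b" "coprime a b" by (rule coprime_square_factors[OF mn(3)])
    have "num_ideals_sq ((a * b)\<^sup>2) = num_ideals a * num_ideals b" unfolding num_ideals_sq_square using num_ideals_coprime[of a b] ab mn by simp
    then show ?thesis using ab by (simp add: power_mult_distrib)
  next
    case False
    have "num_ideals_sq m = 0 \<or> num_ideals_sq n = 0"
    proof (rule ccontr)
      assume "\<not> (num_ideals_sq m = 0 \<or> num_ideals_sq n = 0)"
      then obtain a b where "m = a\<^sup>2" "n = b\<^sup>2" using num_ideals_sq_nonsquare by metis
      then have "m * n = (a * b)\<^sup>2" by (simp add: power_mult_distrib)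
      then show False using False by blast
    qed
    moreover have "num_ideals_sq (m * n) = 0" by (rule num_ideals_sq_nonsquare) (use False in blast)
    ultimately show ?thesis by auto
  qed
qed

lemma multiplicative_cong:
  assumes "multiplicative f" "\<And>n. n > 0 \<Longrightarrow> f n = g n" shows "multiplicative g"
  using assms by (simp add: multiplicative_def)

lemma multiplicative_num_lideals: "multiplicative num_lideals"
proof (rule multiplicative_cong)
  have "multiplicative (\<lambda>a. a * num_ideals a)" unfolding multiplicative_def using num_ideals_coprime by simp
  then show "multiplicative (dconv (\<lambda>a. a * num_ideals a) num_ideals)" by (rule multiplicative_dconv[OF _ multiplicative_num_ideals])
qed (simp add: num_lideals_eq)

lemma dconv_num_SSM: assumes "N > 0" shows "dconv num_ideals_sq num_SSM N = dconv num_lideals num_lideals N"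
proof -
  have fin: "finite {d. d dvd N}" using assms by simp
  have sub: "(\<lambda>a. a\<^sup>2) ` {a. a\<^sup>2 dvd N} \<subseteq> {d. d dvd N}" by auto
  have "dconv num_ideals_sq num_SSM N = (\<Sum>d\<in>(\<lambda>a. a\<^sup>2) ` {a. a\<^sup>2 dvd N}. num_ideals_sq d * num_SSM (N div d))"
    unfolding dconv_def
  proof (rule sum.mono_neutral_right[OF fin sub], intro ballI)
    fix d assume d: "d \<in> {d. d dvd N} - (\<lambda>a. a\<^sup>2) ` {a. a\<^sup>2 dvd N}"
    then have "num_ideals_sq d = 0" by (intro num_ideals_sq_nonsquare) auto
    then show "num_ideals_sq d * num_SSM (N div d) = 0" by simp
  qed
  also have "\<dots> = (\<Sum>a | a\<^sup>2 dvd N. num_ideals a * num_SSM (N div a\<^sup>2))"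
    by (subst sum.reindex) (auto simp: inj_on_def power2_eq_iff_nonneg)
  finally show ?thesis using num_SSM_identity(1)[OF assms] by simp
qed

lemma multiplicative_num_SSM: "multiplicative num_SSM"
  by (rule multiplicative_of_dconv[OF multiplicative_num_ideals_sq multiplicative_dconv[OF multiplicative_num_lideals multiplicative_num_lideals] dconv_num_SSM])

lemma SSM_count_nonsquare:
  assumes "\<And>d. m \<noteq> d\<^sup>2" shows "SSM_count cubian m = 0" "{M. is_SSM cubian M \<and> add_index cubian M = m} = {}"
proof -
  show "{M. is_SSM cubian M \<and> add_index cubian M = m} = {}" using SSM_index_square assms by blast
  then show "SSM_count cubian m = 0" by (simp only: SSM_count_def card.empty)
qed

text \<open>For coprime \<open>m\<close> and \<open>n\<close> the product is a square only if both
  are, and on squares the count is \<open>num_SSM\<close> of the root.\<close>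

lemma multiplicative_SSM_count: "multiplicative (SSM_count cubian)"
  unfolding multiplicative_def
proof (intro conjI allI impI)
  show "SSM_count cubian 1 = 1" using SSM_count_square[of 1] multiplicativeD(1)[OF multiplicative_num_SSM] by simp
  fix m n :: nat assume mn: "m > 0" "n > 0" "coprime m n"
  show "SSM_count cubian (m * n) = SSM_count cubian m * SSM_count cubian n"
  proof (cases "\<exists>c. m * n = c\<^sup>2")
    case True
    then obtain c where "m * n = c\<^sup>2" by blast
    then obtain a b where ab: "m = a\<^sup>2" "n = b\<^sup>2" "c = a * b" "coprime a b" by (rule coprime_square_factors[OF mn(3)])
    have "SSM_count cubian ((a * b)\<^sup>2) = num_SSM a * num_SSM b"
      unfolding SSM_count_square using multiplicativeD(3)[OF multiplicative_num_SSM, of a b] ab mn by simp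
    then show ?thesis using ab by (simp add: power_mult_distrib SSM_count_square)
  next
    case False
    have "SSM_count cubian m = 0 \<or> SSM_count cubian n = 0"
    proof (rule ccontr)
      assume "\<not> (SSM_count cubian m = 0 \<or> SSM_count cubian n = 0)"
      then obtain a b where "m = a\<^sup>2" "n = b\<^sup>2" using SSM_count_nonsquare by metis
      then have "m * n = (a * b)\<^sup>2" by (simp add: power_mult_distrib)
      then show False using False by blast
    qed
    moreover have "SSM_count cubian (m * n) = 0" by (rule SSM_count_nonsquare) (use False in blast)
    ultimately show ?thesis by auto
  qed
qed

section \<open>Small values\<close>

lemma prime_elem_of_prime_norm: assumes "prime (nat \<bar>Nm d\<bar>)" shows "prime_elem d"
proof -
  have "irreducible d"
  proof (rule irreducibleI)
    show "d \<noteq> 0" using assms by auto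
    show "\<not> is_unit d" using assms by (auto simp: zs_is_unit_iff)
    fix a b assume "d = a * b"
    then have "nat \<bar>Nm a\<bar> * nat \<bar>Nm b\<bar> = nat \<bar>Nm d\<bar>" by (simp add: Nm_mult abs_mult nat_mult_distrib)
    then have "nat \<bar>Nm a\<bar> = 1 \<or> nat \<bar>Nm b\<bar> = 1" using assms by (metis prime_product)
    then show "is_unit a \<or> is_unit b" by (auto simp: zs_is_unit_iff)
  qed
  then show ?thesis by (rule irreducible_imp_prime_elem)
qed

lemma normalize_eq_of_dvd:
  assumes "a dvd b" "b \<noteq> 0" "\<bar>Nm a\<bar> = \<bar>Nm b\<bar>" shows "normalize a = normalize (b::zs)"
proof -
  obtain c where c: "b = a * c" using assms(1) by (rule dvdE)
  have "\<bar>Nm a\<bar> * \<bar>Nm c\<bar> = \<bar>Nm a\<bar> * 1" using assms(3) c by (simp add: Nm_mult abs_mult)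
  moreover have "a \<noteq> 0" using assms c by auto
  ultimately have "\<bar>Nm c\<bar> = 1" by (simp only: mult_cancel_left) auto
  then have "is_unit c" by (simp add: zs_is_unit_iff)
  then have "b dvd a" using c by (simp add: mult_unit_dvd_iff)
  then show ?thesis using assms(1) by (rule associatedI[rotated])
qed

text \<open>Up to sign \<open>p\<close> is \<open>d * gconj d\<close> with
  \<open>d = ZS a b\<close>, and every element of norm \<open>p\<close> up to sign is prime and
  divides one of the two factors. If these were associated, \<open>d\<close> would divide
  \<open>d + gconj d\<close>, that is \<open>2 * a\<close>, which \<open>nd\<close>
  excludes.\<close>

lemma num_ideals_split:
  assumes p: "prime p" and ab: "\<bar>a\<^sup>2 - 2 * b\<^sup>2\<bar> = int p" and nd: "\<not> int p dvd (2 * a)\<^sup>2"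
  shows "num_ideals p = 2"
proof -
  let ?d = "ZS a b"
  have N: "\<bar>Nm ?d\<bar> = int p" "\<bar>Nm (gconj ?d)\<bar> = int p" using ab by (simp_all add: Nm_def)
  have d0: "?d \<noteq> 0" "gconj ?d \<noteq> 0" using N p Nm_eq_0 by (metis abs_0 of_nat_eq_0_iff not_prime_0)+
  have "norm_reps p = {normalize ?d, normalize (gconj ?d)}"
  proof (intro equalityI subsetI)
    fix z assume z: "z \<in> norm_reps p"
    then have Nz: "\<bar>Nm z\<bar> = int p" "normalize z = z" by (auto simp: norm_reps_def)
    have zp: "prime_elem z" by (rule prime_elem_of_prime_norm) (use Nz p in simp)
    have "z dvd of_int (int p)" using z norm_reps_subset_divs by (auto simp: divs_def)
    moreover have "of_int (int p) dvd ?d * gconj ?d"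
    proof -
      have "int p dvd Nm ?d" using N(1) by (metis dvd_abs_iff dvd_refl)
      then show ?thesis unfolding mult_gconj by (metis dvd_def of_int_mult)
    qed
    ultimately have "z dvd ?d * gconj ?d" using dvd_trans by blast
    then have "z dvd ?d \<or> z dvd gconj ?d" using zp by (simp add: prime_elem_dvd_mult_iff)
    then show "z \<in> {normalize ?d, normalize (gconj ?d)}"
      using normalize_eq_of_dvd[of z] Nz N d0 by auto
  next
    fix z assume "z \<in> {normalize ?d, normalize (gconj ?d)}"
    then show "z \<in> norm_reps p" using N by (auto intro!: norm_reps_normalizeI)
  qed
  moreover have "normalize ?d \<noteq> normalize (gconj ?d)"
  proof
    assume "normalize ?d = normalize (gconj ?d)"
    then have "?d dvd gconj ?d" by (rule associatedD1)
    then have "?d dvd gconj ?d + ?d" by simp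
    also have "gconj ?d + ?d = of_int (2 * a)" by (simp add: zs_eq_iff)
    finally have "Nm ?d dvd Nm (of_int (2 * a))" by (rule Nm_dvd)
    then have "Nm ?d dvd (2 * a)\<^sup>2" by (simp only: Nm_of_int)
    then have "int p dvd (2 * a)\<^sup>2" using N by (metis abs_dvd_iff)
    then show False using nd by simp
  qed
  ultimately show ?thesis by (simp add: num_ideals_def)
qed

text \<open>For odd \<open>x\<close> the norm \<open>x^2 - 2 y^2\<close> is 1 or 7 modulo 8, a pair
  of residues closed under change of sign.\<close>

lemma num_ideals_zero: assumes "m mod 8 = 3 \<or> m mod 8 = 5" shows "num_ideals m = 0"
proof -
  have "norm_reps m = {}"
  proof (intro equalityI subsetI)
    fix d assume "d \<in> norm_reps m"
    then have N: "\<bar>Nm d\<bar> = int m" by (auto simp: norm_reps_def)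
    let ?x = "rat_part d" and ?y = "irr_part d"
    have "odd m" using assms by presburger
    then have "odd (Nm d)" using N by (metis dvd_abs_iff even_of_nat)
    then have "odd ?x" by (simp add: Nm_def)
    then have x: "?x\<^sup>2 mod 8 = 1"
    proof -
      have "?x mod 8 \<in> {1, 3, 5, 7}" using \<open>odd ?x\<close> by simp presburger
      then show ?thesis by (auto simp: power2_eq_square mod_mult_eq[of ?x 8 ?x, symmetric])
    qed
    have "(2 * ?y\<^sup>2) mod 8 \<in> {0, 2}"
    proof -
      have "?y mod 4 \<in> {0, 1, 2, 3}" by simp presburger
      then have "?y\<^sup>2 mod 4 \<in> {0, 1}" by (auto simp: power2_eq_square mod_mult_eq[of ?y 4 ?y, symmetric])
      then show ?thesis using mult_mod_right[of 2 "?y\<^sup>2" 4] by auto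
    qed
    then have N8: "Nm d mod 8 \<in> {1, 7}"
      using x mod_diff_eq[of "?x\<^sup>2" 8 "2 * ?y\<^sup>2"] unfolding Nm_def by auto
    have "int m mod 8 \<in> {1, 7}"
    proof (cases "Nm d \<ge> 0")
      case True
      then show ?thesis using N N8 by simp
    next
      case False
      then have "int m = - Nm d" using N by simp
      then show ?thesis using N8 mod_minus_eq[of "Nm d" 8] by auto
    qed
    moreover have "int m mod 8 = int (m mod 8)" by (simp add: zmod_int)
    ultimately show "d \<in> {}" using assms by auto
  qed simp
  then show ?thesis by (simp add: num_ideals_def)
qed

text \<open>Without elements of norm \<open>p\<close> up to sign, \<open>p\<close> stays prime in
  \<open>Z[sqrt 2]\<close>. If \<open>d\<close> has norm \<open>p^2\<close> up to sign, then
  \<open>p\<close> divides \<open>d * gconj d\<close>, hence \<open>d\<close>, and equality of the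
  norms makes them associated.\<close>

lemma num_ideals_inert_square: assumes p: "prime p" and "num_ideals p = 0" shows "num_ideals (p\<^sup>2) = 1"
proof -
  let ?p = "of_int (int p) :: zs"
  have p0: "?p \<noteq> 0" using p by (auto simp: zs_eq_iff)
  have no: "nat \<bar>Nm d\<bar> \<noteq> p" for d
  proof
    assume "nat \<bar>Nm d\<bar> = p"
    then have "normalize d \<in> norm_reps p" by (rule norm_reps_normalizeI)
    then show False using assms finite_norm_reps[of p] prime_gt_0_nat[OF p] by (auto simp: num_ideals_def)
  qed
  have NP: "nat \<bar>Nm ?p\<bar> = p\<^sup>2" by (simp only: Nm_of_int) (simp add: nat_power_eq)
  have "irreducible ?p"
  proof (rule irreducibleI)
    show "?p \<noteq> 0" by (rule p0)
    show "\<not> is_unit ?p"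
    proof
      assume "is_unit ?p"
      then have "nat \<bar>Nm ?p\<bar> = 1" using zs_is_unit_iff[of ?p] by (metis nat_one_as_int)
      then have "p * p = 1" unfolding NP by (simp add: power2_eq_square)
      then have "p = 1" by simp
      then show False using p by simp
    qed
    fix a b assume "?p = a * b"
    then have ab: "nat \<bar>Nm a\<bar> * nat \<bar>Nm b\<bar> = p\<^sup>2" using NP by (simp add: Nm_mult abs_mult nat_mult_distrib del: Nm_of_int)
    then obtain i where i: "i \<le> 2" "nat \<bar>Nm a\<bar> = p ^ i" using divides_primepow_nat[OF p] by (metis dvd_triv_left)
    moreover have "i \<noteq> 1" using no i by auto
    ultimately have "i = 0 \<or> i = 2" by linarith
    then have "nat \<bar>Nm a\<bar> = 1 \<or> nat \<bar>Nm b\<bar> = 1" using i ab p by (auto simp: prime_gt_0_nat)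
    then show "is_unit a \<or> is_unit b" by (auto simp: zs_is_unit_iff)
  qed
  then have pe: "prime_elem ?p" by (rule irreducible_imp_prime_elem)
  have "norm_reps (p\<^sup>2) = {normalize ?p}"
  proof (intro equalityI subsetI)
    fix d assume d: "d \<in> norm_reps (p\<^sup>2)"
    then have N: "\<bar>Nm d\<bar> = (int p)\<^sup>2" "normalize d = d" by (auto simp: norm_reps_def) (metis abs_ge_zero int_nat_eq of_nat_power)
    have "?p dvd of_int (Nm d)"
    proof -
      have "int p dvd Nm d" using N(1) by (metis dvd_abs_iff dvd_power zero_less_numeral)
      then show ?thesis by (metis dvd_def of_int_mult)
    qed
    then have "?p dvd d \<or> ?p dvd gconj d" using pe unfolding mult_gconj[symmetric] by (simp add: prime_elem_dvd_mult_iff)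
    moreover have "?p dvd d" if c: "?p dvd gconj d"
    proof -
      obtain e where "gconj d = ?p * e" using c by (rule dvdE)
      then have "d = ?p * gconj e" by (metis gconj_mult zs_eq_iff gconj_simps zs_of_int minus_minus minus_zero)
      then show ?thesis by simp
    qed
    ultimately have "?p dvd d" by blast
    moreover have "d \<noteq> 0" using N p by auto
    moreover have "\<bar>Nm ?p\<bar> = \<bar>Nm d\<bar>" unfolding N(1) Nm_of_int by simp
    ultimately have "normalize ?p = normalize d" by (rule normalize_eq_of_dvd)
    then show "d \<in> {normalize ?p}" using N by simp
  next
    fix d assume "d \<in> {normalize ?p}"
    then show "d \<in> norm_reps (p\<^sup>2)" using NP norm_reps_normalizeI[of ?p] by simp
  qed
  then show ?thesis by (simp add: num_ideals_def)
qed

text \<open>The prime 2 is ramified: \<open>x^2 - 2 y^2\<close> is even only if \<open>x\<close> is,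
  which means divisibility by \<open>sqrt 2\<close>. So multiplication by \<open>r2\<close> is a
  bijection on normalised generators.\<close>

lemma num_ideals_double: "num_ideals (2 * m) = num_ideals m"
proof -
  have r0: "r2 \<noteq> 0" by (simp add: zs_eq_iff)
  have "norm_reps (2 * m) = (\<lambda>d. normalize (r2 * d)) ` norm_reps m"
  proof (intro equalityI subsetI)
    fix d assume "d \<in> norm_reps (2 * m)"
    then have d: "\<bar>Nm d\<bar> = 2 * int m" "normalize d = d" by (auto simp: norm_reps_def)
    then have "even (Nm d)" by (metis dvd_abs_iff dvd_triv_left)
    then have "even (rat_part d)" by (simp add: Nm_def)
    then obtain k where k: "rat_part d = 2 * k" by (rule evenE)
    define e where "e = ZS (irr_part d) k"
    have e: "d = r2 * e" using k by (simp add: e_def zs_eq_iff)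
    then have "nat \<bar>Nm e\<bar> = m" using d by (simp add: Nm_mult abs_mult)
    then have "normalize e \<in> norm_reps m" by (rule norm_reps_normalizeI)
    moreover have "d = normalize (r2 * normalize e)" using d e by simp
    ultimately show "d \<in> (\<lambda>d. normalize (r2 * d)) ` norm_reps m" by blast
  next
    fix d assume "d \<in> (\<lambda>d. normalize (r2 * d)) ` norm_reps m"
    then show "d \<in> norm_reps (2 * m)" by (auto simp: norm_reps_def Nm_mult abs_mult nat_mult_distrib)
  qed
  moreover have "inj_on (\<lambda>d. normalize (r2 * d)) (norm_reps m)"
  proof (rule inj_onI)
    fix d d' assume d: "d \<in> norm_reps m" "d' \<in> norm_reps m" "normalize (r2 * d) = normalize (r2 * d')"
    then have "normalize d = normalize d'" using normalize_mult_cancel[of d r2 d' r2] r0 by (simp add: mult.commute)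
    then show "d = d'" using d by (simp add: norm_reps_def)
  qed
  ultimately show ?thesis by (simp add: num_ideals_def card_image)
qed

section \<open>The counting functions at prime powers\<close>

lemma dconv_prime_power:
  assumes "prime p" shows "dconv f g (p ^ k) = (\<Sum>i\<le>k. f (p ^ i) * g (p ^ (k - i)))"
proof -
  have p: "p > 1" using assms prime_gt_1_nat by blast
  have "{a. a dvd p ^ k} = (\<lambda>i. p ^ i) ` {..k}" using divides_primepow_nat[OF assms] by auto
  then have "dconv f g (p ^ k) = (\<Sum>a\<in>(\<lambda>i. p ^ i) ` {..k}. f a * g (p ^ k div a))" by (simp add: dconv_def)
  also have "\<dots> = (\<Sum>i\<le>k. f (p ^ i) * g (p ^ k div p ^ i))"
    using p by (subst sum.reindex) (auto simp: inj_on_def)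
  also have "\<dots> = (\<Sum>i\<le>k. f (p ^ i) * g (p ^ (k - i)))"
    using p by (intro sum.cong refl) (simp add: power_diff)
  finally show ?thesis .
qed

lemma num_ideals_sq_prime: assumes "prime p" shows "num_ideals_sq p = 0"
proof (rule num_ideals_sq_nonsquare, rule notI)
  fix c assume "p = c\<^sup>2"
  then have "p = c * c" by (simp add: power2_eq_square)
  then have "c = 1" using assms prime_product by blast
  then show False using \<open>p = c * c\<close> assms by simp
qed

lemma num_SSM_prime: assumes p: "prime p" shows "num_SSM p = 2 * (p + 1) * num_ideals p" "num_lideals p = (p + 1) * num_ideals p"
proof -
  have p0: "p > 0" using p prime_gt_0_nat by blast
  show num_lideals: "num_lideals p = (p + 1) * num_ideals p"
    using num_lideals_eq[OF p0] dconv_prime_power[OF p, of "\<lambda>a. a * num_ideals a" num_ideals 1] by (simp add: algebra_simps)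
  have "dconv num_ideals_sq num_SSM p = num_SSM p"
    using dconv_prime_power[OF p, of num_ideals_sq num_SSM 1] num_ideals_sq_prime[OF p] multiplicativeD(2)[OF multiplicative_num_ideals_sq] by simp
  moreover have "dconv num_lideals num_lideals p = 2 * num_lideals p"
    using dconv_prime_power[OF p, of num_lideals num_lideals 1] multiplicativeD(2)[OF multiplicative_num_lideals] by simp
  ultimately show "num_SSM p = 2 * (p + 1) * num_ideals p" using dconv_num_SSM[OF p0] num_lideals by simp
qed

lemma num_SSM_inert_square: assumes p: "prime p" and Z0: "num_ideals p = 0" shows "num_SSM (p\<^sup>2) = 2 * (p\<^sup>2 + 1)"
proof -
  have p0: "p > 0" using p prime_gt_0_nat by blast
  have At0: "num_lideals p = 0" and F0: "num_SSM p = 0" using num_SSM_prime[OF p] Z0 by simp_all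
  have num_lideals: "num_lideals (p\<^sup>2) = p\<^sup>2 + 1"
    using num_lideals_eq[of "p\<^sup>2"] dconv_prime_power[OF p, of "\<lambda>a. a * num_ideals a" num_ideals 2] Z0 num_ideals_inert_square[OF p Z0] p0
    by (simp add: numeral_2_eq_2)
  have "dconv num_ideals_sq num_SSM (p\<^sup>2) = num_SSM (p\<^sup>2) + 0"
    using dconv_prime_power[OF p, of num_ideals_sq num_SSM 2] num_ideals_sq_square[of p] Z0 F0 multiplicativeD(2)[OF multiplicative_num_ideals_sq]
    by (simp add: numeral_2_eq_2)
  moreover have "dconv num_lideals num_lideals (p\<^sup>2) = 2 * num_lideals (p\<^sup>2)"
    using dconv_prime_power[OF p, of num_lideals num_lideals 2] multiplicativeD(2)[OF multiplicative_num_lideals] At0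
    by (simp add: numeral_2_eq_2)
  ultimately show ?thesis using dconv_num_SSM[of "p\<^sup>2"] num_lideals p0 by simp
qed

lemma num_ideals_power2: "num_ideals (2 ^ k) = 1"
  by (induction k) (simp_all add: num_ideals_double)

text \<open>Write \<open>F(k)\<close> for \<open>num_SSM (2 ^ k)\<close>. As
  \<open>num_ideals_sq (2 ^ k)\<close> is 1 for even and 0 for odd \<open>k\<close>, and
  \<open>num_lideals (2 ^ k)\<close> is \<open>2^(k+1) - 1\<close>, the convolution identity gives
  \<open>F(k) + F(k-2) + ...\<close> as the sum of \<open>(2^(i+1) - 1) (2^(k-i+1) - 1)\<close> over
  \<open>i\<close> up to \<open>k\<close>. It is solved for one value after the other.\<close>

lemma num_SSM_powers_of_2: "num_SSM 2 = 6" "num_SSM 4 = 22" "num_SSM 8 = 66" "num_SSM 16 = 178"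
proof -
  have p: "prime (2::nat)" by simp
  have A: "num_lideals (2 ^ k) = (\<Sum>i\<le>k. 2 ^ i)" for k
    using num_lideals_eq[of "2 ^ k"] dconv_prime_power[OF p, of "\<lambda>a. a * num_ideals a" num_ideals k] by (simp add: num_ideals_power2)
  have S: "num_ideals_sq (2 ^ (2 * i)) = 1" for i using num_ideals_sq_square[of "2 ^ i"] by (simp add: num_ideals_power2 power_mult[symmetric] mult.commute)
  have S': "num_ideals_sq (2 ^ Suc (2 * i)) = 0" for i
  proof (rule num_ideals_sq_nonsquare)
    fix c :: nat
    show "2 ^ Suc (2 * i) \<noteq> c\<^sup>2"
    proof
      assume e: "2 ^ Suc (2 * i) = c\<^sup>2"
      then have "c \<noteq> 0" by (metis power_not_zero zero_neq_numeral power_zero_numeral)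
      then have "multiplicity 2 (c\<^sup>2) = 2 * multiplicity 2 c" by (simp add: prime_elem_multiplicity_power_distrib)
      moreover have "multiplicity 2 ((2::nat) ^ Suc (2 * i)) = Suc (2 * i)" by (rule multiplicity_same_power) auto
      ultimately have "2 * multiplicity 2 c = Suc (2 * i)" using e by metis
      then show False by presburger
    qed
  qed
  have iv: "{..1::nat} = {0, 1}" "{..2::nat} = {0, 1, 2}" "{..3::nat} = {0, 1, 2, 3}" "{..4::nat} = {0, 1, 2, 3, 4}"
    by auto
  have e: "dconv num_ideals_sq num_SSM (2 ^ k) = dconv num_lideals num_lideals (2 ^ k)" for k by (rule dconv_num_SSM) simp
  note e = e[unfolded dconv_prime_power[OF p]]
  have S0: "num_ideals_sq 1 = 1" "num_ideals_sq 2 = 0" "num_ideals_sq 4 = 1" "num_ideals_sq 8 = 0" "num_ideals_sq 16 = 1"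
    using S[of 0] S'[of 0] S[of 1] S'[of 1] S[of 2] by simp_all
  have A0: "num_lideals 1 = 1" "num_lideals 2 = 3" "num_lideals 4 = 7" "num_lideals 8 = 15" "num_lideals 16 = 31"
    using A[of 0] A[of 1] A[of 2] A[of 3] A[of 4] by (simp_all only: iv) simp_all
  have F1: "num_SSM 1 = 1" by (rule multiplicativeD(1)[OF multiplicative_num_SSM])
  show F2: "num_SSM 2 = 6" using e[of 1] S0 A0 F1 by (simp add: iv[unfolded One_nat_def])
  show F4: "num_SSM 4 = 22" using e[of 2] S0 A0 F1 F2 by (simp add: iv)
  show F8: "num_SSM 8 = 66" using e[of 3] S0 A0 F1 F2 F4 by (simp add: iv)
  show "num_SSM 16 = 178" using e[of 4] S0 A0 F1 F2 F4 F8 by (simp add: iv)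
qed

lemma num_SSM_values:
  "num_SSM 1 = 1" "num_SSM 2 = 6" "num_SSM 4 = 22" "num_SSM 7 = 32" "num_SSM 8 = 66" "num_SSM 9 = 20" "num_SSM 14 = 192" "num_SSM 16 = 178"
  "num_SSM 17 = 72" "num_SSM 18 = 120" "num_SSM 23 = 96" "num_SSM 25 = 52"
  "d \<in> {3, 5, 6, 10, 11, 12, 13, 15, 19, 20, 21, 22, 24} \<Longrightarrow> num_SSM d = 0"
proof -
  have z: "num_ideals 3 = 0" "num_ideals 5 = 0" "num_ideals 11 = 0" "num_ideals 13 = 0" "num_ideals 19 = 0" by (rule num_ideals_zero; simp)+
  have pr: "prime (3::nat)" "prime (5::nat)" "prime (7::nat)" "prime (11::nat)" "prime (13::nat)"
    "prime (17::nat)" "prime (19::nat)" "prime (23::nat)" by simp_all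
  have s: "num_ideals 7 = 2" "num_ideals 17 = 2" "num_ideals 23 = 2"
    using num_ideals_split[OF pr(3), of 3 1] num_ideals_split[OF pr(6), of 5 2] num_ideals_split[OF pr(8), of 5 1] by simp_all
  have m: "num_SSM (a * b) = num_SSM a * num_SSM b" if "a > 0" "b > 0" "coprime a b" for a b
    using multiplicativeD(3)[OF multiplicative_num_SSM that] .
  show "num_SSM 1 = 1" by (rule multiplicativeD(1)[OF multiplicative_num_SSM])
  show "num_SSM 2 = 6" "num_SSM 4 = 22" "num_SSM 8 = 66" "num_SSM 16 = 178" by (rule num_SSM_powers_of_2)+
  show F7: "num_SSM 7 = 32" and "num_SSM 17 = 72" "num_SSM 23 = 96"
    using num_SSM_prime(1)[OF pr(3)] num_SSM_prime(1)[OF pr(6)] num_SSM_prime(1)[OF pr(8)] s by simp_all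
  show F9: "num_SSM 9 = 20" and "num_SSM 25 = 52"
    using num_SSM_inert_square[OF pr(1) z(1)] num_SSM_inert_square[OF pr(2) z(2)] by simp_all
  have c: "coprime 2 (7::nat)" "coprime 2 (9::nat)" by (simp_all add: coprime_iff_gcd_eq_1 gcd_non_0_nat)
  show "num_SSM 14 = 192" "num_SSM 18 = 120" using m[of 2 7] m[of 2 9] c F7 F9 num_SSM_powers_of_2(1) by simp_all
  \<comment> \<open>Each of the thirteen zeros has one of the inert primes 3, 5, 11, 13, 19 as a
    factor that is prime to its cofactor.\<close>
  have z': "num_SSM 3 = 0" "num_SSM 5 = 0" "num_SSM 11 = 0" "num_SSM 13 = 0" "num_SSM 19 = 0"
    using num_SSM_prime(1) pr z by simp_all
  have c': "coprime 2 (3::nat)" "coprime 2 (5::nat)" "coprime 4 (3::nat)" "coprime 3 (5::nat)" "coprime 4 (5::nat)"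
    "coprime 3 (7::nat)" "coprime 2 (11::nat)" "coprime 8 (3::nat)"
    by (simp_all add: coprime_iff_gcd_eq_1 gcd_non_0_nat)
  have "num_SSM 6 = 0" "num_SSM 10 = 0" "num_SSM 12 = 0" "num_SSM 15 = 0" "num_SSM 20 = 0" "num_SSM 21 = 0" "num_SSM 22 = 0" "num_SSM 24 = 0"
    using m[of 2 3] m[of 2 5] m[of 4 3] m[of 3 5] m[of 4 5] m[of 3 7] m[of 2 11] m[of 8 3] c' z' by simp_all
  then show "num_SSM d = 0" if "d \<in> {3, 5, 6, 10, 11, 12, 13, 15, 19, 20, 21, 22, 24}" for d
    using that z' by auto
qed

section \<open>Ideals and left ideals in the ambient spaces\<close>

text \<open>Only the additive structure enters, so \<open>m\<close> and \<open>e\<close> are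
  arbitrary, and the lemma serves the cubian ring and the ring of integers alike.\<close>

lemma additive_subgroup_iff:
  fixes C :: "'a::ab_group_add set"
  assumes C: "add_closed C"
  shows "additive_subgroup I \<lparr>carrier = C, monoid.mult = m, one = e, zero = 0, add = (+)\<rparr>
    \<longleftrightarrow> I \<subseteq> C \<and> add_closed I"
proof -
  let ?R = "\<lparr>carrier = C, monoid.mult = m, one = e, zero = 0, add = (+)\<rparr>"
  have inv: "inv\<^bsub>add_monoid ?R\<^esub> x = - x" if "x \<in> C" for x
    unfolding m_inv_def using add_closedD(3)[OF C that] by (auto intro!: the_equality simp: add_eq_0_iff)
  show ?thesis
  proof
    assume "additive_subgroup I ?R"
    then have s: "subgroup I (add_monoid ?R)" by (rule additive_subgroup.a_subgroup)
    have sub: "I \<subseteq> C" using subgroup.subset[OF s] by simp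
    have "x - y \<in> I" if "x \<in> I" "y \<in> I" for x y
    proof -
      have "y \<in> C" using sub that by blast
      have "- y \<in> I" using subgroup.m_inv_closed[OF s that(2)] unfolding inv[OF \<open>y \<in> C\<close>] .
      then show ?thesis using subgroup.m_closed[OF s that(1)] by fastforce
    qed
    moreover have "0 \<in> I" using subgroup.one_closed[OF s] by simp
    ultimately show "I \<subseteq> C \<and> add_closed I" using sub by (simp add: add_closed_def)
  next
    assume I: "I \<subseteq> C \<and> add_closed I"
    then have I': "add_closed I" by blast
    show "additive_subgroup I ?R"
    proof (intro additive_subgroup.intro subgroup.intro)
      show "inv\<^bsub>add_monoid ?R\<^esub> x \<in> I" if "x \<in> I" for x
      proof -
        have "x \<in> C" using I that by blast
        show ?thesis unfolding inv[OF \<open>x \<in> C\<close>] by (rule add_closedD(3)[OF I' that])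
      qed
    qed (use I add_closedD(1,4)[OF I'] in auto)
  qed
qed

lemma add_closed_image:
  assumes "\<And>a b. g (a - b) = g a - g b" "add_closed I" shows "add_closed (g ` I)"
proof -
  have "g 0 = 0" using assms(1)[of 0 0] by simp
  then have "0 \<in> g ` I" using add_closedD(1)[OF assms(2)] by (metis imageI)
  moreover have "x - y \<in> g ` I" if xy: "x \<in> g ` I" "y \<in> g ` I" for x y
  proof -
    obtain a b where "a \<in> I" "b \<in> I" "x = g a" "y = g b" using xy by blast
    then show ?thesis using add_closedD(2)[OF assms(2), of a b] assms(1)[of a b] by (metis imageI)
  qed
  ultimately show ?thesis by (simp add: add_closed_def)
qed

lemma add_closed_vimage:
  assumes "\<And>a b. g (a - b) = g a - g b" "add_closed I" shows "add_closed (g -` I)"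
proof -
  have "g 0 = 0" using assms(1)[of 0 0] by simp
  then show ?thesis using assms add_closedD(1,2)[OF assms(2)] by (simp add: add_closed_def)
qed

definition lideals :: "kq set set" where "lideals = {lid x | x. x \<noteq> 0}"

lemma cubian_left_ideals_eq: "cubian_left_ideals = (\<lambda>I. emb ` I) ` lideals"
proof -
  have C: "add_closed cubian" unfolding range_emb[symmetric] by (rule add_closed_rangeI) simp
  note iff = additive_subgroup_iff[OF C, of _ qmult q_1, folded cubian_ring_def]
  have car: "carrier cubian_ring = range emb" "monoid.mult cubian_ring = qmult"
    by (simp_all add: cubian_ring_def range_emb)
  show ?thesis
  proof (intro equalityI subsetI)
    fix I assume "I \<in> cubian_left_ideals"
    then have I: "I \<subseteq> range emb" "add_closed I" "\<And>r x. x \<in> I \<Longrightarrow> qmult (emb r) x \<in> I" "I \<noteq> {0}"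
      unfolding cubian_left_ideals_def left_ideal_def iff car range_emb[symmetric] by auto
    have "is_lideal (emb -` I)"
      unfolding is_lideal_def
    proof (intro conjI allI ballI)
      show "add_closed (emb -` I)" by (rule add_closed_vimage[OF _ I(2)]) simp
      show "k * x \<in> emb -` I" if "x \<in> emb -` I" for k x using that I(3) by (simp add: emb_mult)
    qed
    then obtain x where x: "emb -` I = lid x" by (rule left_ideal_principal)
    then have "I = emb ` lid x" using I(1) by blast
    moreover have "x \<noteq> 0"
    proof
      assume "x = 0"
      then have "lid x = {0}" by (auto simp: lid_def)
      then show False using I(4) \<open>I = emb ` lid x\<close> by simp
    qed
    ultimately show "I \<in> (\<lambda>I. emb ` I) ` lideals" by (auto simp: lideals_def)
  next
    fix I assume "I \<in> (\<lambda>I. emb ` I) ` lideals"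
    then obtain x where x: "I = emb ` lid x" "x \<noteq> 0" by (auto simp: lideals_def)
    have "I \<subseteq> cubian" using x range_emb by blast
    moreover have "add_closed I" unfolding x by (rule add_closed_image) simp_all
    moreover have "qmult r y \<in> I" if "r \<in> range emb" "y \<in> I" for r y
      using that lid_mult unfolding x by (auto simp: emb_mult[symmetric])
    moreover have "I \<noteq> {0}"
    proof
      assume "I = {0}"
      moreover have "emb x \<in> I" using x by simp
      ultimately show False using x by simp
    qed
    ultimately show "I \<in> cubian_left_ideals"
      unfolding cubian_left_ideals_def left_ideal_def iff car by blast
  qed
qed

section \<open>The ring of integers of Q(sqrt 2) and its ideals\<close>

lemma rational_er_quotient:
  assumes "x \<in> Q_sqrt2" obtains a b where "b \<noteq> 0" "x * er b = er a"
proof -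
  obtain u v where uv: "u \<in> \<rat>" "v \<in> \<rat>" "x = u + v * sqrt 2" using assms by (auto simp: Q_sqrt2_def)
  obtain m n where mn: "n \<noteq> 0" "u = of_int m / of_int n" using uv(1) by (metis Rats_cases' not_less_iff_gr_or_eq)
  obtain k l where kl: "l \<noteq> 0" "v = of_int k / of_int l" using uv(2) by (metis Rats_cases' not_less_iff_gr_or_eq)
  have "x * er (of_int (n * l)) = er (ZS (m * l) (k * n))"
    unfolding uv(3) mn(2) kl(2) er_simps(8) using mn(1) kl(1) by (simp add: er_def field_simps)
  moreover have "of_int (n * l) \<noteq> (0::zs)" using mn kl by (simp add: zs_eq_iff)
  ultimately show thesis using that by blast
qed

lemma er_power: "er (a ^ n) = er a ^ n"
  by (induction n) simp_all

lemma er_sum: "er (\<Sum>i\<in>A. f i) = (\<Sum>i\<in>A. er (f i))"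
  by (induction A rule: infinite_finite_induct) simp_all

text \<open>The rational root theorem over \<open>zs\<close>: the denominator of an integral element is a unit.\<close>
lemma integers_of_Q_sqrt2: "{x \<in> Q_sqrt2. algebraic_int x} = range er"
proof (intro equalityI subsetI)
  fix x assume "x \<in> range er"
  then obtain z where z: "x = er z" by blast
  have "x \<in> Q_sqrt2" unfolding z er_def Q_sqrt2_def
    by (intro CollectI exI[of _ "of_int (rat_part z)"] exI[of _ "of_int (irr_part z)"]) simp
  moreover have "algebraic_int x"
  proof (rule algebraic_int.intros[of "[:of_int (Nm z), - 2 * of_int (rat_part z), 1:]"])
    show "\<forall>i. coeff [:of_int (Nm z), - 2 * of_int (rat_part z), 1::real:] i \<in> \<int>"
      by (auto simp: coeff_pCons split: nat.split)
    have "er z + er (gconj z) = 2 * of_int (rat_part z)" by (simp add: er_def)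
    then have g: "er (gconj z) = 2 * of_int (rat_part z) - er z" by simp
    show "poly [:of_int (Nm z), - 2 * of_int (rat_part z), 1:] x = 0"
      unfolding z er_mult_er_gconj[symmetric] g by (simp add: algebra_simps)
  qed simp
  ultimately show "x \<in> {x \<in> Q_sqrt2. algebraic_int x}" by blast
next
  fix x assume "x \<in> {x \<in> Q_sqrt2. algebraic_int x}"
  then have x: "x \<in> Q_sqrt2" "algebraic_int x" by auto
  obtain a0 b0 where ab0: "b0 \<noteq> 0" "x * er b0 = er a0" using rational_er_quotient[OF x(1)] .
  define g where "g = gcd a0 b0"
  have g0: "g \<noteq> 0" using ab0 by (simp add: g_def)
  obtain a b where ab: "a0 = a * g" "b0 = b * g" "coprime a b"
    using gcd_coprime_exists[of a0 b0] g0 unfolding g_def by blast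
  have b0: "b \<noteq> 0" using ab ab0 by auto
  have xb: "x * er b = er a" using ab0(2) g0 by (simp add: ab mult.assoc[symmetric])
  obtain p where p: "lead_coeff p = 1" "\<And>i. coeff p i \<in> \<int>" "poly p x = 0"
    using x(2) by (auto elim: algebraic_int.cases)
  define n where "n = degree p"
  have "\<forall>i. \<exists>k. coeff p i = of_int k" using p(2) by (blast elim: Ints_cases)
  then obtain c where c: "\<And>i. coeff p i = of_int (c i)" using choice[of "\<lambda>i k. coeff p i = of_int k"] by blast
  have "(\<Sum>i\<le>n. of_int (c i) * x ^ i) * er b ^ n = 0"
    using p(3) by (simp add: poly_altdef n_def c)
  then have "(\<Sum>i\<le>n. of_int (c i) * x ^ i * er b ^ n) = 0" by (simp add: sum_distrib_right)
  moreover have "of_int (c i) * x ^ i * er b ^ n = er (of_int (c i) * a ^ i * b ^ (n - i))" if "i \<le> n" for i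
  proof -
    have "x ^ i * er b ^ n = (x * er b) ^ i * er b ^ (n - i)"
      using that by (simp add: power_mult_distrib mult.assoc flip: power_add)
    then show ?thesis by (simp add: xb er_power mult.assoc)
  qed
  ultimately have "(\<Sum>i\<le>n. er (of_int (c i) * a ^ i * b ^ (n - i))) = 0" by simp
  then have "(\<Sum>i\<le>n. of_int (c i) * a ^ i * b ^ (n - i)) = 0" by (simp only: er_sum[symmetric] er_eq_0)
  moreover have "c n = 1" using p(1) c[of n] by (simp add: n_def)
  ultimately have "a ^ n + (\<Sum>i<n. of_int (c i) * a ^ i * b ^ (n - i)) = 0"
    by (simp add: lessThan_Suc_atMost[symmetric] add.commute)
  then have "a ^ n = - (\<Sum>i<n. of_int (c i) * a ^ i * b ^ (n - i))" by (simp add: eq_neg_iff_add_eq_0)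
  moreover have "b dvd (\<Sum>i<n. of_int (c i) * a ^ i * b ^ (n - i))"
    by (intro dvd_sum dvd_mult dvd_power) auto
  ultimately have "b dvd a ^ n" by simp
  moreover have "coprime (a ^ n) b" using ab(3) by simp
  ultimately have "is_unit b" by (metis coprime_common_divisor dvd_refl)
  then obtain d where d: "1 = b * d" by (rule dvdE)
  have "x = x * er (b * d)" using d by (metis er_simps(2) mult_1_right)
  also have "\<dots> = er (a * d)" using xb by (simp add: mult.assoc[symmetric])
  finally show "x \<in> range er" by blast
qed

lemma ring_of_integers_Q_sqrt2:
  "ring_of_integers Q_sqrt2 = \<lparr>carrier = range er, monoid.mult = (*), one = 1, zero = 0, add = (+)\<rparr>"
  by (simp add: ring_of_integers_def integers_of_Q_sqrt2)

lemma ring_range_er: "ring \<lparr>carrier = range er, monoid.mult = (*), one = 1, zero = 0, add = (+)\<rparr>"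
proof (intro ringI abelian_groupI monoidI)
  let ?R = "\<lparr>carrier = range er, monoid.mult = (*), one = 1, zero = 0, add = (+)\<rparr>"
  show "\<zero>\<^bsub>?R\<^esub> \<in> carrier ?R" by (simp add: range_eqI[of _ _ 0])
  show "\<one>\<^bsub>?R\<^esub> \<in> carrier ?R" by (simp add: range_eqI[of _ _ 1])
  fix x y assume "x \<in> carrier ?R" "y \<in> carrier ?R"
  then obtain a b where ab: "x = er a" "y = er b" by auto
  show "x \<oplus>\<^bsub>?R\<^esub> y \<in> carrier ?R" using range_eqI[of _ er "a + b"] by (simp add: ab)
  show "x \<otimes>\<^bsub>?R\<^esub> y \<in> carrier ?R" using range_eqI[of _ er "a * b"] by (simp add: ab)
next
  let ?R = "\<lparr>carrier = range er, monoid.mult = (*), one = 1, zero = 0, add = (+)\<rparr>"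
  fix x assume "x \<in> carrier ?R"
  then obtain a where a: "x = er a" by auto
  show "\<exists>y\<in>carrier ?R. y \<oplus>\<^bsub>?R\<^esub> x = \<zero>\<^bsub>?R\<^esub>"
  proof (rule bexI[of _ "er (- a)"])
    show "er (- a) \<in> carrier ?R" by (simp del: er_simps(5))
  qed (simp add: a)
qed (auto simp: algebra_simps)

definition zreps :: "zs set" where "zreps = {d. d \<noteq> 0 \<and> normalize d = d}"

lemma zs_ideal_principal:
  assumes "add_closed J" "\<And>a x. x \<in> J \<Longrightarrow> a * x \<in> J" "J \<noteq> {0}"
  obtains d where "d \<in> zreps" "J = oid d"
proof -
  obtain x0 where "x0 \<in> J" "x0 \<noteq> 0" using add_closedD(1)[OF assms(1)] assms(3) by blast
  then obtain b where b: "b \<in> J" "b \<noteq> 0" "\<And>y. y \<in> J \<Longrightarrow> y \<noteq> 0 \<Longrightarrow> euclidean_size b \<le> euclidean_size y"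
    using ex_has_least_nat[of "\<lambda>x. x \<in> J \<and> x \<noteq> 0" x0 euclidean_size] by blast
  have "b dvd a" if "a \<in> J" for a
  proof -
    have "a mod b = a - (a div b) * b" by (simp add: modulo_zs_def)
    then have "a mod b \<in> J" using add_closedD(2)[OF assms(1) that assms(2)[OF b(1), of "a div b"]] by simp
    then have "a mod b = 0" using b(3)[of "a mod b"] mod_size_less[OF b(2), of a] by fastforce
    then show ?thesis by (rule mod_0_imp_dvd)
  qed
  moreover have "a \<in> J" if "b dvd a" for a using that assms(2)[OF b(1)] by (auto elim!: dvdE simp: mult.commute)
  ultimately have "J = oid (normalize b)" by (auto simp: oid_mem)
  moreover have "normalize b \<in> zreps" using b by (simp add: zreps_def)
  ultimately show thesis using that by blast
qed

lemma nonzero_ideals_eq: "nonzero_ideals Q_sqrt2 = (\<lambda>d. er ` oid d) ` zreps"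
proof -
  let ?R = "\<lparr>carrier = range er, monoid.mult = (*), one = 1, zero = 0, add = (+)\<rparr>"
  have C: "add_closed (range er)" by (rule add_closed_rangeI) simp
  note iff = additive_subgroup_iff[OF C]
  show ?thesis
  proof (intro equalityI subsetI)
    fix I assume "I \<in> nonzero_ideals Q_sqrt2"
    then have id: "ideal I ?R" and I0: "I \<noteq> {0}" by (auto simp: nonzero_ideals_def ring_of_integers_Q_sqrt2)
    have I: "I \<subseteq> range er" "add_closed I"
      using ideal.axioms(1)[OF id] unfolding iff by auto
    have mult: "er a * x \<in> I" if "x \<in> I" for a x
      using ideal.I_l_closed[OF id that, of "er a"] by simp
    have "add_closed (er -` I)" by (rule add_closed_vimage[OF _ I(2)]) simp
    moreover have "a * x \<in> er -` I" if "x \<in> er -` I" for a x using that mult by simp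
    moreover have "er -` I \<noteq> {0}"
    proof
      assume "er -` I = {0}"
      moreover have "I = er ` (er -` I)" using I(1) by blast
      ultimately have "I = {0}" by simp
      then show False using I0 by simp
    qed
    ultimately obtain d where "d \<in> zreps" "er -` I = oid d" by (rule zs_ideal_principal)
    then show "I \<in> (\<lambda>d. er ` oid d) ` zreps" using I(1) by blast
  next
    fix I assume "I \<in> (\<lambda>d. er ` oid d) ` zreps"
    then obtain d where d: "d \<in> zreps" "I = er ` oid d" by blast
    have mult: "er a * x \<in> I" "x * er a \<in> I" if "x \<in> I" for a x
    proof -
      obtain y where y: "x = er y" "d dvd y" using \<open>x \<in> I\<close> d by (auto simp: oid_mem)
      then have "er (a * y) \<in> I" unfolding d by (intro imageI) (simp add: oid_mem)
      then show "er a * x \<in> I" "x * er a \<in> I" using y by (simp_all add: mult.commute)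
    qed
    have "ideal I ?R"
    proof (intro ideal.intro ideal_axioms.intro ring_range_er)
      show "additive_subgroup I ?R" unfolding iff using d by (auto intro!: add_closed_image)
    qed (use mult in auto)
    moreover have "I \<noteq> {0}"
    proof
      assume "I = {0}"
      moreover have "er d \<in> I" unfolding d by (intro imageI) (simp add: oid_mem)
      ultimately show False using d by (simp add: zreps_def)
    qed
    ultimately show "I \<in> nonzero_ideals Q_sqrt2" by (simp add: nonzero_ideals_def ring_of_integers_Q_sqrt2)
  qed
qed

lemma inj_er: "inj er"
  by (rule injI) simp

lemma inj_on_ideals: "inj_on (\<lambda>d. er ` oid d) zreps"
proof (rule inj_onI)
  fix d d' assume d: "d \<in> zreps" "d' \<in> zreps" "er ` oid d = er ` oid d'"
  then have "oid d = oid d'" by (simp only: inj_image_eq_iff[OF inj_er])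
  then have "d dvd d'" "d' dvd d" using oid_mem[of d d] oid_mem[of d d'] oid_mem[of d' d'] oid_mem[of d' d] by auto
  then show "d = d'" using d by (metis (mono_tags, lifting) associatedI mem_Collect_eq zreps_def)
qed

lemma ideal_norm_eq: assumes "d \<noteq> 0" shows "ideal_norm Q_sqrt2 (er ` oid d) = nat \<bar>Nm d\<bar>"
proof -
  have "add_index (er ` UNIV) (er ` oid d) = add_index UNIV (oid d)"
    by (rule add_index_image[OF inj_er]) auto
  then show ?thesis using oid_index[OF assms] by (simp add: ideal_norm_def ring_of_integers_Q_sqrt2)
qed

section \<open>Dirichlet series\<close>

definition npow :: "complex \<Rightarrow> nat \<Rightarrow> complex" where "npow s n = of_nat n powr (- s)"

definition dterm :: "(nat \<Rightarrow> nat) \<Rightarrow> complex \<Rightarrow> nat \<Rightarrow> complex" where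
  "dterm f s n = of_nat (f n) * npow s n"

definition dabs :: "(nat \<Rightarrow> nat) \<Rightarrow> complex \<Rightarrow> bool" where
  "dabs f s \<longleftrightarrow> (\<lambda>n. norm (dterm f s n)) summable_on {1..}"

definition dser :: "(nat \<Rightarrow> nat) \<Rightarrow> complex \<Rightarrow> complex" where
  "dser f s = infsum (dterm f s) {1..}"

lemma npow_mult: "npow s (m * n) = npow s m * npow s n"
  unfolding npow_def of_nat_mult by (rule powr_times_real) auto

lemma npow_square: "npow s (n\<^sup>2) = npow (2 * s) n"
proof -
  have "npow s (n\<^sup>2) = npow s n * npow s n" by (simp add: power2_eq_square npow_mult)
  also have "\<dots> = npow (2 * s) n" by (simp add: npow_def powr_add[symmetric])
  finally show ?thesis .
qed

lemma norm_npow: "norm (npow s n) = real n powr (- Re s)"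
  by (simp add: npow_def norm_powr_real_powr)

lemma npow_shift: assumes "n \<ge> 1" shows "of_nat n * npow s n = npow (s - 1) n"
proof -
  have "npow (s - 1) n = of_nat n powr (1 + (- s))" by (simp add: npow_def)
  also have "\<dots> = of_nat n * npow s n" unfolding powr_add using assms by (simp add: npow_def)
  finally show ?thesis by simp
qed

lemma summable_of_norm: "(\<lambda>x. norm (f x :: complex)) summable_on A \<Longrightarrow> f summable_on A"
  by (rule Infinite_Sum.abs_summable_summable)

text \<open>A series over ideals is grouped by the norm \<open>w\<close>. The equivalence is used in
  both directions: from ideals to coefficients for the Dedekind zeta function, and from coefficients
  to left ideals for the cubian ring.\<close>

lemma fibre_sum:
  fixes w :: "'a \<Rightarrow> nat" and h :: "nat \<Rightarrow> complex"
  assumes fin: "\<And>n. n \<ge> 1 \<Longrightarrow> finite {x \<in> X. w x = n}" and pos: "\<And>x. x \<in> X \<Longrightarrow> w x \<ge> 1"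
  shows "(\<lambda>x. norm (h (w x))) summable_on X \<longleftrightarrow>
      (\<lambda>n. norm (of_nat (card {x \<in> X. w x = n}) * h n)) summable_on {1..}" (is "?L \<longleftrightarrow> ?R")
    and "(\<lambda>x. norm (h (w x))) summable_on X \<Longrightarrow>
      infsum (\<lambda>x. h (w x)) X = infsum (\<lambda>n. of_nat (card {x \<in> X. w x = n}) * h n) {1..}"
proof -
  let ?B = "\<lambda>n. {x \<in> X. w x = n}" and ?S = "SIGMA n:{1..}. {x \<in> X. w x = n}"
  let ?f = "\<lambda>(n, x). h n"
  have bij: "bij_betw snd ?S X"
    by (rule bij_betwI[where g = "\<lambda>x. (w x, x)"]) (use pos in auto)
  have "?L \<longleftrightarrow> (\<lambda>z. norm (h (w (snd z)))) summable_on ?S"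
    by (rule summable_on_reindex_bij_betw[OF bij, symmetric])
  also have "\<dots> \<longleftrightarrow> (\<lambda>z. norm (?f z)) summable_on ?S"
    by (rule summable_on_cong) auto
  finally have L: "?L \<longleftrightarrow> (\<lambda>z. norm (?f z)) summable_on ?S" .
  also have "\<dots> \<longleftrightarrow> (\<forall>n\<in>{1..}. (\<lambda>x. norm (?f (n, x))) summable_on ?B n) \<and>
      (\<lambda>n. norm (infsum (\<lambda>x. norm (?f (n, x))) (?B n))) summable_on {1..}"
    by (rule Infinite_Sum.abs_summable_on_Sigma_iff)
  also have "\<dots> \<longleftrightarrow> (\<lambda>n. norm (infsum (\<lambda>x. norm (?f (n, x))) (?B n))) summable_on {1..}"
    using fin by auto
  also have "\<dots> \<longleftrightarrow> ?R"
  proof (rule summable_on_cong)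
    fix n :: nat assume "n \<in> {1..}"
    then have "finite (?B n)" using fin by simp
    then show "norm (infsum (\<lambda>x. norm (?f (n, x))) (?B n)) = norm (of_nat (card (?B n)) * h n)"
      by (simp add: norm_mult)
  qed
  finally show "?L \<longleftrightarrow> ?R" .
  assume "?L"
  then have S: "?f summable_on ?S" unfolding L by (rule summable_of_norm)
  have "infsum (\<lambda>x. h (w x)) X = infsum (\<lambda>z. h (w (snd z))) ?S"
    by (rule infsum_reindex_bij_betw[OF bij, symmetric])
  also have "\<dots> = infsum ?f ?S" by (rule infsum_cong) auto
  also have "\<dots> = infsum (\<lambda>n. infsum (\<lambda>x. ?f (n, x)) (?B n)) {1..}"
    by (rule infsum_Sigma_banach[OF S, symmetric])
  also have "\<dots> = infsum (\<lambda>n. of_nat (card (?B n)) * h n) {1..}"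
  proof (rule infsum_cong)
    fix n :: nat assume "n \<in> {1..}"
    then have "finite (?B n)" using fin by simp
    then show "infsum (\<lambda>x. ?f (n, x)) (?B n) = of_nat (card (?B n)) * h n" by simp
  qed
  finally show "infsum (\<lambda>x. h (w x)) X = infsum (\<lambda>n. of_nat (card (?B n)) * h n) {1..}" .
qed

text \<open>The double series over pairs \<open>(a, b)\<close> converges absolutely and is regrouped
  along \<open>n = a * b\<close>, with \<open>(n, a)\<close> standing for the pair
  \<open>(a, n div a)\<close>.\<close>

lemma dirichlet_product:
  assumes f: "dabs f s" and g: "dabs g s"
  shows "dabs (dconv f g) s" "dser (dconv f g) s = dser f s * dser g s"
proof -
  let ?P = "{1..} \<times> {1..} :: (nat \<times> nat) set"
  let ?F = "\<lambda>(a, b). dterm f s a * dterm g s b"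
  let ?S = "SIGMA n:{1..}. {a. a dvd (n::nat)}" and ?G = "\<lambda>(n, a). dterm f s a * dterm g s (n div a)"
  have "(\<lambda>z. norm (?F z)) summable_on ?P"
    unfolding Infinite_Sum.abs_summable_on_Sigma_iff
  proof (intro conjI ballI)
    show "(\<lambda>b. norm (?F (a, b))) summable_on {1..}" for a
      using summable_on_cmult_right[OF g[unfolded dabs_def], of "norm (dterm f s a)"] by (simp add: norm_mult)
    have "infsum (\<lambda>b. norm (?F (a, b))) {1..} = norm (dterm f s a) * infsum (\<lambda>b. norm (dterm g s b)) {1..}" for a
      by (simp add: norm_mult infsum_cmult_right')
    then have "(\<lambda>a. infsum (\<lambda>b. norm (?F (a, b))) {1..}) summable_on {1..}"
      using summable_on_cmult_left[OF f[unfolded dabs_def]] by simp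
    then show "(\<lambda>a. norm (infsum (\<lambda>b. norm (?F (a, b))) {1..})) summable_on {1..}"
      by (rule summable_on_iff_abs_summable_on_real[THEN iffD1])
  qed
  then have P: "(\<lambda>z. norm (?F z)) summable_on ?P" .
  have "dser f s * dser g s = infsum (\<lambda>a. infsum (\<lambda>b. ?F (a, b)) {1..}) {1..}"
    by (simp add: dser_def infsum_cmult_right' infsum_cmult_left')
  also have "\<dots> = infsum ?F ?P" by (rule infsum_Sigma_banach[OF summable_of_norm[OF P]])
  finally have prod: "dser f s * dser g s = infsum ?F ?P" .
  have bij: "bij_betw (\<lambda>(n, a). (a, n div a)) ?S ?P"
  proof (rule bij_betwI[where g = "\<lambda>(a, b). (a * b, a)"])
    show "(\<lambda>(n, a). (a, n div a)) \<in> ?S \<rightarrow> ?P"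
    proof (intro funcsetI)
      fix z assume "z \<in> ?S"
      then obtain n a where z: "z = (n, a)" "n \<ge> 1" "a dvd n" by auto
      then have "a \<noteq> 0" "n div a > 0" using div_pos_of_dvd[of a n] by auto
      then show "(case z of (n, a) \<Rightarrow> (a, n div a)) \<in> ?P" using z by simp
    qed
    show "(\<lambda>(a, b). (a * b, a)) \<in> ?P \<rightarrow> ?S" by auto
  qed auto
  have S: "(\<lambda>z. norm (?G z)) summable_on ?S"
  proof -
    have "(\<lambda>z. norm (?F (case z of (n, a) \<Rightarrow> (a, n div a)))) summable_on ?S"
      using P summable_on_reindex_bij_betw[OF bij, of "\<lambda>z. norm (?F z)"] by blast
    moreover have "(\<lambda>z. norm (?F (case z of (n, a) \<Rightarrow> (a, n div a)))) summable_on ?S \<longleftrightarrow>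
        (\<lambda>z. norm (?G z)) summable_on ?S"
      by (rule summable_on_cong) auto
    ultimately show ?thesis by blast
  qed
  have inner: "(\<Sum>a | a dvd n. ?G (n, a)) = dterm (dconv f g) s n" if n: "n \<ge> 1" for n
  proof -
    have "(\<Sum>a | a dvd n. ?G (n, a)) = (\<Sum>a | a dvd n. of_nat (f a * g (n div a)) * npow s n)"
    proof (rule sum.cong)
      fix a assume "a \<in> {a. a dvd n}"
      then have "npow s n = npow s a * npow s (n div a)" using npow_mult[of s a "n div a"] by simp
      then show "?G (n, a) = of_nat (f a * g (n div a)) * npow s n" by (simp add: dterm_def)
    qed simp
    then show ?thesis by (simp add: dterm_def dconv_def sum_distrib_right)
  qed
  have fin: "finite {a. a dvd n}" if "n \<ge> 1" for n :: nat using that by simp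
  have "infsum ?F ?P = infsum (\<lambda>z. ?F (case z of (n, a) \<Rightarrow> (a, n div a))) ?S"
    by (rule infsum_reindex_bij_betw[OF bij, symmetric])
  also have "\<dots> = infsum ?G ?S" by (rule infsum_cong) auto
  also have "\<dots> = infsum (\<lambda>n. infsum (\<lambda>a. ?G (n, a)) {a. a dvd n}) {1..}"
    by (rule infsum_Sigma_banach[OF summable_of_norm[OF S], symmetric])
  also have "\<dots> = dser (dconv f g) s"
    unfolding dser_def
  proof (rule infsum_cong)
    fix n :: nat assume "n \<in> {1..}"
    then have n: "n \<ge> 1" by simp
    show "infsum (\<lambda>a. ?G (n, a)) {a. a dvd n} = dterm (dconv f g) s n"
      using inner[OF n] fin[OF n] by (simp only: infsum_finite)
  qed
  finally show "dser (dconv f g) s = dser f s * dser g s" using prod by simp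
  have "(\<lambda>n. norm (infsum (\<lambda>a. norm (?G (n, a))) {a. a dvd n})) summable_on {1..}"
    using S unfolding Infinite_Sum.abs_summable_on_Sigma_iff by blast
  then show "dabs (dconv f g) s"
    unfolding dabs_def
  proof (rule Infinite_Sum.abs_summable_on_comparison_test')
    fix n :: nat assume "n \<in> {1..}"
    then have n: "n \<ge> 1" by simp
    have "norm (dterm (dconv f g) s n) \<le> (\<Sum>a | a dvd n. norm (?G (n, a)))"
      unfolding inner[OF n, symmetric] by (rule norm_sum)
    also have "\<dots> \<le> norm (infsum (\<lambda>a. norm (?G (n, a))) {a. a dvd n})" using fin[OF n] by simp
    finally show "norm (dterm (dconv f g) s n) \<le> norm (infsum (\<lambda>a. norm (?G (n, a))) {a. a dvd n})" .
  qed
qed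

text \<open>Substituting \<open>n = c^2\<close> doubles the argument. This connects the count by
  index with the count by its root, and \<open>num_ideals_sq\<close> with
  \<open>num_ideals\<close>.\<close>

lemma square_supported:
  assumes "\<And>n. (\<And>c. n \<noteq> c\<^sup>2) \<Longrightarrow> f n = 0"
  shows "dabs f s \<longleftrightarrow> dabs (\<lambda>c. f (c\<^sup>2)) (2 * s)" "dser f s = dser (\<lambda>c. f (c\<^sup>2)) (2 * s)"
proof -
  let ?Q = "(\<lambda>c. c\<^sup>2) ` {1..} :: nat set"
  have sub: "?Q \<subseteq> {1..}" by (auto simp: Suc_le_eq)
  have out: "dterm f s n = 0" if n: "n \<in> {1..} - ?Q" for n
  proof -
    have "n \<noteq> c\<^sup>2" for c
    proof
      assume "n = c\<^sup>2"
      moreover from this have "c \<ge> 1" using n by (cases "c = 0") auto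
      ultimately show False using n by auto
    qed
    then show ?thesis using assms by (simp add: dterm_def)
  qed
  have inj: "inj_on (\<lambda>c. c\<^sup>2) {1::nat..}" by (auto simp: inj_on_def power2_eq_iff_nonneg)
  have e: "dterm f s (c\<^sup>2) = dterm (\<lambda>c. f (c\<^sup>2)) (2 * s) c" for c by (simp add: dterm_def npow_square)
  have "dabs f s \<longleftrightarrow> (\<lambda>n. norm (dterm f s n)) summable_on ?Q"
    unfolding dabs_def by (rule summable_on_cong_neutral) (use out sub in auto)
  also have "\<dots> \<longleftrightarrow> dabs (\<lambda>c. f (c\<^sup>2)) (2 * s)"
    unfolding dabs_def summable_on_reindex[OF inj] by (simp add: o_def e)
  finally show "dabs f s \<longleftrightarrow> dabs (\<lambda>c. f (c\<^sup>2)) (2 * s)" .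
  have "dser f s = infsum (dterm f s) ?Q"
    unfolding dser_def by (rule infsum_cong_neutral) (use out sub in auto)
  also have "\<dots> = dser (\<lambda>c. f (c\<^sup>2)) (2 * s)"
    unfolding dser_def infsum_reindex[OF inj] by (simp add: o_def e)
  finally show "dser f s = dser (\<lambda>c. f (c\<^sup>2)) (2 * s)" .
qed

subsection \<open>Convergence and non-vanishing of the Dedekind zeta function\<close>

text \<open>Multiplication by the unit 1 + sqrt 2 or by its inverse does not decrease the quadratic form
  \<open>x\<^sup>2 + 2 * y\<^sup>2\<close> of the associate on which this form is minimal; hence \<open>4 * \<bar>x * y\<bar> \<le> x\<^sup>2 + 2 * y\<^sup>2\<close>,
  and the norm is comparable with the form.\<close>
lemma reduced_associate:
  assumes "d \<noteq> 0"
  obtains e where "normalize e = normalize d"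
    "max 1 \<bar>rat_part e\<bar> * max 1 \<bar>irr_part e\<bar> \<le> \<bar>Nm e\<bar>"
proof -
  let ?q = "\<lambda>e. nat ((rat_part e)\<^sup>2 + 2 * (irr_part e)\<^sup>2)"
  obtain e where e: "normalize e = normalize d" and min: "\<And>y. normalize y = normalize d \<Longrightarrow> ?q e \<le> ?q y"
    using ex_has_least_nat[of "\<lambda>e. normalize e = normalize d" d ?q] by blast
  let ?x = "rat_part e" and ?y = "irr_part e"
  have u: "is_unit (ZS 1 1)" "is_unit (ZS (- 1) 1)" by (simp_all add: zs_is_unit_iff Nm_def)
  have "?q e \<le> ?q (ZS 1 1 * e)" "?q e \<le> ?q (ZS (- 1) 1 * e)"
    using u e by (intro min; simp add: normalize_mult_unit_left)+
  then have "?x\<^sup>2 + 2 * ?y\<^sup>2 \<le> (?x + 2 * ?y)\<^sup>2 + 2 * (?x + ?y)\<^sup>2"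
    "?x\<^sup>2 + 2 * ?y\<^sup>2 \<le> (2 * ?y - ?x)\<^sup>2 + 2 * (?x - ?y)\<^sup>2"
    by (simp_all add: algebra_simps nat_le_eq_zle)
  then have "4 * (?x * ?y) \<le> ?x\<^sup>2 + 2 * ?y\<^sup>2" "- (4 * (?x * ?y)) \<le> ?x\<^sup>2 + 2 * ?y\<^sup>2"
    by (simp_all add: power2_eq_square algebra_simps)
  then have "\<bar>4 * (?x * ?y)\<bar> \<le> ?x\<^sup>2 + 2 * ?y\<^sup>2" by linarith
  then have "\<bar>4 * (?x * ?y)\<bar>\<^sup>2 \<le> (?x\<^sup>2 + 2 * ?y\<^sup>2)\<^sup>2" by (intro power_mono) auto
  \<comment> \<open>The square of the form exceeds the square of \<open>Nm e\<close> by
    \<open>8 (x y)^2\<close>, and it is at least \<open>16 (x y)^2\<close>; the difference leaves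
    \<open>8 (x y)^2\<close> below the square of \<open>Nm e\<close>.\<close>
  then have h: "16 * (?x * ?y)\<^sup>2 \<le> (?x\<^sup>2 + 2 * ?y\<^sup>2)\<^sup>2" by (simp add: power_mult_distrib)
  have "(?x\<^sup>2 + 2 * ?y\<^sup>2)\<^sup>2 = (Nm e)\<^sup>2 + 8 * (?x * ?y)\<^sup>2"
    by (simp add: Nm_def power2_eq_square algebra_simps)
  then have "(?x * ?y)\<^sup>2 \<le> (Nm e)\<^sup>2" using h zero_le_power2[of "?x * ?y"] by linarith
  then have xy: "\<bar>?x\<bar> * \<bar>?y\<bar> \<le> \<bar>Nm e\<bar>" by (simp add: abs_le_square_iff[symmetric] abs_mult)
  have "e \<noteq> 0" using e assms by auto
  then have N1: "\<bar>Nm e\<bar> \<ge> 1" using Nm_eq_0[of e] by linarith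
  have sq: "\<bar>k\<bar> \<le> k\<^sup>2" for k :: int
  proof (cases "k = 0")
    case False
    then have "\<bar>k\<bar> * 1 \<le> \<bar>k\<bar> * \<bar>k\<bar>" by (intro mult_left_mono) auto
    then show ?thesis by (simp add: power2_eq_square)
  qed simp
  \<comment> \<open>A vanishing coordinate is treated separately, because \<open>x * y\<close> then
    says nothing about the other one. With \<open>max 1\<close> both factors stay positive for the
    powers to come.\<close>
  have "max 1 \<bar>?x\<bar> * max 1 \<bar>?y\<bar> \<le> \<bar>Nm e\<bar>"
  proof -
    consider "?x = 0" | "?y = 0" | "\<bar>?x\<bar> \<ge> 1" "\<bar>?y\<bar> \<ge> 1" by linarith
    then show ?thesis
    proof cases
      case 1
      then have "\<bar>Nm e\<bar> = 2 * ?y\<^sup>2" by (simp add: Nm_def)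
      then show ?thesis using 1 sq[of ?y] N1 by simp
    next
      case 2
      then have "\<bar>Nm e\<bar> = ?x\<^sup>2" by (simp add: Nm_def)
      then show ?thesis using 2 sq[of ?x] N1 by simp
    next
      case 3
      then show ?thesis using xy by (simp add: max_def)
    qed
  qed
  then show thesis using that e by blast
qed

lemma summable_int_powr:
  fixes \<sigma> :: real assumes "\<sigma> > 1"
  shows "(\<lambda>x::int. real_of_int (max 1 \<bar>x\<bar>) powr (- \<sigma>)) summable_on UNIV"
proof -
  let ?f = "\<lambda>x::int. real_of_int (max 1 \<bar>x\<bar>) powr (- \<sigma>)"
  have "summable (\<lambda>n. real n powr (- \<sigma>))" using assms by (simp add: summable_real_powr_iff)
  then have "summable (\<lambda>n. real (Suc n) powr (- \<sigma>))" by (subst summable_Suc_iff)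
  then have N: "(\<lambda>n. real (Suc n) powr (- \<sigma>)) summable_on UNIV"
    by (intro norm_summable_imp_summable_on) simp
  have p: "?f summable_on range (\<lambda>n. int (Suc n))"
    by (subst summable_on_reindex) (use N in \<open>auto simp: inj_on_def o_def add.commute\<close>)
  have m: "?f summable_on range (\<lambda>n. - int (Suc n))"
    by (subst summable_on_reindex) (use N in \<open>auto simp: inj_on_def o_def add.commute\<close>)
  have "?f summable_on (range (\<lambda>n. int (Suc n)) \<union> range (\<lambda>n. - int (Suc n)))"
    by (rule summable_on_Un_disjoint[OF p m]) auto
  moreover have "?f summable_on {0}" by simp
  ultimately have "?f summable_on ((range (\<lambda>n. int (Suc n)) \<union> range (\<lambda>n. - int (Suc n))) \<union> {0})"
    by (rule summable_on_Un_disjoint) auto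
  moreover have "(range (\<lambda>n. int (Suc n)) \<union> range (\<lambda>n. - int (Suc n))) \<union> {0} = UNIV"
  proof -
    have "x \<in> (range (\<lambda>n. int (Suc n)) \<union> range (\<lambda>n. - int (Suc n))) \<union> {0}" for x :: int
    proof (cases x rule: int_cases3)
      case (pos n)
      then have "x = int (Suc (n - 1))" by simp
      then show ?thesis by blast
    next
      case (neg n)
      then have "x = - int (Suc (n - 1))" by simp
      then show ?thesis by blast
    qed simp
    then show ?thesis by blast
  qed
  ultimately show ?thesis by simp
qed

text \<open>Each ideal is sent to the coordinates of a reduced generator, an injection into pairs of
  integers. The norm is at least the product of the two truncated coordinates, so the series is
  dominated by a product of two one-variable series, and these converge for
  \<open>Re s > 1\<close>.\<close>

lemma summable_zreps:
  assumes "Re s > 1"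
  shows "(\<lambda>d. norm (npow s (nat \<bar>Nm d\<bar>))) summable_on zreps"
proof -
  let ?\<sigma> = "Re s"
  let ?m = "\<lambda>x::int. real_of_int (max 1 \<bar>x\<bar>) powr (- ?\<sigma>)"
  let ?g = "\<lambda>(x, y). ?m x * ?m y"
  have "\<forall>d\<in>zreps. \<exists>e. normalize e = normalize d \<and> max 1 \<bar>rat_part e\<bar> * max 1 \<bar>irr_part e\<bar> \<le> \<bar>Nm e\<bar>"
    using reduced_associate by (metis (mono_tags, lifting) mem_Collect_eq zreps_def)
  then obtain r where r: "\<And>d. d \<in> zreps \<Longrightarrow> normalize (r d) = normalize d"
    "\<And>d. d \<in> zreps \<Longrightarrow> max 1 \<bar>rat_part (r d)\<bar> * max 1 \<bar>irr_part (r d)\<bar> \<le> \<bar>Nm (r d)\<bar>" by metis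
  let ?h = "\<lambda>d. (rat_part (r d), irr_part (r d))"
  have inj: "inj_on ?h zreps"
  proof (rule inj_onI)
    fix d d' assume d: "d \<in> zreps" "d' \<in> zreps" "?h d = ?h d'"
    then have "r d = r d'" by (simp add: zs_eq_iff)
    then have "normalize d = normalize d'" using r(1) d by metis
    then show "d = d'" using d by (simp add: zreps_def)
  qed
  note m = summable_int_powr[OF assms]
  have "(\<lambda>z. norm (?g z)) summable_on UNIV \<times> UNIV"
    unfolding Infinite_Sum.abs_summable_on_Sigma_iff
  proof (intro conjI ballI)
    show "(\<lambda>y. norm (?g (x, y))) summable_on UNIV" for x
      using summable_on_cmult_right[OF m, of "?m x"] by simp
    have "(\<Sum>\<^sub>\<infinity>y. norm (?g (x, y))) = ?m x * infsum ?m UNIV" for x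
      by (simp add: infsum_cmult_right')
    then show "(\<lambda>x. norm (\<Sum>\<^sub>\<infinity>y. norm (?g (x, y)))) summable_on UNIV"
      using summable_on_iff_abs_summable_on_real summable_on_cmult_left[OF m, of "infsum ?m UNIV"] by fastforce
  qed
  then have "?g summable_on UNIV \<times> UNIV" using summable_on_iff_abs_summable_on_real by blast
  then have "?g summable_on ?h ` zreps" by (rule summable_on_subset_banach) auto
  then have "(\<lambda>d. ?g (?h d)) summable_on zreps" using summable_on_reindex[OF inj, of ?g] by (simp add: o_def)
  then show ?thesis
  proof (rule Infinite_Sum.abs_summable_on_comparison_test')
    fix d assume d: "d \<in> zreps"
    let ?M = "max 1 \<bar>rat_part (r d)\<bar> * max 1 \<bar>irr_part (r d)\<bar>"
    have "?M \<le> \<bar>Nm d\<bar>" using r[OF d] abs_Nm_normalize by metis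
    then have "real_of_int ?M \<le> real (nat \<bar>Nm d\<bar>)" by (metis abs_ge_zero int_nat_eq of_int_le_iff of_int_of_nat_eq)
    moreover have "real_of_int ?M > 0" by (simp add: less_max_iff_disj)
    ultimately have "real (nat \<bar>Nm d\<bar>) powr (- ?\<sigma>) \<le> real_of_int ?M powr (- ?\<sigma>)"
      using assms by (intro powr_mono2') auto
    also have "\<dots> = ?g (?h d)" by (simp add: powr_mult)
    finally show "norm (npow s (nat \<bar>Nm d\<bar>)) \<le> ?g (?h d)" unfolding norm_npow .
  qed
qed

lemma zreps_fibre: "n \<ge> 1 \<Longrightarrow> {d \<in> zreps. nat \<bar>Nm d\<bar> = n} = norm_reps n"
  by (auto simp: zreps_def norm_reps_def)

lemma zreps_norm_pos: "d \<in> zreps \<Longrightarrow> nat \<bar>Nm d\<bar> \<ge> 1"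
  using Nm_eq_0[of d] unfolding zreps_def by (simp add: Suc_le_eq)

lemma dabs_num_ideals: assumes "Re s > 1" shows "dabs num_ideals s"
proof -
  have "(\<lambda>n. norm (of_nat (card {d \<in> zreps. nat \<bar>Nm d\<bar> = n}) * npow s n)) summable_on {1..}"
    using summable_zreps[OF assms] finite_norm_reps zreps_norm_pos zreps_fibre
    by (subst fibre_sum(1)[symmetric]) auto
  then show ?thesis
    unfolding dabs_def by (rule summable_on_cong[THEN iffD1, rotated]) (simp add: zreps_fibre dterm_def num_ideals_def)
qed

lemma dedekind_zeta_eq: assumes "Re s > 1" shows "dedekind_zeta Q_sqrt2 s = dser num_ideals s"
proof -
  have "dedekind_zeta Q_sqrt2 s = infsum (\<lambda>d. of_nat (ideal_norm Q_sqrt2 (er ` oid d)) powr (- s)) zreps"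
    unfolding dedekind_zeta_def nonzero_ideals_eq infsum_reindex[OF inj_on_ideals] by (simp add: o_def)
  also have "\<dots> = infsum (\<lambda>d. npow s (nat \<bar>Nm d\<bar>)) zreps"
    by (rule infsum_cong) (simp add: zreps_def ideal_norm_eq npow_def)
  also have "\<dots> = infsum (\<lambda>n. of_nat (card {d \<in> zreps. nat \<bar>Nm d\<bar> = n}) * npow s n) {1..}"
    using summable_zreps[OF assms] finite_norm_reps zreps_norm_pos zreps_fibre by (intro fibre_sum(2)) auto
  also have "\<dots> = dser num_ideals s" unfolding dser_def by (rule infsum_cong) (simp add: zreps_fibre dterm_def num_ideals_def)
  finally show ?thesis .
qed

lemma summable_nonzero_ideals:
  assumes "Re s > 1"
  shows "(\<lambda>I. of_nat (ideal_norm Q_sqrt2 I) powr (- s) :: complex) summable_on nonzero_ideals Q_sqrt2"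
proof -
  have "(\<lambda>d. npow s (nat \<bar>Nm d\<bar>)) summable_on zreps" by (rule summable_of_norm[OF summable_zreps[OF assms]])
  then have "(\<lambda>d. of_nat (ideal_norm Q_sqrt2 (er ` oid d)) powr (- s) :: complex) summable_on zreps"
    by (rule summable_on_cong[THEN iffD1, rotated]) (simp add: zreps_def ideal_norm_eq npow_def)
  then show ?thesis unfolding nonzero_ideals_eq summable_on_reindex[OF inj_on_ideals] by (simp add: o_def)
qed

text \<open>The term for 2 is 1/4, and the later ones telescope to at most 1/2. What matters is a
  bound below 1.\<close>

lemma sum_inverse_squares_le:
  assumes "finite A" "A \<subseteq> {2..}" shows "(\<Sum>n\<in>A. 1 / (real n)\<^sup>2) \<le> 3/4"
proof -
  have *: "(\<Sum>n=2..k. 1 / (real n)\<^sup>2) \<le> 3/4 - 1 / real k" if "k \<ge> 2" for k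
    using that
  proof (induction k rule: dec_induct)
    case base
    then show ?case by simp
  next
    case (step k)
    have "1 / (real (Suc k))\<^sup>2 \<le> 1 / (real k * real (Suc k))"
      using step by (intro divide_left_mono) (auto simp: power2_eq_square)
    also have "\<dots> = 1 / real k - 1 / real (Suc k)" using step by (simp add: field_simps)
    finally have "1 / (real (Suc k))\<^sup>2 \<le> 1 / real k - 1 / real (Suc k)" .
    then show ?case using step by (simp del: of_nat_Suc)
  qed
  obtain k where k: "A \<subseteq> {..k}" using assms(1) by (meson finite_nat_iff_bounded_le)
  have "(\<Sum>n\<in>A. 1 / (real n)\<^sup>2) \<le> (\<Sum>n=2..max 2 k. 1 / (real n)\<^sup>2)"
  proof (rule sum_mono2)
    show "A \<subseteq> {2..max 2 k}"
    proof
      fix x assume "x \<in> A"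
      then have "x \<le> k" "2 \<le> x" using k assms(2) by auto
      then show "x \<in> {2..max 2 k}" by simp
    qed
  qed auto
  also have "\<dots> \<le> 3/4 - 1 / real (max 2 k)" by (rule *) simp
  also have "\<dots> \<le> 3/4" by simp
  finally show ?thesis .
qed

text \<open>The term at 1 equals 1, and the others are bounded by \<open>n^2 * n^(-4)\<close>, too
  little to cancel it. As the value is taken at \<open>4 s\<close> with \<open>Re s > 1\<close>, the
  half-plane is large enough.\<close>

lemma dser_num_ideals_nonzero: assumes "Re s > 4" shows "dser num_ideals s \<noteq> 0"
proof
  assume z: "dser num_ideals s = 0"
  have abs: "dabs num_ideals s" using assms by (intro dabs_num_ideals) simp
  have un: "{1..} = insert 1 {2::nat..}" by auto
  have "dterm num_ideals s summable_on {2..}"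
    using summable_of_norm[OF abs[unfolded dabs_def]] by (rule summable_on_subset_banach) auto
  then have "dser num_ideals s = dterm num_ideals s 1 + infsum (dterm num_ideals s) {2..}"
    unfolding dser_def un by (intro infsum_insert) auto
  then have "infsum (dterm num_ideals s) {2..} = - 1" using z by (simp add: dterm_def npow_def eq_neg_iff_add_eq_0 add.commute)
  then have "1 = norm (infsum (dterm num_ideals s) {2..})" by simp
  also have "\<dots> \<le> infsum (\<lambda>n. norm (dterm num_ideals s n)) {2..}"
    by (rule norm_infsum_bound) (rule summable_on_subset_banach[OF abs[unfolded dabs_def]], auto)
  also have "\<dots> \<le> 3/4"
  proof (rule infsum_le_finite_sums)
    show "(\<lambda>n. norm (dterm num_ideals s n)) summable_on {2..}"
      by (rule summable_on_subset_banach[OF abs[unfolded dabs_def]]) auto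
    fix A assume A: "finite A" "A \<subseteq> {2::nat..}"
    have "(\<Sum>n\<in>A. norm (dterm num_ideals s n)) \<le> (\<Sum>n\<in>A. 1 / (real n)\<^sup>2)"
    proof (rule sum_mono)
      fix n assume "n \<in> A"
      then have n: "real n \<ge> 2" "n > 0" using A by (auto dest: subsetD)
      have "norm (dterm num_ideals s n) = real (num_ideals n) * real n powr (- Re s)" by (simp add: dterm_def norm_mult norm_npow)
      also have "\<dots> \<le> (real n)\<^sup>2 * real n powr (- 4)"
      proof (rule mult_mono)
        show "real (num_ideals n) \<le> (real n)\<^sup>2" using num_ideals_le[OF n(2)] by (metis of_nat_le_iff of_nat_power)
        show "real n powr (- Re s) \<le> real n powr (- 4)" using n assms by (intro powr_mono) auto
      qed auto
      also have "\<dots> = 1 / (real n)\<^sup>2" using n by (simp add: powr_minus field_simps power2_eq_square powr_numeral power4_eq_xxxx)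
      finally show "norm (dterm num_ideals s n) \<le> 1 / (real n)\<^sup>2" .
    qed
    then show "(\<Sum>n\<in>A. norm (dterm num_ideals s n)) \<le> 3/4" using sum_inverse_squares_le[OF A] by linarith
  qed
  finally show False by simp
qed

subsection \<open>The zeta function of the cubian ring\<close>

lemma dser_cong: assumes "\<And>n. n \<ge> 1 \<Longrightarrow> f n = g n" shows "dser f s = dser g s" "dabs f s = dabs g s"
  unfolding dser_def dabs_def
  using assms by (auto intro!: infsum_cong summable_on_cong simp: dterm_def)

lemma dser_weighted: "dser (\<lambda>a. a * num_ideals a) s = dser num_ideals (s - 1)" "dabs (\<lambda>a. a * num_ideals a) s = dabs num_ideals (s - 1)"
proof -
  have "dterm (\<lambda>a. a * num_ideals a) s n = dterm num_ideals (s - 1) n" if "n \<ge> 1" for n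
    unfolding dterm_def npow_shift[OF that, symmetric] by simp
  then show "dser (\<lambda>a. a * num_ideals a) s = dser num_ideals (s - 1)" "dabs (\<lambda>a. a * num_ideals a) s = dabs num_ideals (s - 1)"
    unfolding dser_def dabs_def by (auto intro!: infsum_cong summable_on_cong)
qed

text \<open>The weight \<open>a\<close> in the convolution shifts the argument by 1; the shifted
  factor at \<open>2 * s - 1\<close> is the one that asks for \<open>Re s > 1\<close>.\<close>

lemma dser_num_lideals:
  assumes "Re s > 1"
  shows "dabs num_lideals (2 * s)" "dser num_lideals (2 * s) = dser num_ideals (2 * s) * dser num_ideals (2 * s - 1)"
proof -
  have a: "dabs (\<lambda>a. a * num_ideals a) (2 * s)" unfolding dser_weighted(2) using assms by (intro dabs_num_ideals) simp
  have b: "dabs num_ideals (2 * s)" using assms by (intro dabs_num_ideals) simp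
  have e: "num_lideals n = dconv (\<lambda>a. a * num_ideals a) num_ideals n" if "n \<ge> 1" for n using num_lideals_eq[of n] that by simp
  show "dabs num_lideals (2 * s)" using dirichlet_product(1)[OF a b] dser_cong(2)[OF e] by simp
  show "dser num_lideals (2 * s) = dser num_ideals (2 * s) * dser num_ideals (2 * s - 1)"
    using dirichlet_product(2)[OF a b] dser_cong(1)[OF e] by (simp add: dser_weighted(1) mult.commute)
qed

text \<open>Absolute convergence comes from the identity itself: \<open>num_SSM n\<close> is the
  term for the divisor 1 in a convolution of non-negative numbers that equals
  \<open>dconv num_lideals num_lideals n\<close>.\<close>

lemma dser_num_SSM:
  assumes "Re s > 1"
  shows "dabs num_SSM (2 * s)" "dser num_ideals (4 * s) * dser num_SSM (2 * s) = (dser num_lideals (2 * s))\<^sup>2"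
proof -
  note A = dser_num_lideals(1)[OF assms]
  have AA: "dabs (dconv num_lideals num_lideals) (2 * s)" by (rule dirichlet_product(1)[OF A A])
  show dF: "dabs num_SSM (2 * s)"
    unfolding dabs_def
  proof (rule Infinite_Sum.abs_summable_on_comparison_test'[OF AA[unfolded dabs_def]])
    fix n :: nat assume "n \<in> {1..}"
    then have n: "n > 0" by simp
    have "num_ideals_sq 1 * num_SSM (n div 1) \<le> dconv num_ideals_sq num_SSM n"
      unfolding dconv_def by (rule member_le_sum) (use n in auto)
    then have "num_SSM n \<le> dconv num_lideals num_lideals n" using dconv_num_SSM[OF n] multiplicativeD(1)[OF multiplicative_num_ideals_sq] by simp
    then show "norm (dterm num_SSM (2 * s) n) \<le> norm (dterm (dconv num_lideals num_lideals) (2 * s) n)"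
      by (simp add: dterm_def norm_mult mult_right_mono)
  qed
  have sq: "dabs num_ideals_sq (2 * s) \<longleftrightarrow> dabs num_ideals (4 * s)" "dser num_ideals_sq (2 * s) = dser num_ideals (4 * s)"
    using square_supported[of num_ideals_sq "2 * s", OF num_ideals_sq_nonsquare] by simp_all
  have Zs: "dabs num_ideals_sq (2 * s)" unfolding sq(1) using assms by (intro dabs_num_ideals) simp
  have "dser (dconv num_ideals_sq num_SSM) (2 * s) = dser (dconv num_lideals num_lideals) (2 * s)"
    by (rule dser_cong) (simp add: dconv_num_SSM)
  then show "dser num_ideals (4 * s) * dser num_SSM (2 * s) = (dser num_lideals (2 * s))\<^sup>2"
    by (simp add: dirichlet_product(2)[OF Zs dF] dirichlet_product(2)[OF A A] sq power2_eq_square)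
qed

lemma cubian_zeta_eq:
  assumes "Re s > 1"
  shows "(\<lambda>I. of_nat (add_index cubian I) powr (- s) :: complex) summable_on cubian_left_ideals"
    "cubian_zeta s = dser num_lideals (2 * s)"
proof -
  \<comment> \<open>The root of the index depends on \<open>I\<close> alone, so ideals can be
    grouped by it without choosing generators.\<close>
  define w where "w I = (THE m. add_index UNIV I = m\<^sup>2)" for I :: "kq set"
  have w: "w (lid x) = qn x" if "x \<noteq> 0" for x
    unfolding w_def lid_index[OF that] by (rule the_equality) (auto simp: power2_eq_iff_nonneg)
  have inj: "inj_on (\<lambda>I. emb ` I) lideals" by (rule inj_onI) (simp only: inj_image_eq_iff[OF inj_emb])
  have idx: "of_nat (add_index cubian (emb ` I)) powr (- s) = npow (2 * s) (w I)" if I: "I \<in> lideals" for I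
  proof -
    obtain x where x: "I = lid x" "x \<noteq> 0" using I by (auto simp: lideals_def)
    have "add_index (emb ` UNIV) (emb ` I) = add_index UNIV I"
      unfolding x by (rule add_index_image[OF inj_emb]) auto
    then have "add_index cubian (emb ` I) = (w I)\<^sup>2" using lid_index[OF x(2)] w[OF x(2)] by (simp add: range_emb x)
    then show ?thesis using npow_square[of s "w I"] by (simp add: npow_def)
  qed
  have fib: "{I \<in> lideals. w I = n} = lideals_of_norm n" for n
    using w by (auto simp: lideals_def lideals_of_norm_def)
  have fin: "finite {I \<in> lideals. w I = n}" if "n \<ge> 1" for n
    unfolding fib lideals_of_norm_def using finite_lids_of_norm that by simp
  have pos: "w I \<ge> 1" if "I \<in> lideals" for I using that w qn_pos by (force simp: lideals_def Suc_le_eq)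
  have fs: "(\<lambda>I. norm (npow (2 * s) (w I))) summable_on lideals \<longleftrightarrow>
      (\<lambda>n. norm (of_nat (card {I \<in> lideals. w I = n}) * npow (2 * s) n)) summable_on {1..}"
    by (rule fibre_sum(1)[OF fin pos])
  have card: "of_nat (card {I \<in> lideals. w I = n}) * npow (2 * s) n = dterm num_lideals (2 * s) n" for n
    unfolding fib dterm_def num_lideals_def lideals_of_norm_def ..
  have sm: "(\<lambda>I. norm (npow (2 * s) (w I))) summable_on lideals"
    using fs dser_num_lideals(1)[OF assms] unfolding card dabs_def by blast
  have "(\<lambda>I. npow (2 * s) (w I)) summable_on lideals" by (rule summable_of_norm[OF sm])
  then have "(\<lambda>I. of_nat (add_index cubian (emb ` I)) powr (- s) :: complex) summable_on lideals"
    by (rule summable_on_cong[THEN iffD1, rotated]) (simp add: idx)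
  then show "(\<lambda>I. of_nat (add_index cubian I) powr (- s) :: complex) summable_on cubian_left_ideals"
    unfolding cubian_left_ideals_eq summable_on_reindex[OF inj] by (simp add: o_def)
  have "cubian_zeta s = infsum (\<lambda>I. of_nat (add_index cubian (emb ` I)) powr (- s)) lideals"
    unfolding cubian_zeta_def cubian_left_ideals_eq infsum_reindex[OF inj] by (simp add: o_def)
  also have "\<dots> = infsum (\<lambda>I. npow (2 * s) (w I)) lideals" by (rule infsum_cong) (rule idx)
  also have "\<dots> = infsum (\<lambda>n. of_nat (card {I \<in> lideals. w I = n}) * npow (2 * s) n) {1..}"
    by (rule fibre_sum(2)[OF fin pos sm])
  also have "\<dots> = dser num_lideals (2 * s)" unfolding card dser_def ..
  finally show "cubian_zeta s = dser num_lideals (2 * s)" .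
qed

section \<open>Series and indices of similarity submodules\<close>

lemma SSM_series_eq:
  assumes "Re s > 1"
  shows "(\<lambda>m. of_nat (SSM_count cubian m) * of_nat m powr (- s) :: complex) summable_on {1..}"
    "SSM_series cubian s = dser num_SSM (2 * s)"
proof -
  have sq: "dabs (SSM_count cubian) s \<longleftrightarrow> dabs num_SSM (2 * s)" "dser (SSM_count cubian) s = dser num_SSM (2 * s)"
    using square_supported[of "SSM_count cubian" s, OF SSM_count_nonsquare(1)] by (simp_all add: SSM_count_square)
  have "dterm (SSM_count cubian) s summable_on {1..}"
    using sq(1) dser_num_SSM(1)[OF assms] summable_of_norm unfolding dabs_def by blast
  then show "(\<lambda>m. of_nat (SSM_count cubian m) * of_nat m powr (- s) :: complex) summable_on {1..}"
    by (simp add: dterm_def[abs_def] npow_def)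
  show "SSM_series cubian s = dser num_SSM (2 * s)"
    unfolding sq(2)[symmetric] by (simp add: SSM_series_def dser_def dterm_def[abs_def] npow_def)
qed

lemma SSM_indices:
  "{add_index cubian M | M. is_SSM cubian M} =
    {nat (n\<^sup>2) | n :: int. n \<noteq> 0 \<and> (\<exists>x y :: int. n = x\<^sup>2 - 2 * y\<^sup>2)}"
proof (intro equalityI subsetI)
  fix k assume "k \<in> {add_index cubian M | M. is_SSM cubian M}"
  then obtain P Q where PQ: "P \<noteq> 0" "Q \<noteq> 0" "k = add_index cubian (emb ` sandwich P Q)"
    by (auto simp: is_SSM_cubian_iff)
  define z where "z = nr P * nr Q"
  have "k = (qn P * qn Q)\<^sup>2" using SSM_index PQ by simp
  also have "qn P * qn Q = nat (Nm z)"
    using Nm_nr_nonneg by (simp add: z_def Nm_mult nat_mult_distrib)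
  finally have "k = nat ((Nm z)\<^sup>2)" using Nm_nr_nonneg by (simp add: nat_power_eq z_def Nm_mult)
  moreover have "Nm z \<noteq> 0" using PQ by (simp add: z_def)
  moreover have "Nm z = (rat_part z)\<^sup>2 - 2 * (irr_part z)\<^sup>2" by (simp add: Nm_def)
  ultimately show "k \<in> {nat (n\<^sup>2) | n :: int. n \<noteq> 0 \<and> (\<exists>x y :: int. n = x\<^sup>2 - 2 * y\<^sup>2)}" by blast
next
  fix k assume "k \<in> {nat (n\<^sup>2) | n :: int. n \<noteq> 0 \<and> (\<exists>x y :: int. n = x\<^sup>2 - 2 * y\<^sup>2)}"
  then obtain n x y where n: "k = nat (n\<^sup>2)" "n \<noteq> 0" "n = x\<^sup>2 - 2 * y\<^sup>2" by blast
  define z where "z = ZS x y"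
  have Nz: "Nm z = n" by (simp add: z_def Nm_def n)
  then have z0: "z \<noteq> 0" using n by auto
  \<comment> \<open>The divisor 1 contributes to \<open>sigma z\<close>, so some left ideal has
    reduced norm \<open>z\<close> up to a unit. This works for either sign of \<open>n\<close>, as
    only \<open>n^2\<close> enters the index.\<close>
  have "1 \<in> divs z" by (simp add: divs_def)
  then have "sigma z > 0"
    unfolding sigma_def using finite_divs[OF z0] by (intro sum_pos2[of _ 1]) auto
  then have "lids z \<noteq> {}" using card_lids[OF z0] by auto
  then obtain P where P: "normalize (nr P) = normalize z" by (auto simp: lids_def)
  have "Nm (nr P) = \<bar>n\<bar>" using P Nz Nm_nr_nonneg[of P] by (metis abs_Nm_normalize abs_of_nonneg)
  moreover have P0: "P \<noteq> 0" using P z0 by auto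
  ultimately have "add_index cubian (emb ` sandwich P 1) = k"
    using SSM_index[of P 1] n by (simp add: nat_power_eq[symmetric])
  moreover have "is_SSM cubian (emb ` sandwich P 1)" unfolding is_SSM_cubian_iff
    using P0 by (intro exI[of _ P] exI[of _ 1]) simp
  ultimately show "k \<in> {add_index cubian M | M. is_SSM cubian M}" by blast
qed

lemma SSM_count_small_zero:
  assumes "m \<in> {1..625} - {1, 4, 16, 49, 64, 81, 196, 256, 289, 324, 529, 625}"
  shows "SSM_count cubian m = 0"
proof (cases "\<exists>d. m = d\<^sup>2")
  case True
  then obtain d where d: "m = d\<^sup>2" by blast
  then have "d\<^sup>2 \<le> 25\<^sup>2" using assms by simp
  then have "d \<le> 25" by (rule power2_le_imp_le) simp
  moreover have "d \<noteq> 0" using d assms by (cases "d = 0") auto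
  ultimately have "d \<in> {1, 2, 3, 4, 5, 6, 7, 8, 9, 10, 11, 12, 13, 14, 15, 16, 17, 18, 19, 20, 21, 22, 23, 24, 25}"
    by simp presburger
  then have "d \<in> {3, 5, 6, 10, 11, 12, 13, 15, 19, 20, 21, 22, 24}" using assms d by auto
  then show ?thesis using num_SSM_values(13) d SSM_count_square by simp
next
  case False
  then show ?thesis by (intro SSM_count_nonsquare(1)) blast
qed

theorem theorem4:
  shows "{add_index cubian M | M. is_SSM cubian M} =
           {nat (n\<^sup>2) | n :: int. n \<noteq> 0 \<and> (\<exists>x y :: int. n = x\<^sup>2 - 2 * y\<^sup>2)} \<and>
         (\<forall>m\<ge>1. finite {M. is_SSM cubian M \<and> add_index cubian M = m}) \<and>
         multiplicative (SSM_count cubian) \<and>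
         (\<forall>s. Re s > 1 \<longrightarrow>
            (\<lambda>I. of_nat (ideal_norm Q_sqrt2 I) powr (- s) :: complex)
              summable_on nonzero_ideals Q_sqrt2) \<and>
         (\<forall>s. Re s > 1 \<longrightarrow>
            (\<lambda>I. of_nat (add_index cubian I) powr (- s) :: complex)
              summable_on cubian_left_ideals \<and>
            (\<lambda>m. of_nat (SSM_count cubian m) * of_nat m powr (- s) :: complex)
              summable_on {1..} \<and>
            dedekind_zeta Q_sqrt2 (4 * s) \<noteq> 0 \<and>
            SSM_series cubian s = (cubian_zeta s)\<^sup>2 / dedekind_zeta Q_sqrt2 (4 * s) \<and>
            SSM_series cubian s =
              (dedekind_zeta Q_sqrt2 (2 * s) * dedekind_zeta Q_sqrt2 (2 * s - 1))\<^sup>2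
                / dedekind_zeta Q_sqrt2 (4 * s)) \<and>
         SSM_count cubian 1 = 1 \<and>
         SSM_count cubian 4 = 6 \<and>
         SSM_count cubian 16 = 22 \<and>
         SSM_count cubian 49 = 32 \<and>
         SSM_count cubian 64 = 66 \<and>
         SSM_count cubian 81 = 20 \<and>
         SSM_count cubian 196 = 192 \<and>
         SSM_count cubian 256 = 178 \<and>
         SSM_count cubian 289 = 72 \<and>
         SSM_count cubian 324 = 120 \<and>
         SSM_count cubian 529 = 96 \<and>
         SSM_count cubian 625 = 52 \<and>
         (\<forall>m\<in>{1..625} - {1, 4, 16, 49, 64, 81, 196, 256, 289, 324, 529, 625}.
            SSM_count cubian m = 0)"
proof (intro conjI)
  \<comment> \<open>Finiteness shows that no count is the default value 0 that \<open>card\<close>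
    takes on infinite sets.\<close>
  show "\<forall>m\<ge>1. finite {M. is_SSM cubian M \<and> add_index cubian M = m}"
  proof (intro allI impI)
    fix m :: nat assume m: "m \<ge> 1"
    show "finite {M. is_SSM cubian M \<and> add_index cubian M = m}"
    proof (cases "\<exists>d. m = d\<^sup>2")
      case True
      then obtain d where d: "m = d\<^sup>2" by blast
      then have "d > 0" using m by (cases "d = 0") auto
      then show ?thesis unfolding d SSM_of_index using num_SSM_identity(2) by blast
    next
      case False
      then have "{M. is_SSM cubian M \<and> add_index cubian M = m} = {}" by (intro SSM_count_nonsquare(2)) blast
      then show ?thesis by (simp only: finite.emptyI)
    qed
  qed
  have "SSM_series cubian s = (cubian_zeta s)\<^sup>2 / dedekind_zeta Q_sqrt2 (4 * s) \<and>
      SSM_series cubian s = (dedekind_zeta Q_sqrt2 (2 * s) * dedekind_zeta Q_sqrt2 (2 * s - 1))\<^sup>2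
        / dedekind_zeta Q_sqrt2 (4 * s) \<and> dedekind_zeta Q_sqrt2 (4 * s) \<noteq> 0" if s: "Re s > 1" for s
  proof -
    have z: "dedekind_zeta Q_sqrt2 (4 * s) = dser num_ideals (4 * s)" "dedekind_zeta Q_sqrt2 (2 * s) = dser num_ideals (2 * s)"
      "dedekind_zeta Q_sqrt2 (2 * s - 1) = dser num_ideals (2 * s - 1)" using s by (intro dedekind_zeta_eq; simp)+
    have nz: "dser num_ideals (4 * s) \<noteq> 0" using s by (intro dser_num_ideals_nonzero) simp
    have "dser num_SSM (2 * s) = (dser num_lideals (2 * s))\<^sup>2 / dser num_ideals (4 * s)"
      using dser_num_SSM(2)[OF s] nz by (simp add: field_simps)
    then show ?thesis
      using nz unfolding z SSM_series_eq(2)[OF s] cubian_zeta_eq(2)[OF s] dser_num_lideals(2)[OF s] by simp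
  qed
  then show "\<forall>s. Re s > 1 \<longrightarrow>
            (\<lambda>I. of_nat (add_index cubian I) powr (- s) :: complex)
              summable_on cubian_left_ideals \<and>
            (\<lambda>m. of_nat (SSM_count cubian m) * of_nat m powr (- s) :: complex)
              summable_on {1..} \<and>
            dedekind_zeta Q_sqrt2 (4 * s) \<noteq> 0 \<and>
            SSM_series cubian s = (cubian_zeta s)\<^sup>2 / dedekind_zeta Q_sqrt2 (4 * s) \<and>
            SSM_series cubian s =
              (dedekind_zeta Q_sqrt2 (2 * s) * dedekind_zeta Q_sqrt2 (2 * s - 1))\<^sup>2
                / dedekind_zeta Q_sqrt2 (4 * s)"
    using cubian_zeta_eq(1) SSM_series_eq(1) by blast
  show "SSM_count cubian 1 = 1" "SSM_count cubian 4 = 6" "SSM_count cubian 16 = 22" "SSM_count cubian 49 = 32"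
    "SSM_count cubian 64 = 66" "SSM_count cubian 81 = 20" "SSM_count cubian 196 = 192"
    "SSM_count cubian 256 = 178" "SSM_count cubian 289 = 72" "SSM_count cubian 324 = 120"
    "SSM_count cubian 529 = 96" "SSM_count cubian 625 = 52"
    using SSM_count_square[of 1] SSM_count_square[of 2] SSM_count_square[of 4] SSM_count_square[of 7]
      SSM_count_square[of 8] SSM_count_square[of 9] SSM_count_square[of 14] SSM_count_square[of 16]
      SSM_count_square[of 17] SSM_count_square[of 18] SSM_count_square[of 23] SSM_count_square[of 25]
      num_SSM_values(1-12) by simp_all
qed (use SSM_indices multiplicative_SSM_count summable_nonzero_ideals SSM_count_small_zero in blast)+

end
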